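(* Assume that: (i) $x\in\mathbb{X}\mapsto\bm{\mu}_x\in\mathcal{P}(\mathbb{N}^d)^d$ is continuous; (ii) $0\le \mu_x^{(i)}(\bm{0})+\sum_{j=1}^d\mu_x^{(i)}(\bm{e}_j)<1$ for all $x\in\mathbb{X}$ and $i\in\{1,\dots,d\}$; (iii) there exist constants $0<C\le D<+\infty$ such that, for all $x\in\mathbb{X}$, $C\le\min_{i,j}m_{ij}(x)\le\max_{i,j}m_{ij}(x)\le D$ and $\max_{i,j,k}\frac{\partial^2\varphi_k}{\partial s_i\partial s_j}(x,\bm{1})\le D$; (iv) $\pi_\nu>0$ for every $T$-invariant ergodic Borel probability measure $\nu$ on $\mathbb{X}$. Then the map $x\in\mathbb{X}\mapsto\bm{q}(x)\in[0,1]^d$ is continuous.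
   Context: Setting. $\mathbb{N}=\{0,1,2,\dots\}$; $d\ge1$ is a fixed integer (the number of types); $\mathbb{X}$ is a compact metric space with its Borel $\sigma$-algebra and $T:\mathbb{X}\to\mathbb{X}$ is continuous. $\mathcal{P}(\mathbb{N}^d)$ is the set of probability measures on $\mathbb{N}^d$ with the topology of weak convergence (equivalently, of the $\ell^1$ distance). To each $x\in\mathbb{X}$ is associated $\bm{\mu}_x=(\mu_x^{(1)},\dots,\mu_x^{(d)})\in\mathcal{P}(\mathbb{N}^d)^d$. $\bm{e}_i$ is the $i$-th canonical basis vector, $\bm{0}=(0,\dots,0)$, $\bm{1}=(1,\dots,1)$. Process. For $x\in\mathbb{X}$, the multi-type Galton-Watson process in dynamical environments is the sequence $(\bm{Z}_n(x))_{n\in\mathbb{N}}$ in $\mathbb{N}^d$ with deterministic $\bm{Z}_0\in\mathbb{N}^d$ and, for each type $j$, $Z_{n+1}^{(j)}=\sum_{i=1}^d\sum_{k=1}^{Z_n^{(i)}}Y_{n,k}^{(i,j)}$, where the random vectors $\bm{Y}_{n,k}^{(i)}=(Y_{n,k}^{(i,1)},\dots,Y_{n,k}^{(i,d)})$ are independent and $\bm{Y}_{n,k}^{(i)}$ has law $\mu_{T^nx}^{(i)}$. Generating function. For $\bm{s}\in[0,1]^d$ and $\bm{k}\in\mathbb{N}^d$ write $\bm{s}^{\bm{k}}=\prod_j s_j^{k_j}$ (with $0^0=1$), and $\varphi_i(x,\bm{s})=\sum_{\bm{k}\in\mathbb{N}^d}\mu_x^{(i)}(\bm{k})\bm{s}^{\bm{k}}$.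 Derivatives at $\bm{1}$ are one-sided, i.e. they are the corresponding factorial moments. Mean matrix. $M(x)=(m_{ij}(x))_{1\le i,j\le d}$ with $m_{ij}(x)=\frac{\partial\varphi_j}{\partial s_i}(x,\bm{1})$, the expected number of offspring of type $i$ of an individual of type $j$ in environment $x$. The matrix norm is $\|A\|=\max_i\sum_j|a_{ij}|$. For a $T$-invariant ergodic probability measure $\nu$, $\pi_\nu=\lim_{n\to\infty}\frac1n\int_{\mathbb{X}}\ln\|M(T^{n-1}x)\cdots M(x)\|\,d\nu(x)$; under (i)-(iii) this limit exists and is finite. Extinction. $q_i(x)=\mathbb{P}\big(\bigcup_{n\ge0}\{\bm{Z}_n(x)=\bm{0}\}\mid\bm{Z}_0=\bm{e}_i\big)$ and $\bm{q}=(q_1,\dots,q_d)$. *)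

theory Defs
  imports "HOL-Probability.Probability"
begin

text \<open>
  The type \<open>'d\<close> is the finite set of types of individuals, so \<open>nat ^ 'd\<close> is \<open>\<nat>\<^sup>d\<close> and
  \<open>axis i 1\<close> is its \<open>i\<close>-th canonical basis vector. Probability measures on \<open>\<nat>\<^sup>d\<close> are
  \<open>(nat ^ 'd) pmf\<close>, and an environment assigns to each \<open>x\<close> a family \<open>\<mu> x :: 'd \<Rightarrow> (nat ^ 'd) pmf\<close>.
\<close>

text \<open>
  Topology of weak convergence for probability measures on the discrete space \<open>'a\<close>: the coarsest one
  making \<open>p \<mapsto> \<integral> f dp\<close> continuous for all bounded \<open>f\<close> (every \<open>f\<close> is continuous on a discrete space).
\<close>

definition weak_pmf_topology :: "'a pmf topology" where
  "weak_pmf_topology = topology_generated_by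
     {{p. measure_pmf.expectation p f \<in> U} | (f :: 'a \<Rightarrow> real) U. bounded (range f) \<and> open U}"

subsection \<open>Generating functions and the mean matrix\<close>

definition gen_fun :: "(nat ^ 'd::finite) pmf \<Rightarrow> real ^ 'd \<Rightarrow> real" where
  "gen_fun p s = (\<Sum>\<^sub>\<infinity>k\<in>UNIV. pmf p k * (\<Prod>j\<in>UNIV. (s $ j) ^ (k $ j)))"

definition line_fun :: "'d::finite \<Rightarrow> (real ^ 'd \<Rightarrow> real) \<Rightarrow> real ^ 'd \<Rightarrow> real \<Rightarrow> real" where
  "line_fun i f s = (\<lambda>t. f (\<chi> l. if l = i then t else s $ l))"

text \<open>
  Partial derivatives of functions on the cube \<open>[0,1]\<^sup>d\<close>; on its boundary they are one-sided.
  The value of \<open>partial_deriv\<close> is meaningful only where \<open>partial_differentiable\<close> holds.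
\<close>

definition partial_differentiable :: "'d::finite \<Rightarrow> (real ^ 'd \<Rightarrow> real) \<Rightarrow> real ^ 'd \<Rightarrow> bool" where
  "partial_differentiable i f s \<longleftrightarrow> line_fun i f s differentiable (at (s $ i) within {0..1})"

definition partial_deriv :: "'d::finite \<Rightarrow> (real ^ 'd \<Rightarrow> real) \<Rightarrow> real ^ 'd \<Rightarrow> real" where
  "partial_deriv i f s = vector_derivative (line_fun i f s) (at (s $ i) within {0..1})"

definition mean_matrix :: "('x \<Rightarrow> 'd::finite \<Rightarrow> (nat ^ 'd) pmf) \<Rightarrow> 'x \<Rightarrow> real ^ 'd ^ 'd" where
  "mean_matrix \<mu> x = (\<chi> i j. partial_deriv i (gen_fun (\<mu> x j)) 1)"

definition row_sum_norm :: "real ^ 'd ^ 'd::finite \<Rightarrow> real" where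
  "row_sum_norm A = Max (range (\<lambda>i. \<Sum>j\<in>UNIV. \<bar>A $ i $ j\<bar>))"

primrec mean_cocycle ::
  "('x \<Rightarrow> 'd::finite \<Rightarrow> (nat ^ 'd) pmf) \<Rightarrow> ('x \<Rightarrow> 'x) \<Rightarrow> nat \<Rightarrow> 'x \<Rightarrow> real ^ 'd ^ 'd" where
  "mean_cocycle \<mu> T 0 x = mat 1"
| "mean_cocycle \<mu> T (Suc n) x = mean_matrix \<mu> ((T ^^ n) x) ** mean_cocycle \<mu> T n x"

subsection \<open>Invariant ergodic measures and the Lyapunov exponent\<close>

definition invariant_prob :: "('x::topological_space \<Rightarrow> 'x) \<Rightarrow> 'x measure \<Rightarrow> bool" where
  "invariant_prob T \<nu> \<longleftrightarrow> prob_space \<nu> \<and> sets \<nu> = sets borel \<and>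
     T \<in> borel_measurable borel \<and> distr \<nu> borel T = \<nu>"

definition ergodic_prob :: "('x::topological_space \<Rightarrow> 'x) \<Rightarrow> 'x measure \<Rightarrow> bool" where
  "ergodic_prob T \<nu> \<longleftrightarrow> invariant_prob T \<nu> \<and>
     (\<forall>A\<in>sets borel. T -` A = A \<longrightarrow> measure \<nu> A = 0 \<or> measure \<nu> A = 1)"

definition lyapunov_exponent ::
  "('x::topological_space \<Rightarrow> 'd::finite \<Rightarrow> (nat ^ 'd) pmf) \<Rightarrow> ('x \<Rightarrow> 'x) \<Rightarrow> 'x measure \<Rightarrow> real" where
  "lyapunov_exponent \<mu> T \<nu> =
     lim (\<lambda>n. 1 / real n * (\<integral>x. ln (row_sum_norm (mean_cocycle \<mu> T n x)) \<partial>\<nu>))"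

subsection \<open>The process and its extinction probabilities\<close>

text \<open>
  The offspring vectors are the coordinates of a product space: \<open>\<omega> (n, i, k)\<close> is the offspring of the
  \<open>k\<close>-th individual of type \<open>i\<close> in generation \<open>n\<close>, with individuals numbered from \<open>0\<close>.
  Under \<open>offspring_measure \<mu> T x\<close> they are independent, with law \<open>\<mu> (T\<^sup>n x) i\<close>.
\<close>

definition offspring_measure ::
  "('x \<Rightarrow> 'd::finite \<Rightarrow> (nat ^ 'd) pmf) \<Rightarrow> ('x \<Rightarrow> 'x) \<Rightarrow> 'x \<Rightarrow> (nat \<times> 'd \<times> nat \<Rightarrow> nat ^ 'd) measure" where
  "offspring_measure \<mu> T x = (\<Pi>\<^sub>M (n, i, k)\<in>UNIV. measure_pmf (\<mu> ((T ^^ n) x) i))"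

primrec gw_process ::
  "nat ^ 'd::finite \<Rightarrow> (nat \<times> 'd \<times> nat \<Rightarrow> nat ^ 'd) \<Rightarrow> nat \<Rightarrow> nat ^ 'd" where
  "gw_process z \<omega> 0 = z"
| "gw_process z \<omega> (Suc n) = (\<chi> j. \<Sum>i\<in>UNIV. \<Sum>k<gw_process z \<omega> n $ i. \<omega> (n, i, k) $ j)"

definition extinction_prob ::
  "('x \<Rightarrow> 'd::finite \<Rightarrow> (nat ^ 'd) pmf) \<Rightarrow> ('x \<Rightarrow> 'x) \<Rightarrow> 'x \<Rightarrow> real ^ 'd" where
  "extinction_prob \<mu> T x =
     (\<chi> i. measure (offspring_measure \<mu> T x) (\<Union>n. {\<omega>. gw_process (axis i 1) \<omega> n = 0}))"

end

theory Submission
  imports Defs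
begin

text \<open>
  The extinction probability is the limit of the probabilities of being extinct at time \<open>n\<close>, each of
  which depends continuously on the environment. The point is that the convergence is uniform.

  In survival coordinates, the probability \<open>P\<^sub>n(x)\<close> of being alive at time \<open>n\<close> is the image of the
  vector \<open>1\<close> under the composition of the survival maps \<open>F\<^sub>x(s) = 1 - \<phi>(x, 1 - s)\<close> along the orbit of
  \<open>x\<close>. These maps are monotone and concave with \<open>F\<^sub>x(0) = 0\<close>. Having at least two children has a
  probability bounded below, by nondegeneracy and compactness, so the concavity is uniformly strict
  at vectors with entries bounded below. Suppose that all \<open>P\<^sub>n(x)\<close> have entries at least \<open>e > 0\<close>, and let
  \<open>R\<^sub>n(x)\<close> be the iterates that start from the vector with entries \<open>e\<close>. Strict concavity forces the
  ratio of \<open>R\<^sub>n\<close> to \<open>P\<^sub>n\<close> to tend to \<open>1\<close> geometrically fast and uniformly in \<open>x\<close>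
  (\<open>surv_iter_ratio\<close>). As \<open>R\<^sub>n \<le> P\<^sub>m \<le> P\<^sub>n\<close> for all \<open>m \<ge> n\<close>, the convergence is uniform.

  It remains to bound \<open>P\<^sub>n\<close> from below (\<open>uniform_survival\<close>). Near the origin \<open>F\<^sub>x(s)\<close> is close to the
  row vector \<open>s M(x)\<close>, with a relative error controlled by the second moments. So it suffices that for
  some \<open>N\<close> the \<open>N\<close>-step mean matrices have column sums at least \<open>2\<close> at every point of the space
  (\<open>column_sums_growth\<close>). The entries of \<open>M\<close> lie between \<open>C\<close> and \<open>D\<close>, so the logarithm of the norm of
  the \<open>n\<close>-step matrix is additive along orbits up to a bounded error. For such functions
  \<open>almost_additive_growth\<close> turns the hypothesis on ergodic measures into uniform growth. The growth rate
  is a continuous affine function on the compact convex set of invariant positive functionals on the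
  continuous functions; it attains its minimum at an extreme point. By the Riesz representation theorem
  this is integration against a measure, and extremality makes the measure ergodic, so the minimum is
  positive. If growth failed at some points for longer and longer times, then averages along their
  orbits would accumulate at an invariant functional with too small a rate.
\<close>

section \<open>Positive functionals on continuous functions\<close>

text \<open>
  The functionals act on plain functions rather than on a Banach space of continuous functions;
  continuity is therefore a premise of each law, and nothing is said about other arguments.
\<close>

definition mean_functional :: "(('x::topological_space \<Rightarrow> real) \<Rightarrow> real) \<Rightarrow> bool" where
  "mean_functional L \<longleftrightarrow>
     L (\<lambda>_. 1) = 1 \<and>
     (\<forall>f g. continuous_on UNIV f \<longrightarrow> continuous_on UNIV g \<longrightarrow> L (\<lambda>x. f x + g x) = L f + L g) \<and>
     (\<forall>c f. continuous_on UNIV f \<longrightarrow> L (\<lambda>x. c * f x) = c * L f) \<and>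
     (\<forall>f. continuous_on UNIV f \<longrightarrow> (\<forall>x. 0 \<le> f x) \<longrightarrow> 0 \<le> L f)"

lemma mean_functionalD:
  assumes "mean_functional L"
  shows "L (\<lambda>_. 1) = 1"
    "\<And>f g. continuous_on UNIV f \<Longrightarrow> continuous_on UNIV g \<Longrightarrow> L (\<lambda>x. f x + g x) = L f + L g"
    "\<And>c f. continuous_on UNIV f \<Longrightarrow> L (\<lambda>x. c * f x) = c * L f"
    "\<And>f. continuous_on UNIV f \<Longrightarrow> (\<And>x. 0 \<le> f x) \<Longrightarrow> 0 \<le> L f"
  using assms unfolding mean_functional_def by blast+

lemma mean_functional_const: "mean_functional L \<Longrightarrow> L (\<lambda>_. c) = c"
  using mean_functionalD(3)[of L "\<lambda>_. 1" c] by (simp add: mean_functionalD(1))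

lemma mean_functional_diff:
  assumes "mean_functional L" "continuous_on UNIV f" "continuous_on UNIV g"
  shows "L (\<lambda>x. f x - g x) = L f - L g"
proof -
  have "L (\<lambda>x. f x + (-1) * g x) = L f + L (\<lambda>x. (-1) * g x)"
    by (rule mean_functionalD(2)[OF assms(1,2)]) (intro continuous_intros assms)
  also have "L (\<lambda>x. (-1) * g x) = (-1) * L g"
    by (rule mean_functionalD(3)[OF assms(1,3)])
  finally show ?thesis by simp
qed

lemma mean_functional_mono:
  assumes "mean_functional L" "continuous_on UNIV f" "continuous_on UNIV g" "\<And>x. f x \<le> g x"
  shows "L f \<le> L g"
proof -
  have "0 \<le> L (\<lambda>x. g x - f x)"
    using assms by (intro mean_functionalD(4)[OF assms(1)]) (auto intro!: continuous_intros)
  with mean_functional_diff[OF assms(1,3,2)] show ?thesis by simp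
qed

lemma mean_functional_sum:
  assumes "mean_functional L" "\<And>i. i \<in> I \<Longrightarrow> continuous_on UNIV (f i)" "finite I"
  shows "L (\<lambda>x. \<Sum>i\<in>I. f i x) = (\<Sum>i\<in>I. L (f i))"
  using assms(3,2)
proof (induction I rule: finite_induct)
  case empty
  then show ?case using mean_functional_const[OF assms(1), of 0] by simp
next
  case (insert i I)
  then have "L (\<lambda>x. f i x + (\<Sum>j\<in>I. f j x)) = L (f i) + L (\<lambda>x. \<Sum>j\<in>I. f j x)"
    by (intro mean_functionalD(2)[OF assms(1)]) (auto intro!: continuous_intros)
  with insert show ?case by simp
qed

text \<open>
  The mass that a representing measure has to give to an open set, by approximation from below
  with continuous functions.
\<close>

definition open_mass :: "(('x::topological_space \<Rightarrow> real) \<Rightarrow> real) \<Rightarrow> 'x set \<Rightarrow> ennreal" where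
  "open_mass L U = (SUP f\<in>{f. continuous_on UNIV f \<and> (\<forall>x. 0 \<le> f x \<and> f x \<le> indicator U x)}. ennreal (L f))"

definition functional_outer :: "(('x::topological_space \<Rightarrow> real) \<Rightarrow> real) \<Rightarrow> 'x set \<Rightarrow> ennreal" where
  "functional_outer L A = (INF U\<in>{U. open U \<and> A \<subseteq> U}. open_mass L U)"

lemma open_mass_upper:
  "continuous_on UNIV f \<Longrightarrow> (\<And>x. 0 \<le> f x) \<Longrightarrow> (\<And>x. f x \<le> indicator U x) \<Longrightarrow> ennreal (L f) \<le> open_mass L U"
  unfolding open_mass_def by (rule SUP_upper) auto

lemma open_mass_mono: "U \<subseteq> V \<Longrightarrow> open_mass L U \<le> open_mass L V"
  unfolding open_mass_def
proof (intro SUP_subset_mono order_refl subsetI CollectI conjI allI)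
  fix f :: "'a \<Rightarrow> real" and x
  assume UV: "U \<subseteq> V" and f: "f \<in> {f. continuous_on UNIV f \<and> (\<forall>x. 0 \<le> f x \<and> f x \<le> indicator U x)}"
  show "continuous_on UNIV f" "0 \<le> f x" using f by blast+
  have "f x \<le> indicator U x" using f by blast
  also have "indicator U x \<le> (indicator V x :: real)" using UV by (auto simp: indicator_def)
  finally show "f x \<le> indicator V x" .
qed

lemma open_mass_empty: "mean_functional L \<Longrightarrow> open_mass L {} = 0"
proof -
  assume L: "mean_functional L"
  have "L f = 0" if "\<forall>x. 0 \<le> f x \<and> f x \<le> indicator {} x" for f :: "'a \<Rightarrow> real"
  proof -
    have "f = (\<lambda>_. 0)" using that by (auto simp: fun_eq_iff antisym)
    then show ?thesis using mean_functional_const[OF L, of 0] by simp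
  qed
  then have "open_mass L {} \<le> 0"
    unfolding open_mass_def by (intro SUP_least) auto
  then show ?thesis by simp
qed

lemma open_mass_UNIV:
  assumes L: "mean_functional L"
  shows "open_mass L UNIV = 1"
proof (rule antisym)
  show "open_mass L UNIV \<le> 1"
    unfolding open_mass_def
  proof (intro SUP_least, safe)
    fix f :: "'a \<Rightarrow> real" assume "continuous_on UNIV f" "\<forall>x. 0 \<le> f x \<and> f x \<le> indicator UNIV x"
    then have "L f \<le> L (\<lambda>_. 1)" by (intro mean_functional_mono[OF L]) auto
    then show "ennreal (L f) \<le> 1"
      using mean_functionalD(1)[OF L] by (simp add: ennreal_le_1)
  qed
  show "1 \<le> open_mass L UNIV"
    using open_mass_upper[of "\<lambda>_. 1" UNIV L] mean_functionalD(1)[OF L] by simp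
qed

text \<open>
  Continuous functions increasing to the indicator of an open set. Since the distance to the empty
  set is \<open>0\<close> by convention, the whole space is a separate case.
\<close>

definition bump :: "'x::metric_space set \<Rightarrow> nat \<Rightarrow> 'x \<Rightarrow> real" where
  "bump U m x = (if U = UNIV then 1 else min 1 (real m * infdist x (- U)))"

lemma bump_props:
  assumes "open U"
  shows "continuous_on UNIV (bump U m)" "0 \<le> bump U m x" "bump U m x \<le> indicator U x"
    "m \<le> m' \<Longrightarrow> bump U m x \<le> bump U m' x"
    "x \<in> U \<Longrightarrow> \<exists>m. \<forall>k\<ge>m. bump U k x = 1"
proof -
  show "continuous_on UNIV (bump U m)"
    unfolding bump_def by (cases "U = UNIV") (auto intro!: continuous_intros)
  show "0 \<le> bump U m x"
    by (auto simp: bump_def infdist_nonneg)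
  show "bump U m x \<le> indicator U x"
    by (auto simp: bump_def indicator_def infdist_nonneg)
  show "bump U m x \<le> bump U m' x" if "m \<le> m'"
  proof -
    have "real m * infdist x (- U) \<le> real m' * infdist x (- U)"
      using that by (intro mult_right_mono) (auto simp: infdist_nonneg)
    then show ?thesis by (auto simp: bump_def)
  qed
  show "\<exists>m. \<forall>k\<ge>m. bump U k x = 1" if "x \<in> U"
  proof (cases "U = UNIV")
    case False
    have "closed (- U)" using assms by (simp add: closed_def)
    then have pos: "infdist x (- U) > 0"
      using that False by (intro infdist_pos_not_in_closed) auto
    obtain m where m: "1 < real m * infdist x (- U)"
      using reals_Archimedean3[OF pos] by blast
    have "bump U k x = 1" if "k \<ge> m" for k
    proof -
      have "real m * infdist x (- U) \<le> real k * infdist x (- U)"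
        using that by (intro mult_right_mono) (auto simp: infdist_nonneg)
      then show ?thesis using m False by (simp add: bump_def)
    qed
    then show ?thesis by blast
  qed (simp add: bump_def)
qed

text \<open>
  Compactness replaces countably many sets by finitely many. If \<open>f\<close> is below the indicator of the
  union, then the open sets \<open>W m\<close> on which \<open>f - e\<close> is less than the sum of the first \<open>m\<close> bump
  functions increase and cover the space, so one of them is the whole space.
\<close>

lemma open_mass_countably_subadditive:
  fixes U :: "nat \<Rightarrow> 'x::metric_space set"
  assumes X: "compact (UNIV :: 'x set)" and L: "mean_functional L" and U: "\<And>n. open (U n)"
  shows "open_mass L (\<Union>n. U n) \<le> (\<Sum>n. open_mass L (U n))"
  unfolding open_mass_def[of L "\<Union>n. U n"]
proof (intro SUP_least, safe)
  fix f :: "'x \<Rightarrow> real"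
  assume f: "continuous_on UNIV f" and f01: "\<forall>x. 0 \<le> f x \<and> f x \<le> indicator (\<Union>n. U n) x"
  show "ennreal (L f) \<le> (\<Sum>n. open_mass L (U n))"
  proof (rule ennreal_le_epsilon)
    fix e :: real assume e: "0 < e"
    let ?S = "\<lambda>m x. \<Sum>n\<le>m. bump (U n) m x"
    define W where "W m = {x. f x - e < ?S m x}" for m
    have cont: "continuous_on UNIV (?S m)" for m
      using bump_props(1)[OF U] by (intro continuous_intros) auto
    have "open (W m)" for m
      unfolding W_def by (intro open_Collect_less continuous_intros f cont)
    moreover have "UNIV \<subseteq> (\<Union>m. W m)"
    proof
      fix x
      show "x \<in> (\<Union>m. W m)"
      proof (cases "x \<in> (\<Union>n. U n)")
        case True
        then obtain n where n: "x \<in> U n" by blast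
        obtain m where m: "\<forall>k\<ge>m. bump (U n) k x = 1" using bump_props(5)[OF U n] by blast
        have "f x \<le> 1" using f01 by (auto simp: indicator_def split: if_splits intro: order_trans)
        moreover have "bump (U n) (max m n) x \<le> ?S (max m n) x"
          by (rule member_le_sum) (auto simp: bump_props(2)[OF U])
        ultimately have "x \<in> W (max m n)" using m e by (auto simp: W_def)
        then show ?thesis by blast
      next
        case False
        then have "f x \<le> 0" using f01[rule_format, of x] by simp
        moreover have "0 \<le> ?S 0 x" by (intro sum_nonneg bump_props(2)[OF U])
        ultimately have "x \<in> W 0" using e by (simp add: W_def)
        then show ?thesis by blast
      qed
    qed
    ultimately obtain M where M: "finite M" "UNIV \<subseteq> (\<Union>m\<in>M. W m)"
      using compactE_image[OF X, of UNIV W] by (metis UNIV_I)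
    have Wmono: "W m \<subseteq> W m'" if "m \<le> m'" for m m'
    proof
      fix x assume "x \<in> W m"
      moreover have "?S m x \<le> ?S m' x"
      proof -
        have "?S m x \<le> (\<Sum>n\<le>m. bump (U n) m' x)"
          using that by (intro sum_mono bump_props(4)[OF U])
        also have "\<dots> \<le> ?S m' x"
          using that by (intro sum_mono2) (auto simp: bump_props(2)[OF U])
        finally show ?thesis .
      qed
      ultimately show "x \<in> W m'" by (auto simp: W_def)
    qed
    obtain m where m: "\<And>k. k \<in> M \<Longrightarrow> k \<le> m"
      using M(1) by (meson finite_nat_set_iff_bounded_le)
    have "x \<in> W m" for x using M(2) Wmono m by blast
    then have le: "f x \<le> ?S m x + e" for x by (auto simp: W_def less_imp_le algebra_simps)
    have "L f \<le> L (\<lambda>x. ?S m x + e)"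
      using le by (intro mean_functional_mono[OF L] f continuous_intros cont)
    also have "\<dots> = L (?S m) + e"
      using mean_functionalD(2)[OF L cont, of "\<lambda>_. e" m] mean_functional_const[OF L, of e] by simp
    also have "L (?S m) = (\<Sum>n\<le>m. L (bump (U n) m))"
      by (rule mean_functional_sum[OF L]) (auto simp: bump_props(1)[OF U])
    finally have "ennreal (L f) \<le> ennreal ((\<Sum>n\<le>m. L (bump (U n) m)) + e)"
      by (rule ennreal_leI)
    also have nn: "0 \<le> L (bump (U n) m)" for n
      by (rule mean_functionalD(4)[OF L]) (auto simp: bump_props[OF U])
    then have "ennreal ((\<Sum>n\<le>m. L (bump (U n) m)) + e) = (\<Sum>n\<le>m. ennreal (L (bump (U n) m))) + e"
      using e by (subst ennreal_plus) (auto intro!: sum_nonneg simp: sum_ennreal)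
    also have "\<dots> \<le> (\<Sum>n\<le>m. open_mass L (U n)) + e"
      by (intro add_right_mono sum_mono open_mass_upper) (auto simp: bump_props[OF U])
    also have "\<dots> \<le> (\<Sum>n. open_mass L (U n)) + e"
      by (intro add_right_mono sum_le_suminf) auto
    finally show "ennreal (L f) \<le> (\<Sum>n. open_mass L (U n)) + ennreal e" .
  qed
qed

lemma functional_outer_open: "open U \<Longrightarrow> functional_outer L U = open_mass L U"
  unfolding functional_outer_def
proof (rule antisym)
  assume "open U"
  then show "(INF V\<in>{V. open V \<and> U \<subseteq> V}. open_mass L V) \<le> open_mass L U"
    by (intro INF_lower) simp
  show "open_mass L U \<le> (INF V\<in>{V. open V \<and> U \<subseteq> V}. open_mass L V)"
    by (rule INF_greatest) (simp add: open_mass_mono)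
qed

lemma functional_outer_mono: "A \<subseteq> B \<Longrightarrow> functional_outer L A \<le> functional_outer L B"
  unfolding functional_outer_def by (intro INF_superset_mono order_refl) blast

text \<open>
  For arbitrary sets, countable subadditivity is inherited from open sets: the \<open>n\<close>-th set is
  enclosed in an open set whose mass exceeds its outer mass by at most \<open>e / 2 ^ (n + 1)\<close>.
\<close>

lemma outer_measure_space_functional_outer:
  assumes X: "compact (UNIV :: 'x::metric_space set)" and L: "mean_functional L"
  shows "outer_measure_space (UNIV :: 'x set set) (functional_outer L)"
  unfolding outer_measure_space_def
proof (intro conjI)
  show "positive UNIV (functional_outer L)"
    by (simp add: positive_def functional_outer_open open_mass_empty[OF L])
  show "increasing UNIV (functional_outer L)"
    by (simp add: increasing_def functional_outer_mono)
  show "countably_subadditive UNIV (functional_outer L)"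
    unfolding countably_subadditive_def
  proof safe
    fix A :: "nat \<Rightarrow> 'x set"
    show "functional_outer L (\<Union>i. A i) \<le> (\<Sum>i. functional_outer L (A i))"
    proof (rule ennreal_le_epsilon)
      fix e :: real assume e: "0 < e" and fin: "(\<Sum>i. functional_outer L (A i)) < top"
      have "\<exists>V. open V \<and> A n \<subseteq> V \<and> open_mass L V \<le> functional_outer L (A n) + e * (1/2)^Suc n" for n
      proof -
        have "functional_outer L (A n) < top" using fin by (rule ennreal_suminf_lessD)
        then have "functional_outer L (A n) < functional_outer L (A n) + e * (1/2)^Suc n"
          using e by (auto simp: less_top)
        then obtain V where "open V" "A n \<subseteq> V" "open_mass L V < functional_outer L (A n) + e * (1/2)^Suc n"
          unfolding functional_outer_def[of L "A n"] INF_less_iff by blast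
        then show ?thesis by (blast intro: less_imp_le)
      qed
      then obtain V where V: "\<And>n. open (V n)" "\<And>n. A n \<subseteq> V n"
        "\<And>n. open_mass L (V n) \<le> functional_outer L (A n) + e * (1/2)^Suc n" by metis
      have "functional_outer L (\<Union>i. A i) \<le> functional_outer L (\<Union>i. V i)"
        using V(2) by (intro functional_outer_mono) blast
      also have "\<dots> = open_mass L (\<Union>i. V i)" using V(1) by (intro functional_outer_open) auto
      also have "\<dots> \<le> (\<Sum>n. open_mass L (V n))"
        by (rule open_mass_countably_subadditive[OF X L V(1)])
      also have "\<dots> \<le> (\<Sum>n. functional_outer L (A n) + e * (1/2)^Suc n)"
        by (intro suminf_le V(3)) auto
      also have "... = (\<Sum>n. functional_outer L (A n)) + (\<Sum>n. ennreal e * ennreal ((1/2) ^ Suc n))"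
        using e by (subst suminf_add[symmetric])
           (auto simp del: ennreal_suminf_cmult simp add: ennreal_mult[symmetric])
      also have "\<dots> = (\<Sum>n. functional_outer L (A n)) + e"
        unfolding ennreal_suminf_cmult
        by (subst suminf_ennreal_eq[OF zero_le_power power_half_series]) auto
      finally show "functional_outer L (\<Union>i. A i) \<le> (\<Sum>i. functional_outer L (A i)) + ennreal e" .
    qed
  qed
qed

text \<open>
  The nontrivial half of Caratheodory's criterion. If \<open>f\<close> is below the indicator of \<open>V \<inter> U\<close>, then
  the points of \<open>V\<close> with \<open>f < e\<close> form an open set \<open>W\<close> that contains \<open>V - U\<close>. For \<open>g\<close> below the
  indicator of \<open>W\<close>, the functions \<open>max 0 (f - e)\<close> and \<open>g\<close> are never positive at the same point, so
  their sum is still below the indicator of \<open>V\<close>.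
\<close>

lemma open_mass_split:
  fixes U V :: "'x::metric_space set"
  assumes L: "mean_functional L" and U: "open U" and V: "open V"
  shows "open_mass L (V \<inter> U) + functional_outer L (V - U) \<le> open_mass L V"
proof -
  have key: "ennreal (L f) + functional_outer L (V - U) \<le> open_mass L V"
    if f: "continuous_on UNIV f" "\<forall>x. 0 \<le> f x \<and> f x \<le> indicator (V \<inter> U) x" for f
  proof (rule ennreal_le_epsilon)
    fix e :: real assume e: "0 < e"
    define W where "W = V \<inter> {x. f x < e}"
    have "open {x. f x < e}" by (rule open_Collect_less[OF f(1) continuous_on_const])
    with V have W: "open W" unfolding W_def by (rule open_Int)
    have "V - U \<subseteq> W"
    proof
      fix x assume x: "x \<in> V - U"
      then have "f x \<le> 0" using f(2)[rule_format, of x] by simp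
      then show "x \<in> W" using x e by (simp add: W_def)
    qed
    then have "functional_outer L (V - U) \<le> open_mass L W"
      unfolding functional_outer_open[OF W, symmetric] by (rule functional_outer_mono)
    moreover have "ennreal (L f) + open_mass L W \<le> open_mass L V + e"
    proof -
      have "ennreal (L f) + ennreal (L g) \<le> open_mass L V + e"
        if g: "continuous_on UNIV g" "\<forall>x. 0 \<le> g x \<and> g x \<le> indicator W x" for g
      proof -
        let ?h = "\<lambda>x. max 0 (f x - e) + g x"
        have ch: "continuous_on UNIV ?h" by (intro continuous_intros f g)
        have hV: "0 \<le> ?h x \<and> ?h x \<le> indicator V x" for x
        proof (cases "x \<in> W")
          case True
          then show ?thesis using g(2)[rule_format, of x] by (auto simp: W_def)
        next
          case False
          then have "g x = 0" using g(2)[rule_format, of x] by simp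
          moreover have "f x \<le> indicator V x"
            using f(2)[rule_format, of x] by (cases "x \<in> U") (auto simp: indicator_def split: if_splits)
          ultimately show ?thesis using e by (auto simp: indicator_def)
        qed
        have nf: "0 \<le> L f" "0 \<le> L g" using f g by (auto intro!: mean_functionalD(4)[OF L])
        have "L f + L g = L (\<lambda>x. f x + g x)"
          using mean_functionalD(2)[OF L f(1) g(1)] by simp
        also have "\<dots> \<le> L (\<lambda>x. ?h x + e)"
          by (intro mean_functional_mono[OF L] continuous_intros f g) auto
        also have "\<dots> = L ?h + e"
          using mean_functionalD(2)[OF L ch, of "\<lambda>_. e"] mean_functional_const[OF L, of e] by simp
        finally have "ennreal (L f + L g) \<le> ennreal (L ?h + e)" by (rule ennreal_leI)
        moreover have "0 \<le> L ?h" using ch hV by (intro mean_functionalD(4)[OF L]) auto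
        ultimately have "ennreal (L f) + ennreal (L g) \<le> ennreal (L ?h) + e"
          using nf e by (simp add: ennreal_plus)
        also have "ennreal (L ?h) \<le> open_mass L V"
          using hV by (intro open_mass_upper ch) auto
        finally show ?thesis by (simp add: add_right_mono)
      qed
      note A = this
      have ne: "{f. continuous_on UNIV f \<and> (\<forall>x. 0 \<le> f x \<and> f x \<le> indicat_real W x)} \<noteq> {}"
        by (auto intro!: exI[of _ "\<lambda>_. 0"])
      have "open_mass L W + ennreal (L f) \<le> open_mass L V + e"
        unfolding open_mass_def[of L W]
        by (subst ennreal_SUP_add_left[OF ne, symmetric])
          (auto intro!: SUP_least A simp: add.commute[of _ "ennreal (L f)"])
      then show ?thesis by (simp add: add.commute)
    qed
    ultimately show "ennreal (L f) + functional_outer L (V - U) \<le> open_mass L V + ennreal e"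
      by (meson add_left_mono order_trans)
  qed
  have ne: "{f. continuous_on UNIV f \<and> (\<forall>x. 0 \<le> f x \<and> f x \<le> indicat_real (V \<inter> U) x)} \<noteq> {}"
    by (auto intro!: exI[of _ "\<lambda>_. 0"])
  show ?thesis
    unfolding open_mass_def[of L "V \<inter> U"]
    by (subst ennreal_SUP_add_left[OF ne, symmetric]) (auto intro!: SUP_least key)
qed

lemma open_in_lambda_system:
  fixes U :: "'x::metric_space set"
  assumes X: "compact (UNIV :: 'x set)" and L: "mean_functional L" and U: "open U"
  shows "U \<in> lambda_system UNIV UNIV (functional_outer L)"
proof -
  interpret algebra "UNIV::'x set" UNIV using algebra_Pow[of "UNIV::'x set"] by simp
  have "functional_outer L (A \<inter> U) + functional_outer L (A - U) = functional_outer L A" for A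
  proof (rule antisym)
    show "functional_outer L (A \<inter> U) + functional_outer L (A - U) \<le> functional_outer L A"
      unfolding functional_outer_def[of L A]
    proof (intro INF_greatest, safe)
      fix V assume V: "open V" "A \<subseteq> V"
      have "functional_outer L (A \<inter> U) + functional_outer L (A - U)
        \<le> functional_outer L (V \<inter> U) + functional_outer L (V - U)"
        using V by (intro add_mono functional_outer_mono) auto
      also have "\<dots> \<le> open_mass L V"
        using open_mass_split[OF L U V(1)] U V(1) by (simp add: functional_outer_open open_Int)
      finally show "functional_outer L (A \<inter> U) + functional_outer L (A - U) \<le> open_mass L V" .
    qed
    have sub: "subadditive UNIV (functional_outer L)"
      using outer_measure_space_functional_outer[OF X L] countably_subadditive_subadditive
      unfolding outer_measure_space_def by blast
    have "functional_outer L ((A \<inter> U) \<union> (A - U)) \<le> functional_outer L (A \<inter> U) + functional_outer L (A - U)"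
      by (rule subadditiveD[OF sub]) auto
    then show "functional_outer L A \<le> functional_outer L (A \<inter> U) + functional_outer L (A - U)"
      by (simp only: Int_Diff_Un)
  qed
  then show ?thesis by (simp add: lambda_system_eq)
qed

text \<open>
  The Riesz-Markov theorem on a compact metric space. The measure is the outer measure restricted
  to Borel sets. For \<open>0 \<le> f \<le> 1\<close>, cutting \<open>f\<close> into thin layers shows that \<open>L f\<close> is at most the
  integral; the same bound for \<open>1 - f\<close> is the reverse inequality.
\<close>

theorem Riesz_representation:
  fixes L :: "('x::metric_space \<Rightarrow> real) \<Rightarrow> real"
  assumes X: "compact (UNIV :: 'x set)" and L: "mean_functional L"
  obtains \<nu> where "prob_space \<nu>" "sets \<nu> = sets borel"
    "\<And>f. continuous_on UNIV f \<Longrightarrow> L f = (\<integral>x. f x \<partial>\<nu>)"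
proof -
  interpret P: sigma_algebra "UNIV::'x set" UNIV using sigma_algebra_Pow[of "UNIV::'x set"] by simp
  have ms: "measure_space UNIV (lambda_system UNIV UNIV (functional_outer L)) (functional_outer L)"
    by (rule P.caratheodory_lemma[OF outer_measure_space_functional_outer[OF X L]])
  have sub: "sets borel \<subseteq> lambda_system UNIV UNIV (functional_outer L)"
  proof -
    have "sigma_algebra UNIV (lambda_system UNIV UNIV (functional_outer L))"
      using ms by (simp add: measure_space_def)
    then show ?thesis
      unfolding sets_borel by (rule sigma_algebra.sigma_sets_subset) (auto intro: open_in_lambda_system[OF X L])
  qed
  have ms': "measure_space UNIV (sets borel) (functional_outer L)"
    by (rule measure_down[OF ms _ sub]) (metis sets.sigma_algebra_axioms space_borel)
  define \<nu> where "\<nu> = measure_of UNIV (sets borel) (functional_outer L)"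
  have sets: "sets \<nu> = sets borel"
    unfolding \<nu>_def by (metis sets.sets_measure_of_eq space_borel)
  have sp: "space \<nu> = UNIV" using sets_eq_imp_space_eq[OF sets] by simp
  have emeas: "emeasure \<nu> A = functional_outer L A" if "A \<in> sets borel" for A
    unfolding \<nu>_def using ms' that
    by (intro emeasure_measure_of_sigma) (auto simp: measure_space_def)
  have ps: "prob_space \<nu>"
    by (rule prob_spaceI) (simp add: sp emeas functional_outer_open open_mass_UNIV[OF L])
  interpret prob_space \<nu> by (rule ps)
  have bm: "f \<in> borel_measurable \<nu>" if "continuous_on UNIV f" for f :: "'x \<Rightarrow> real"
    using borel_measurable_continuous_onI[OF that] by (simp add: measurable_cong_sets[OF sets refl])
  have int: "integrable \<nu> f" if "continuous_on UNIV f" for f :: "'x \<Rightarrow> real"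
  proof -
    have "bounded (range f)" using compact_continuous_image[OF that X] by (rule compact_imp_bounded)
    then obtain B where "\<And>x. \<bar>f x\<bar> \<le> B" by (auto simp: bounded_iff)
    then show ?thesis using bm[OF that] by (intro integrable_const_bound[where B=B]) auto
  qed
  \<comment> \<open>
    Here \<open>N * f\<close> is cut into layers \<open>g i\<close> of height at most \<open>1\<close>. Layer \<open>i\<close> vanishes off
    \<open>V i\<close>, and each point lies in at most \<open>N * f + 1\<close> of the sets \<open>V i\<close>.\<close>
  have le1: "L f \<le> (\<integral>x. f x \<partial>\<nu>)" if f: "continuous_on UNIV f" "\<And>x. 0 \<le> f x" "\<And>x. f x \<le> 1" for f
  proof (rule field_le_epsilon)
    fix e :: real assume e: "0 < e"
    obtain N where N: "N > 0" "1 / real N < e"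
      using real_arch_invD[OF e] by (auto simp: inverse_eq_divide)
    define g where "g i x = min 1 (max 0 (real N * f x - real i))" for i x
    have cg: "continuous_on UNIV (g i)" for i unfolding g_def by (intro continuous_intros f)
    define V where "V i = {x. real i < real N * f x}" for i
    have V: "open (V i)" for i unfolding V_def by (intro open_Collect_less continuous_intros f)
    have sum_g: "(\<Sum>i<n. g i x) = min (real n) (real N * f x)" for n x
      by (induction n) (use f(2)[of x] in \<open>auto simp: g_def min_def max_def\<close>)
    have Nf: "real N * f x = (\<Sum>i<N. g i x)" for x
      using f(3)[of x] sum_g[of x N] mult_left_mono[of "f x" 1 "real N"] by simp
    have "real N * L f = L (\<lambda>x. real N * f x)" using mean_functionalD(3)[OF L f(1)] by simp
    also have "\<dots> = (\<Sum>i<N. L (g i))"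
      unfolding Nf by (rule mean_functional_sum[OF L]) (auto simp: cg)
    also have "\<dots> \<le> (\<Sum>i<N. measure \<nu> (V i))"
    proof (rule sum_mono)
      fix i
      have "ennreal (L (g i)) \<le> open_mass L (V i)"
        by (rule open_mass_upper[OF cg]) (auto simp: g_def V_def indicator_def)
      then have "ennreal (L (g i)) \<le> ennreal (measure \<nu> (V i))"
        using V by (simp add: emeasure_eq_measure[symmetric] emeas functional_outer_open)
      then show "L (g i) \<le> measure \<nu> (V i)" by (simp add: ennreal_le_iff)
    qed
    also have "\<dots> \<le> (\<integral>x. real N * f x + 1 \<partial>\<nu>)"
    proof -
      have sV: "V i \<in> sets \<nu>" for i using V sets by auto
      have "(\<Sum>i<N. measure \<nu> (V i)) = (\<integral>x. (\<Sum>i<N. indicator (V i) x) \<partial>\<nu>)"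
        using sV by (subst Bochner_Integration.integral_sum) (auto simp: sp emeasure_eq_measure)
      also have "\<dots> \<le> (\<integral>x. real N * f x + 1 \<partial>\<nu>)"
      proof (rule integral_mono)
        show "integrable \<nu> (\<lambda>x. \<Sum>i<N. indicat_real (V i) x)"
          using sV by (auto simp: emeasure_eq_measure)
        show "integrable \<nu> (\<lambda>x. real N * f x + 1)"
          by (intro int continuous_intros f)
        fix x
        have "(\<Sum>i<n. indicat_real (V i) x) \<le> real N * f x + 1" for n
        proof (induction n)
          case (Suc n)
          show ?case
          proof (cases "x \<in> V n")
            case True
            have "(\<Sum>i<Suc n. indicat_real (V i) x) \<le> (\<Sum>i<Suc n. 1)"
              by (intro sum_mono) (auto simp: indicator_def)
            then show ?thesis using True by (simp add: V_def)
          qed (use Suc in simp)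
        qed (use f(2)[of x] in simp)
        then show "(\<Sum>i<N. indicat_real (V i) x) \<le> real N * f x + 1" .
      qed
      finally show ?thesis .
    qed
    also have "\<dots> = real N * (\<integral>x. f x \<partial>\<nu>) + 1"
      using int[OF f(1)] by (simp add: prob_space)
    finally have "L f \<le> (\<integral>x. f x \<partial>\<nu>) + 1 / real N" using N(1) by (simp add: field_simps)
    then show "L f \<le> (\<integral>x. f x \<partial>\<nu>) + e" using N(2) by simp
  qed
  have eq1: "L f = (\<integral>x. f x \<partial>\<nu>)" if f: "continuous_on UNIV f" "\<And>x. 0 \<le> f x" "\<And>x. f x \<le> 1" for f
  proof (rule antisym)
    show "L f \<le> (\<integral>x. f x \<partial>\<nu>)" by (rule le1[OF f])
    have "L (\<lambda>x. 1 - f x) \<le> (\<integral>x. 1 - f x \<partial>\<nu>)"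
      using f by (intro le1 continuous_intros) auto
    moreover have "L (\<lambda>x. 1 - f x) = 1 - L f"
      using mean_functional_diff[OF L _ f(1), of "\<lambda>_. 1"] mean_functionalD(1)[OF L] by simp
    moreover have "(\<integral>x. 1 - f x \<partial>\<nu>) = 1 - (\<integral>x. f x \<partial>\<nu>)"
      using int[OF f(1)] by (simp add: prob_space)
    ultimately show "(\<integral>x. f x \<partial>\<nu>) \<le> L f" by simp
  qed
  have "L f = (\<integral>x. f x \<partial>\<nu>)" if f: "continuous_on UNIV f" for f
  proof -
    have "bounded (range f)" using compact_continuous_image[OF f X] by (rule compact_imp_bounded)
    then obtain B0 where B0: "\<And>x. \<bar>f x\<bar> \<le> B0" by (auto simp: bounded_iff)
    define B where "B = max B0 1"
    have B: "B > 0" "\<And>x. \<bar>f x\<bar> \<le> B" using B0 unfolding B_def by (auto simp: le_max_iff_disj)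
    define g where "g x = (f x + B) * (1 / (2 * B))" for x
    have fg: "f = (\<lambda>x. 2 * B * g x + (-B))" using B(1) by (auto simp: g_def fun_eq_iff field_simps)
    have cg: "continuous_on UNIV g" unfolding g_def by (intro continuous_intros f)
    have "0 \<le> B + f x" "f x \<le> B" for x using B(2)[of x] by (auto simp: abs_le_iff)
    then have "L g = (\<integral>x. g x \<partial>\<nu>)"
      using B(1) by (intro eq1[OF cg]) (auto simp: g_def field_simps add_nonneg_nonneg)
    moreover have "L (\<lambda>x. 2 * B * g x + (-B)) = L (\<lambda>x. 2 * B * g x) + L (\<lambda>x. -B)"
      by (rule mean_functionalD(2)[OF L]) (intro continuous_intros cg)+
    ultimately show ?thesis
      unfolding fg using int[OF cg] mean_functionalD(3)[OF L cg] mean_functional_const[OF L]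
      by (simp add: prob_space)
  qed
  then show ?thesis using that ps sets by blast
qed

section \<open>Invariant functionals and ergodic measures\<close>

text \<open>
  Setting the value at discontinuous functions to \<open>0\<close> makes a functional determined by its
  restriction to continuous functions. This is what makes the set compact for pointwise
  convergence, and what lets functionals be compared by equality.
\<close>

definition mean_functionals :: "(('x::topological_space \<Rightarrow> real) \<Rightarrow> real) set" where
  "mean_functionals = {L. mean_functional L \<and> (\<forall>f. \<not> continuous_on UNIV f \<longrightarrow> L f = 0)}"

definition invariant_functionals :: "('x::topological_space \<Rightarrow> 'x) \<Rightarrow> (('x \<Rightarrow> real) \<Rightarrow> real) set" where
  "invariant_functionals T =
     {L \<in> mean_functionals. \<forall>f. continuous_on UNIV f \<longrightarrow> L (\<lambda>x. f (T x)) = L f}"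

lemma continuous_evaluation: "continuous_on UNIV (\<lambda>L. L f :: real)"
  by (rule continuous_on_product_coordinates)

lemma continuous_bounded_real:
  fixes f :: "'x::topological_space \<Rightarrow> real"
  assumes "compact (UNIV :: 'x set)" "continuous_on UNIV f"
  obtains B where "B \<ge> 0" "\<And>x. \<bar>f x\<bar> \<le> B"
proof -
  have "bounded (range f)" using compact_continuous_image[OF assms(2,1)] by (rule compact_imp_bounded)
  then obtain B where "\<And>x. \<bar>f x\<bar> \<le> B" by (auto simp: bounded_iff)
  then show ?thesis by (intro that[of "\<bar>B\<bar>"]) (auto intro: order_trans[OF _ abs_ge_self])
qed

lemma closed_mean_functionals:
  "closed (mean_functionals :: (('x::topological_space \<Rightarrow> real) \<Rightarrow> real) set)"
  unfolding mean_functionals_def mean_functional_def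
  by (intro closed_Collect_conj closed_Collect_all closed_Collect_imp open_Collect_const
      closed_Collect_eq closed_Collect_le continuous_intros continuous_evaluation)

text \<open>
  Tychonoff's theorem: the value at a continuous \<open>f\<close> ranges over a compact interval given by a
  bound of \<open>f\<close>, and the defining laws are closed conditions.
\<close>

lemma compact_mean_functionals:
  assumes X: "compact (UNIV :: 'x::topological_space set)"
  shows "compact (mean_functionals :: (('x \<Rightarrow> real) \<Rightarrow> real) set)"
proof -
  have "\<exists>B. continuous_on UNIV f \<longrightarrow> (\<forall>x. \<bar>f x\<bar> \<le> B)" for f :: "'x \<Rightarrow> real"
    using continuous_bounded_real[OF X] by metis
  then obtain B where B: "\<And>f x. continuous_on UNIV f \<Longrightarrow> \<bar>(f :: 'x \<Rightarrow> real) x\<bar> \<le> B f" by metis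
  define K :: "(('x \<Rightarrow> real) \<Rightarrow> real) set"
    where "K = PiE UNIV (\<lambda>f. if continuous_on UNIV f then {- B f..B f} else {0})"
  have "compactin (product_topology (\<lambda>_. euclidean) UNIV) K"
    unfolding K_def by (subst compactin_PiE) (auto simp: compactin_euclidean_iff)
  then have K: "compact K"
    by (simp add: euclidean_product_topology compactin_euclidean_iff)
  have "mean_functionals \<subseteq> K"
  proof
    fix L :: "('x \<Rightarrow> real) \<Rightarrow> real" assume "L \<in> mean_functionals"
    then have L: "mean_functional L" and L0: "\<And>f. \<not> continuous_on UNIV f \<Longrightarrow> L f = 0"
      by (auto simp: mean_functionals_def)
    have "- B f \<le> L f" "L f \<le> B f" if f: "continuous_on UNIV f" for f
    proof -
      have "- B f \<le> f x" "f x \<le> B f" for x using B[OF f, of x] by (auto simp: abs_le_iff)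
      then have "L (\<lambda>_. - B f) \<le> L f" "L f \<le> L (\<lambda>_. B f)"
        by (auto intro!: mean_functional_mono[OF L] f)
      then show "- B f \<le> L f" "L f \<le> B f" by (simp_all add: mean_functional_const[OF L])
    qed
    with L0 show "L \<in> K" by (auto simp: K_def)
  qed
  then show ?thesis using compact_Int_closed[OF K closed_mean_functionals] by (metis inf.absorb_iff2)
qed

lemma closed_invariant_condition:
  "closed {L :: ('x::topological_space \<Rightarrow> real) \<Rightarrow> real.
     \<forall>f. continuous_on UNIV f \<longrightarrow> L (\<lambda>x. f (T x)) = L f}"
  by (intro closed_Collect_all closed_Collect_imp open_Collect_const closed_Collect_eq continuous_evaluation)

lemma compact_invariant_functionals:
  assumes X: "compact (UNIV :: 'x::topological_space set)"
  shows "compact (invariant_functionals (T :: 'x \<Rightarrow> 'x))"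
proof -
  have "invariant_functionals T =
      mean_functionals \<inter> {L. \<forall>f. continuous_on UNIV f \<longrightarrow> L (\<lambda>x. f (T x)) = L f}"
    by (auto simp: invariant_functionals_def)
  then show ?thesis
    using compact_Int_closed[OF compact_mean_functionals[OF X] closed_invariant_condition] by simp
qed

lemma continuous_on_funpow:
  fixes T :: "'x::topological_space \<Rightarrow> 'x"
  assumes "continuous_on UNIV T"
  shows "continuous_on UNIV (T ^^ n)"
  by (induction n) (auto intro: continuous_on_compose2[OF assms] simp: id_def)

text \<open>
  If the average of \<open>g\<close> over long orbit segments fell below \<open>\<theta>\<close> again and again, then the
  functionals that average over these segments would accumulate at an invariant functional with
  \<open>L g \<le> \<theta>\<close>. The accumulation point is found with the finite intersection property.
\<close>

theorem uniform_ergodic_lower_bound: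
  fixes T :: "'x::topological_space \<Rightarrow> 'x" and g :: "'x \<Rightarrow> real"
  assumes X: "compact (UNIV :: 'x set)" and T: "continuous_on UNIV T" and g: "continuous_on UNIV g"
    and pos: "\<And>L. L \<in> invariant_functionals T \<Longrightarrow> \<theta> < L g"
  obtains N0 where "\<And>N x. N \<ge> N0 \<Longrightarrow> real N * \<theta> \<le> (\<Sum>k<N. g ((T ^^ k) x))"
proof (rule ccontr)
  assume "\<not> thesis"
  then have "\<exists>N\<ge>N0. \<exists>x. (\<Sum>k<N. g ((T ^^ k) x)) < real N * \<theta>" for N0
    using that[of N0] by (meson not_le)
  then obtain n y where n: "\<And>m. n m \<ge> m" and y: "\<And>m. (\<Sum>k<n m. g ((T ^^ k) (y m))) < real (n m) * \<theta>"
    by metis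
  have "\<exists>B. continuous_on UNIV f \<longrightarrow> (\<forall>x. \<bar>f x\<bar> \<le> B)" for f :: "'x \<Rightarrow> real"
    using continuous_bounded_real[OF X] by metis
  then obtain B where B: "\<And>f x. continuous_on UNIV f \<Longrightarrow> \<bar>(f :: 'x \<Rightarrow> real) x\<bar> \<le> B f" by metis
  \<comment> \<open>
    Closed conditions that hold for the averages over those of the chosen orbit segments that have at
    least \<open>m\<close> points; holding for all \<open>m\<close>, they imply that \<open>L\<close> is invariant.\<close>
  define C where "C m = {L :: ('x \<Rightarrow> real) \<Rightarrow> real. L g \<le> \<theta> \<and>
      (\<forall>f. continuous_on UNIV f \<longrightarrow> real m * \<bar>L (\<lambda>x. f (T x)) - L f\<bar> \<le> 2 * B f)}" for m
  have clC: "closed (C m)" for m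
    unfolding C_def
    by (intro closed_Collect_conj closed_Collect_all closed_Collect_imp open_Collect_const
        closed_Collect_le continuous_intros continuous_evaluation)
  have Cmono: "C m' \<subseteq> C m" if "m \<le> m'" for m m'
    unfolding C_def
  proof safe
    fix L :: "('x \<Rightarrow> real) \<Rightarrow> real" and f :: "'x \<Rightarrow> real" assume L: "\<forall>f. continuous_on UNIV f \<longrightarrow> real m' * \<bar>L (\<lambda>x. f (T x)) - L f\<bar> \<le> 2 * B f"
      and f: "continuous_on UNIV f"
    have "real m * \<bar>L (\<lambda>x. f (T x)) - L f\<bar> \<le> real m' * \<bar>L (\<lambda>x. f (T x)) - L f\<bar>"
      using that by (intro mult_right_mono) auto
    then show "real m * \<bar>L (\<lambda>x. f (T x)) - L f\<bar> \<le> 2 * B f" using L f by (meson order_trans)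
  qed
  have Cne: "mean_functionals \<inter> C m \<noteq> {}" for m
  proof -
    define N where "N = n (Suc m)"
    have N: "N \<ge> Suc m" unfolding N_def by (rule n)
    define z where "z = y (Suc m)"
    define L where "L f = (if continuous_on UNIV f then (\<Sum>k<N. f ((T ^^ k) z)) / real N else 0)"
      for f :: "'x \<Rightarrow> real"
    have comp: "continuous_on UNIV (\<lambda>x. f (T x))" if "continuous_on UNIV f" for f :: "'x \<Rightarrow> real"
      using that T by (rule continuous_on_compose2) auto
    have "mean_functional L"
      unfolding mean_functional_def
    proof (intro conjI allI impI)
      show "L (\<lambda>_. 1) = 1" using N by (simp add: L_def)
      fix f h :: "'x \<Rightarrow> real" and c :: real assume f: "continuous_on UNIV f"
      show "L (\<lambda>x. c * f x) = c * L f"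
        using f by (simp add: L_def continuous_on_mult_left sum_distrib_left)
      show "0 \<le> L f" if "\<forall>x. 0 \<le> f x" using that by (simp add: L_def sum_nonneg)
      assume h: "continuous_on UNIV h"
      show "L (\<lambda>x. f x + h x) = L f + L h"
        using f h by (simp add: L_def continuous_on_add sum.distrib add_divide_distrib)
    qed
    then have "L \<in> mean_functionals" by (auto simp: mean_functionals_def L_def)
    moreover have "L \<in> C m"
      unfolding C_def
    proof (intro CollectI conjI allI impI)
      show "L g \<le> \<theta>"
        using y[of "Suc m"] N g unfolding L_def N_def[symmetric] z_def[symmetric]
        by (simp add: divide_le_eq mult.commute)
      fix f :: "'x \<Rightarrow> real" assume f: "continuous_on UNIV f"
      have "(\<Sum>k<N. f (T ((T ^^ k) z))) - (\<Sum>k<N. f ((T ^^ k) z)) = f ((T ^^ N) z) - f z"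
        by (induction N) auto
      then have "L (\<lambda>x. f (T x)) - L f = (f ((T ^^ N) z) - f z) / real N"
        using f comp[OF f] by (simp add: L_def diff_divide_distrib[symmetric])
      then have "real N * \<bar>L (\<lambda>x. f (T x)) - L f\<bar> = \<bar>f ((T ^^ N) z) - f z\<bar>"
        using N by (simp add: abs_divide)
      also have "\<dots> \<le> 2 * B f" using B[OF f, of "(T ^^ N) z"] B[OF f, of z] by linarith
      finally have "real N * \<bar>L (\<lambda>x. f (T x)) - L f\<bar> \<le> 2 * B f" .
      moreover have "real m * \<bar>L (\<lambda>x. f (T x)) - L f\<bar> \<le> real N * \<bar>L (\<lambda>x. f (T x)) - L f\<bar>"
        using N by (intro mult_right_mono) auto
      ultimately show "real m * \<bar>L (\<lambda>x. f (T x)) - L f\<bar> \<le> 2 * B f" by linarith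
    qed
    ultimately show ?thesis by blast
  qed
  have "mean_functionals \<inter> \<Inter>(range C) \<noteq> {}"
  proof (rule compact_imp_fip[OF compact_mean_functionals[OF X]])
    fix F assume "finite F" "F \<subseteq> range C"
    then obtain I where I: "finite I" "F = C ` I" by (meson finite_subset_image)
    obtain m where m: "\<And>i. i \<in> I \<Longrightarrow> i \<le> m"
      using I(1) by (meson finite_nat_set_iff_bounded_le)
    have "C m \<subseteq> \<Inter> F" using I(2) m Cmono by blast
    then show "mean_functionals \<inter> \<Inter> F \<noteq> {}" using Cne[of m] by blast
  qed (use clC in auto)
  then obtain L where L: "L \<in> mean_functionals" "\<And>m. L \<in> C m" by blast
  have "L (\<lambda>x. f (T x)) = L f" if f: "continuous_on UNIV f" for f :: "'x \<Rightarrow> real"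
  proof (rule ccontr)
    assume "L (\<lambda>x. f (T x)) \<noteq> L f"
    then have p: "\<bar>L (\<lambda>x. f (T x)) - L f\<bar> > 0" by simp
    then obtain m where "2 * B f < real m * \<bar>L (\<lambda>x. f (T x)) - L f\<bar>"
      using reals_Archimedean3[OF p] by blast
    then show False using L(2)[of m] f by (auto simp: C_def not_le[symmetric])
  qed
  then have "L \<in> invariant_functionals T" using L(1) by (simp add: invariant_functionals_def)
  moreover have "L g \<le> \<theta>" using L(2)[of 0] by (simp add: C_def)
  ultimately show False using pos by force
qed

text \<open>
  If there were no invariant functional, the preceding bound would hold vacuously for \<open>g = 0\<close> and
  \<open>\<theta> = 1\<close>.
\<close>

lemma invariant_functionals_nonempty:
  fixes T :: "'x::topological_space \<Rightarrow> 'x"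
  assumes "compact (UNIV :: 'x set)" "continuous_on UNIV T"
  shows "invariant_functionals T \<noteq> {}"
proof
  assume "invariant_functionals T = {}"
  then obtain N0 where "\<And>N x. N \<ge> N0 \<Longrightarrow> real N * 1 \<le> (\<Sum>k<N. (\<lambda>_. 0) ((T ^^ k) x))"
    using uniform_ergodic_lower_bound[OF assms, of "\<lambda>_. 0" 1] by auto
  from this[of "Suc N0"] show False by simp
qed

definition functional_segment :: "real \<Rightarrow> ('f \<Rightarrow> real) \<Rightarrow> ('f \<Rightarrow> real) \<Rightarrow> 'f \<Rightarrow> real" where
  "functional_segment t L1 L2 = (\<lambda>f. t * L1 f + (1 - t) * L2 f)"

text \<open>
  Nonempty closed faces in the sense of convex analysis. That \<open>{L}\<close> is a face means that \<open>L\<close> is an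
  extreme point of \<open>I\<close>.
\<close>

definition functional_face :: "('f \<Rightarrow> real) set \<Rightarrow> ('f \<Rightarrow> real) set \<Rightarrow> bool" where
  "functional_face I F \<longleftrightarrow> F \<subseteq> I \<and> F \<noteq> {} \<and> closed F \<and>
     (\<forall>L1\<in>I. \<forall>L2\<in>I. \<forall>t. 0 < t \<longrightarrow> t < 1 \<longrightarrow> functional_segment t L1 L2 \<in> F \<longrightarrow> L1 \<in> F \<and> L2 \<in> F)"

text \<open>
  A proper convex combination attains the minimum of an affine function only if both of its end
  points do.
\<close>

lemma functional_face_minimizers:
  fixes I :: "('f \<Rightarrow> real) set"
  assumes I: "compact I" and F: "functional_face I F" and h: "continuous_on I h"
    and affine: "\<And>L1 L2 t. L1 \<in> I \<Longrightarrow> L2 \<in> I \<Longrightarrow> 0 < t \<Longrightarrow> t < 1 \<Longrightarrow>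
      functional_segment t L1 L2 \<in> I \<Longrightarrow> h (functional_segment t L1 L2) = t * h L1 + (1 - t) * h L2"
  obtains L0 where "L0 \<in> F" "\<And>L. L \<in> F \<Longrightarrow> h L0 \<le> h L"
    "functional_face I {L \<in> F. h L \<le> h L0}"
proof -
  have FI: "F \<subseteq> I" "F \<noteq> {}" "closed F" using F by (auto simp: functional_face_def)
  have cF: "compact F" using compact_Int_closed[OF I FI(3)] FI(1) by (metis inf.absorb_iff2)
  have hF: "continuous_on F h" using h FI(1) by (rule continuous_on_subset)
  obtain L0 where L0: "L0 \<in> F" "\<And>L. L \<in> F \<Longrightarrow> h L0 \<le> h L"
    using continuous_attains_inf[OF cF FI(2) hF] by blast
  have "closed {L \<in> F. h L \<le> h L0}"
    using continuous_closed_preimage[OF hF FI(3), of "{..h L0}"]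
    by (simp add: vimage_def Int_def conj_commute)
  moreover have "L1 \<in> F \<and> h L1 \<le> h L0 \<and> L2 \<in> F \<and> h L2 \<le> h L0"
    if L: "L1 \<in> I" "L2 \<in> I" "0 < t" "t < 1"
      and s: "functional_segment t L1 L2 \<in> F" "h (functional_segment t L1 L2) \<le> h L0" for L1 L2 t
  proof -
    have LF: "L1 \<in> F" "L2 \<in> F" using F L s(1) unfolding functional_face_def by blast+
    have "t * h L1 + (1 - t) * h L2 \<le> h L0" using affine[OF L] s FI(1) by auto
    moreover have "t * h L0 \<le> t * h L1" "(1 - t) * h L0 \<le> (1 - t) * h L2"
      using L0(2) LF L by (auto intro!: mult_left_mono)
    ultimately have "t * h L1 \<le> t * h L0" "(1 - t) * h L2 \<le> (1 - t) * h L0"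
      by (simp_all add: algebra_simps)
    then show ?thesis using LF L by simp
  qed
  ultimately have "functional_face I {L \<in> F. h L \<le> h L0}"
    using FI(1) L0 unfolding functional_face_def by blast
  with L0 that show ?thesis by blast
qed

text \<open>
  The argument behind the Krein-Milman theorem. By compactness and Zorn's lemma there is a minimal
  closed face; an evaluation \<open>L \<mapsto> L f\<close> is constant on it, because its minimizers form a face again.
  Minimal faces are obtained as complements of maximal sets.
\<close>

lemma functional_face_contains_extreme:
  fixes I :: "('f \<Rightarrow> real) set"
  assumes I: "compact I" and F0: "functional_face I F0"
  obtains L where "L \<in> F0" "functional_face I {L}"
proof -
  define \<C> where "\<C> = {- F | F. functional_face I F \<and> F \<subseteq> F0}"
  have "\<exists>M\<in>\<C>. \<forall>X\<in>\<C>. M \<subseteq> X \<longrightarrow> X = M"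
  proof (rule subset_Zorn)
    fix \<D> assume ch: "subset.chain \<C> \<D>"
    show "\<exists>U\<in>\<C>. \<forall>X\<in>\<D>. X \<subseteq> U"
    proof (cases "\<D> = {}")
      case True
      then show ?thesis using F0 by (auto simp: \<C>_def)
    next
      case False
      have D: "\<D> \<subseteq> \<C>" "\<And>X Y. X \<in> \<D> \<Longrightarrow> Y \<in> \<D> \<Longrightarrow> X \<subseteq> Y \<or> Y \<subseteq> X"
        using ch by (auto simp: subset.chain_def)
      define G where "G = \<Inter>(uminus ` \<D>)"
      have face: "functional_face I (- X)" "- X \<subseteq> F0" if "X \<in> \<D>" for X
        using D(1) that by (auto simp: \<C>_def)
      have fin: "I \<inter> \<Inter>S \<noteq> {}" if S: "finite S" "S \<subseteq> uminus ` \<D>" for S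
      proof (cases "S = {}")
        case True
        then show ?thesis using F0 by (auto simp: functional_face_def)
      next
        case False
        have "\<Inter>S \<in> S"
          using S(1) False S(2)
        proof (induction S rule: finite_ne_induct)
          case (insert A S)
          then have "\<Inter>S \<in> uminus ` \<D>" "A \<in> uminus ` \<D>" "\<Inter>S \<in> S" by auto
          then have "A \<subseteq> \<Inter>S \<or> \<Inter>S \<subseteq> A" using D(2) by (metis (no_types, lifting) Compl_subset_Compl_iff imageE)
          then show ?case using \<open>\<Inter>S \<in> S\<close> by (auto simp: inf.absorb1 inf.absorb2)
        qed simp
        then have "\<Inter>S \<in> uminus ` \<D>" using S(2) by blast
        then have "functional_face I (\<Inter>S)" using face by auto
        then have "\<Inter>S \<subseteq> I" "\<Inter>S \<noteq> {}" unfolding functional_face_def by blast+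
        then show ?thesis by blast
      qed
      have "I \<inter> G \<noteq> {}"
        unfolding G_def
        by (rule compact_imp_fip[OF I _ fin]) (use face in \<open>auto simp: functional_face_def\<close>)
      moreover have GF0: "G \<subseteq> F0" using False face(2) unfolding G_def by blast
      moreover have "F0 \<subseteq> I" using F0 by (simp only: functional_face_def)
      moreover have "closed G" unfolding G_def using face by (intro closed_Inter) (auto simp: functional_face_def)
      moreover have "L1 \<in> G \<and> L2 \<in> G" if "L1 \<in> I" "L2 \<in> I" "0 < t" "t < 1" "functional_segment t L1 L2 \<in> G" for L1 L2 t
      proof -
        have "L1 \<in> - X \<and> L2 \<in> - X" if "X \<in> \<D>" for X
        proof -
          have "functional_segment t L1 L2 \<in> - X" using \<open>functional_segment t L1 L2 \<in> G\<close> that by (auto simp: G_def)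
          with face(1)[OF that] \<open>L1 \<in> I\<close> \<open>L2 \<in> I\<close> \<open>0 < t\<close> \<open>t < 1\<close> show ?thesis
            unfolding functional_face_def by blast
        qed
        then show ?thesis by (auto simp: G_def)
      qed
      ultimately have "functional_face I G" unfolding functional_face_def by blast
      with GF0 have "- G \<in> \<C>" unfolding \<C>_def by blast
      moreover have "\<forall>X\<in>\<D>. X \<subseteq> - G" by (auto simp: G_def)
      ultimately show ?thesis by blast
    qed
  qed
  note zorn = this
  obtain F where F: "functional_face I F" "F \<subseteq> F0"
    and min: "\<And>F'. functional_face I F' \<Longrightarrow> F' \<subseteq> F \<Longrightarrow> F' = F"
  proof -
    obtain M where M: "M \<in> \<C>" "\<And>X. X \<in> \<C> \<Longrightarrow> M \<subseteq> X \<Longrightarrow> X = M"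
      using zorn by blast
    then obtain F where F: "functional_face I F" "F \<subseteq> F0" "M = - F" by (auto simp: \<C>_def)
    have "F' = F" if "functional_face I F'" "F' \<subseteq> F" for F'
    proof -
      have "- F' \<in> \<C>" using that F(2) by (auto simp: \<C>_def)
      then have "- F' = - F" using M(2)[of "- F'"] that(2) F(3) by blast
      then show ?thesis by blast
    qed
    with F that show ?thesis by blast
  qed
  obtain L where L: "L \<in> F" using F(1) by (auto simp: functional_face_def)
  have "L' f \<le> L'' f" if LF: "L' \<in> F" "L'' \<in> F" for L' L'' f
  proof -
    have c: "continuous_on I (\<lambda>L. L f)" by (rule continuous_on_subset[OF continuous_evaluation]) simp
    obtain L0 where L0: "L0 \<in> F" "\<And>L. L \<in> F \<Longrightarrow> L0 f \<le> L f" "functional_face I {L \<in> F. L f \<le> L0 f}"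
      by (rule functional_face_minimizers[OF I F(1) c]) (auto simp: functional_segment_def)
    have "{L \<in> F. L f \<le> L0 f} = F" by (rule min[OF L0(3)]) auto
    then have "L' f \<le> L0 f" using LF(1) by blast
    also have "\<dots> \<le> L'' f" by (rule L0(2)[OF LF(2)])
    finally show ?thesis .
  qed
  then have "L' = L" if "L' \<in> F" for L' using that L by (auto simp: fun_eq_iff intro: antisym)
  then have "F = {L}" using L by blast
  with F L that show ?thesis by blast
qed

lemma integral_functional_mean:
  fixes N :: "'x::metric_space measure"
  assumes X: "compact (UNIV :: 'x set)" and N: "prob_space N" "sets N = sets borel"
  shows "(\<lambda>f. if continuous_on UNIV f then \<integral>x. f x \<partial>N else 0) \<in> mean_functionals"
    and "continuous_on UNIV f \<Longrightarrow> integrable N (f :: 'x \<Rightarrow> real)"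
proof -
  interpret prob_space N by fact
  have int: "integrable N f" if f: "continuous_on UNIV f" for f :: "'x \<Rightarrow> real"
  proof -
    obtain B where "\<And>x. \<bar>f x\<bar> \<le> B" using continuous_bounded_real[OF X f] by blast
    moreover have "f \<in> borel_measurable N"
      using borel_measurable_continuous_onI[OF f] by (simp add: measurable_cong_sets[OF N(2) refl])
    ultimately show ?thesis by (intro integrable_const_bound[where B=B]) auto
  qed
  then show "continuous_on UNIV f \<Longrightarrow> integrable N (f :: 'x \<Rightarrow> real)" .
  show "(\<lambda>f. if continuous_on UNIV f then \<integral>x. f x \<partial>N else 0) \<in> mean_functionals"
    unfolding mean_functionals_def mean_functional_def
    by (auto simp: prob_space int continuous_on_add continuous_on_mult_left)
qed

text \<open>
  The open sets are an intersection-stable generator, and their indicators are increasing limits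
  of continuous functions.
\<close>

lemma borel_prob_eqI_integral:
  fixes M N :: "'x::metric_space measure"
  assumes M: "prob_space M" "sets M = sets borel" and N: "prob_space N" "sets N = sets borel"
    and eq: "\<And>f. continuous_on UNIV f \<Longrightarrow> (\<And>x. 0 \<le> f x) \<Longrightarrow> (\<And>x. f x \<le> (1::real)) \<Longrightarrow>
      (\<integral>x. f x \<partial>M) = (\<integral>x. f x \<partial>N)"
  shows "M = N"
proof (rule measure_eqI_generator_eq[where E="{U. open U}" and \<Omega>=UNIV and A="\<lambda>_. UNIV"])
  fix U :: "'x set" assume "U \<in> {U. open U}"
  then have U: "open U" by simp
  have *: "emeasure P U = (SUP m. ennreal (\<integral>x. bump U m x \<partial>P))"
    if P: "prob_space P" "sets P = sets borel" for P
  proof -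
    interpret P: prob_space P by fact
    have bm: "bump U m \<in> borel_measurable P" for m
      using borel_measurable_continuous_onI[OF bump_props(1)[OF U]]
      by (simp add: measurable_cong_sets[OF P(2) refl])
    have b1: "bump U m x \<le> 1" for m x by (auto simp: bump_def)
    have int: "integrable P (bump U m)" for m
      by (rule P.integrable_const_bound[where B=1]) (auto simp: bm b1 bump_props(2)[OF U])
    have lim: "(SUP m. ennreal (bump U m x)) = indicator U x" for x
    proof (cases "x \<in> U")
      case True
      then obtain k where "bump U k x = 1" using bump_props(5)[OF U] by blast
      then have "1 \<le> (SUP m. ennreal (bump U m x))" by (metis SUP_upper UNIV_I ennreal_1)
      moreover have "(SUP m. ennreal (bump U m x)) \<le> 1"
        by (intro SUP_least) (simp add: b1 ennreal_le_1)
      ultimately have "(SUP m. ennreal (bump U m x)) = 1" by (intro antisym)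
      then show ?thesis using True by simp
    next
      case False
      then have "bump U m x = 0" for m using bump_props(2,3)[OF U, of m x] by simp
      then show ?thesis using False by simp
    qed
    have "emeasure P U = (\<integral>\<^sup>+x. indicator U x \<partial>P)"
      using U P(2) by (subst nn_integral_indicator) auto
    also have "\<dots> = (\<integral>\<^sup>+x. (SUP m. ennreal (bump U m x)) \<partial>P)" by (simp add: lim)
    also have "\<dots> = (SUP m. \<integral>\<^sup>+x. ennreal (bump U m x) \<partial>P)"
      by (intro nn_integral_monotone_convergence_SUP)
        (auto intro!: incseq_SucI le_funI ennreal_leI bump_props(4)[OF U] measurable_compose[OF bm])
    also have "\<dots> = (SUP m. ennreal (\<integral>x. bump U m x \<partial>P))"
      by (intro SUP_cong refl nn_integral_eq_integral int) (auto simp: bump_props(2)[OF U])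
    finally show ?thesis .
  qed
  have "(\<integral>x. bump U m x \<partial>M) = (\<integral>x. bump U m x \<partial>N)" for m
    by (rule eq[OF bump_props(1)[OF U] bump_props(2)[OF U]]) (simp add: bump_def)
  then show "emeasure M U = emeasure N U" by (simp add: *[OF M] *[OF N])
next
  show "Int_stable {U :: 'x set. open U}" by (auto simp: Int_stable_def)
  show "emeasure M UNIV \<noteq> \<infinity>" for i :: nat
    using prob_space.emeasure_space_1[OF M(1)] sets_eq_imp_space_eq[OF M(2)] by simp
qed (auto simp: M(2) N(2) sets_borel)

text \<open>
  An invariant set \<open>A\<close> with \<open>0 < \<nu> A < 1\<close> would write \<open>\<nu>\<close> as a proper convex combination of its
  conditional measures on \<open>A\<close> and on the complement, both of them invariant. Extremality would make
  \<open>\<nu>\<close> equal to its conditional measure on \<open>A\<close>, although \<open>\<nu>\<close> charges the complement.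
\<close>

lemma extreme_invariant_functional_ergodic:
  fixes T :: "'x::metric_space \<Rightarrow> 'x"
  assumes X: "compact (UNIV :: 'x set)" and T: "continuous_on UNIV T"
    and L: "functional_face (invariant_functionals T) {L}"
  obtains \<nu> where "ergodic_prob T \<nu>" "\<And>f. continuous_on UNIV f \<Longrightarrow> L f = (\<integral>x. f x \<partial>\<nu>)"
proof -
  have "L \<in> invariant_functionals T" using L unfolding functional_face_def by blast
  then have L1: "mean_functional L" and L2: "\<And>f. \<not> continuous_on UNIV f \<Longrightarrow> L f = 0"
    and L3: "\<And>f. continuous_on UNIV f \<Longrightarrow> L (\<lambda>x. f (T x)) = L f"
    by (auto simp: invariant_functionals_def mean_functionals_def)
  obtain \<nu> where \<nu>: "prob_space \<nu>" "sets \<nu> = sets borel"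
    "\<And>f. continuous_on UNIV f \<Longrightarrow> L f = (\<integral>x. f x \<partial>\<nu>)"
    using Riesz_representation[OF X L1] by blast
  interpret prob_space \<nu> by fact
  have sp: "space \<nu> = UNIV" using sets_eq_imp_space_eq[OF \<nu>(2)] by simp
  have Tb: "T \<in> borel_measurable borel" by (rule borel_measurable_continuous_onI[OF T])
  have Tm: "T \<in> measurable \<nu> borel" using Tb by (simp add: measurable_cong_sets[OF \<nu>(2) refl])
  have inv: "distr \<nu> borel T = \<nu>"
  proof (rule borel_prob_eqI_integral)
    show "prob_space (distr \<nu> borel T)" by (rule prob_space_distr[OF Tm])
    fix f :: "'x \<Rightarrow> real" assume f: "continuous_on UNIV f"
    have "continuous_on UNIV (\<lambda>x. f (T x))" using f T by (rule continuous_on_compose2) auto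
    then have "(\<integral>x. f (T x) \<partial>\<nu>) = (\<integral>x. f x \<partial>\<nu>)" using L3[OF f] \<nu>(3) f by simp
    then show "(\<integral>x. f x \<partial>distr \<nu> borel T) = (\<integral>x. f x \<partial>\<nu>)"
      using borel_measurable_continuous_onI[OF f] by (simp add: integral_distr[OF Tm])
  qed (use \<nu> in auto)
  have preim: "emeasure \<nu> (T -` B) = emeasure \<nu> B" if "B \<in> sets borel" for B
    using emeasure_distr[OF Tm that] inv sp by simp
  define I :: "'x set \<Rightarrow> ('x \<Rightarrow> real) \<Rightarrow> real"
    where "I A = (\<lambda>f. if continuous_on UNIV f then \<integral>x. f x \<partial>uniform_measure \<nu> A else 0)" for A
  have ps: "prob_space (uniform_measure \<nu> A)" if "A \<in> sets borel" "measure \<nu> A \<noteq> 0" for A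
    using that by (intro prob_space_uniform_measure) (auto simp: emeasure_eq_measure)
  have Iinv: "I A \<in> invariant_functionals T"
    if A: "A \<in> sets borel" "measure \<nu> A \<noteq> 0" "T -` A = A" for A
  proof -
    interpret A: prob_space "uniform_measure \<nu> A" by (rule ps[OF A(1,2)])
    have sA: "sets (uniform_measure \<nu> A) = sets borel" using \<nu>(2) by simp
    have TA: "T \<in> measurable (uniform_measure \<nu> A) borel"
      using Tb by (simp add: measurable_cong_sets[OF sA refl])
    have "distr (uniform_measure \<nu> A) borel T = uniform_measure \<nu> A"
    proof (rule measure_eqI)
      fix B assume "B \<in> sets (distr (uniform_measure \<nu> A) borel T)"
      then have B: "B \<in> sets borel" by simp
      have TB: "T -` B \<in> sets \<nu>" using measurable_sets[OF Tm B] sp by simp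
      have "emeasure (distr (uniform_measure \<nu> A) borel T) B = emeasure (uniform_measure \<nu> A) (T -` B)"
        using emeasure_distr[OF TA B] sp by simp
      also have "\<dots> = emeasure \<nu> (A \<inter> T -` B) / emeasure \<nu> A"
        using A(1) TB \<nu>(2) by (intro emeasure_uniform_measure) auto
      also have "A \<inter> T -` B = T -` (A \<inter> B)" using A(3) by auto
      also have "emeasure \<nu> (T -` (A \<inter> B)) = emeasure \<nu> (A \<inter> B)" using A(1) B by (intro preim) auto
      also have "emeasure \<nu> (A \<inter> B) / emeasure \<nu> A = emeasure (uniform_measure \<nu> A) B"
        using A(1) B \<nu>(2) by (intro emeasure_uniform_measure[symmetric]) auto
      finally show "emeasure (distr (uniform_measure \<nu> A) borel T) B = emeasure (uniform_measure \<nu> A) B" .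
    qed (simp add: \<nu>(2))
    note dA = this
    have "(\<integral>x. f (T x) \<partial>uniform_measure \<nu> A) = (\<integral>x. f x \<partial>uniform_measure \<nu> A)"
      if f: "continuous_on UNIV f" for f :: "'x \<Rightarrow> real"
      using integral_distr[OF TA, of f] borel_measurable_continuous_onI[OF f] dA by simp
    moreover have "continuous_on UNIV (\<lambda>x. f (T x))" if "continuous_on UNIV f" for f :: "'x \<Rightarrow> real"
      using that T by (rule continuous_on_compose2) auto
    ultimately show ?thesis
      using integral_functional_mean(1)[OF X ps[OF A(1,2)] sA]
      unfolding invariant_functionals_def I_def by simp
  qed
  have Iint: "measure \<nu> A * I A f = (\<integral>x. indicator A x * f x \<partial>\<nu>)"
    if A: "A \<in> sets borel" "measure \<nu> A \<noteq> 0" and f: "continuous_on UNIV f" for A and f :: "'x \<Rightarrow> real"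
  proof -
    have A': "A \<in> sets \<nu>" "f \<in> borel_measurable \<nu>"
      using A(1) \<nu>(2) borel_measurable_continuous_onI[OF f] by (auto simp: measurable_cong_sets[OF \<nu>(2) refl])
    have "uniform_measure \<nu> A = density \<nu> (\<lambda>x. ennreal (indicator A x / measure \<nu> A))"
      unfolding uniform_measure_def using A(2)
      by (intro arg_cong[where f="density \<nu>"]) (auto simp: fun_eq_iff emeasure_eq_measure divide_ennreal
          indicator_def zero_less_measure_iff ennreal_1[symmetric] simp del: ennreal_1)
    then have "(\<integral>x. f x \<partial>uniform_measure \<nu> A) = (\<integral>x. (indicator A x / measure \<nu> A) *\<^sub>R f x \<partial>\<nu>)"
      using A' by (simp add: integral_density)
    also have "\<dots> = (\<integral>x. indicator A x * f x \<partial>\<nu>) / measure \<nu> A" by simp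
    finally show ?thesis using A(2) f by (simp add: I_def)
  qed
  have "measure \<nu> A = 0 \<or> measure \<nu> A = 1" if A: "A \<in> sets borel" "T -` A = A" for A
  proof (rule ccontr)
    assume neg: "\<not> (measure \<nu> A = 0 \<or> measure \<nu> A = 1)"
    define a where "a = measure \<nu> A"
    have a: "0 < a" "a < 1" using neg prob_le_1[of A] by (auto simp: a_def less_le)
    define A' where "A' = UNIV - A"
    have A': "A' \<in> sets borel" "T -` A' = A'" "measure \<nu> A' = 1 - a"
      using A prob_compl[of A] \<nu>(2) by (auto simp: A'_def a_def sp)
    have "functional_segment a (I A) (I A') = L"
    proof
      fix f :: "'x \<Rightarrow> real"
      show "functional_segment a (I A) (I A') f = L f"
      proof (cases "continuous_on UNIV f")
        case f: True
        have ig: "integrable \<nu> (\<lambda>x. indicator B x * f x)" if "B \<in> sets borel" for B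
          using integrable_real_mult_indicator[OF _ integral_functional_mean(2)[OF X \<nu>(1,2) f], of B] that \<nu>(2)
          by (simp add: mult.commute)
        have "functional_segment a (I A) (I A') f =
            (\<integral>x. indicator A x * f x \<partial>\<nu>) + (\<integral>x. indicator A' x * f x \<partial>\<nu>)"
          using Iint[OF A(1) _ f] Iint[OF A'(1) _ f] a A'(3) by (simp add: functional_segment_def a_def)
        also have "\<dots> = (\<integral>x. indicator A x * f x + indicator A' x * f x \<partial>\<nu>)"
          by (rule Bochner_Integration.integral_add[symmetric]) (intro ig A A')+
        also have "\<dots> = (\<integral>x. f x \<partial>\<nu>)"
          by (intro Bochner_Integration.integral_cong) (auto simp: A'_def indicator_def)
        finally show ?thesis using \<nu>(3)[OF f] by simp
      next
        case False
        then show ?thesis using L2[OF False] by (simp add: functional_segment_def I_def)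
      qed
    qed
    moreover have "I A \<in> invariant_functionals T" "I A' \<in> invariant_functionals T"
      using A A' a by (auto intro!: Iinv simp: a_def)
    ultimately have IL: "I A = L" using L a unfolding functional_face_def by blast
    have "uniform_measure \<nu> A = \<nu>"
    proof (rule borel_prob_eqI_integral)
      show "prob_space (uniform_measure \<nu> A)" using A(1) a by (intro ps) (auto simp: a_def)
      fix f :: "'x \<Rightarrow> real" assume f: "continuous_on UNIV f"
      then show "(\<integral>x. f x \<partial>uniform_measure \<nu> A) = (\<integral>x. f x \<partial>\<nu>)"
        using fun_cong[OF IL, of f] \<nu>(3)[OF f] by (simp add: I_def)
    qed (use \<nu> in auto)
    then have "measure \<nu> A' = measure (uniform_measure \<nu> A) A'" by simp
    also have "\<dots> = measure \<nu> (A \<inter> A') / measure \<nu> A"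
      using a A'(1) \<nu>(2) by (intro measure_uniform_measure) (auto simp: a_def emeasure_eq_measure)
    also have "\<dots> = 0" by (simp add: A'_def)
    finally show False using A'(3) a by simp
  qed
  then have "ergodic_prob T \<nu>"
    using \<nu> Tb inv by (auto simp: ergodic_prob_def invariant_prob_def)
  with \<nu>(3) that show ?thesis by blast
qed

text \<open>
  This is how an assumption on ergodic measures yields information on all invariant functionals:
  the minimizers of a continuous affine function form a closed face, and such a face contains an
  extreme point.
\<close>

theorem affine_minimum_ergodic:
  fixes T :: "'x::metric_space \<Rightarrow> 'x"
  assumes X: "compact (UNIV :: 'x set)" and T: "continuous_on UNIV T"
    and h: "continuous_on (invariant_functionals T) h"
    and affine: "\<And>L1 L2 t. L1 \<in> invariant_functionals T \<Longrightarrow> L2 \<in> invariant_functionals T \<Longrightarrow>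
      functional_segment t L1 L2 \<in> invariant_functionals T \<Longrightarrow>
      h (functional_segment t L1 L2) = t * h L1 + (1 - t) * h L2"
  obtains \<nu> L0 where "ergodic_prob T \<nu>" "L0 \<in> invariant_functionals T"
    "\<And>f. continuous_on UNIV f \<Longrightarrow> L0 f = (\<integral>x. f x \<partial>\<nu>)"
    "\<And>L. L \<in> invariant_functionals T \<Longrightarrow> h L0 \<le> h L"
proof -
  let ?I = "invariant_functionals T"
  have cI: "compact ?I" by (rule compact_invariant_functionals[OF X])
  have "closed ?I"
  proof -
    have "closed (mean_functionals :: (('x \<Rightarrow> real) \<Rightarrow> real) set)"
      by (rule closed_mean_functionals)
    moreover have "?I = mean_functionals \<inter> {L. \<forall>f. continuous_on UNIV f \<longrightarrow> L (\<lambda>x. f (T x)) = L f}"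
      by (auto simp: invariant_functionals_def)
    ultimately show ?thesis using closed_Int[OF _ closed_invariant_condition] by simp
  qed
  then have face: "functional_face ?I ?I"
    using invariant_functionals_nonempty[OF X T] unfolding functional_face_def by blast
  obtain L1 where L1: "L1 \<in> ?I" "\<And>L. L \<in> ?I \<Longrightarrow> h L1 \<le> h L" "functional_face ?I {L \<in> ?I. h L \<le> h L1}"
    using functional_face_minimizers[OF cI face h affine] by blast
  obtain L0 where L0: "L0 \<in> {L \<in> ?I. h L \<le> h L1}" "functional_face ?I {L0}"
    using functional_face_contains_extreme[OF cI L1(3)] by blast
  obtain \<nu> where "ergodic_prob T \<nu>" "\<And>f. continuous_on UNIV f \<Longrightarrow> L0 f = (\<integral>x. f x \<partial>\<nu>)"
    using extreme_invariant_functional_ergodic[OF X T L0(2)] by blast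
  moreover have "h L0 \<le> h L" if "L \<in> ?I" for L using L0(1) L1(2)[OF that] by auto
  ultimately show ?thesis using L0(1) that by blast
qed

section \<open>Growth of almost additive functions along orbits\<close>

text \<open>
  For an invariant functional \<open>L\<close> the numbers \<open>L (h n) / n\<close> converge with error at most \<open>a / n\<close>,
  whatever \<open>L\<close> is. The limit \<open>\<pi> L\<close> is therefore a continuous affine function, so its minimum is
  attained at an ergodic measure and is some \<open>p > 0\<close>. If \<open>a / n < p / 4\<close>, then every invariant
  functional gives \<open>h n / n\<close> a value above \<open>p / 2\<close>, and the sums of this function along orbits grow at
  least at rate \<open>p / 2\<close>, uniformly in the starting point. Almost additivity transfers this growth to
  \<open>h\<close> at the multiples of \<open>n\<close>.
\<close>

theorem almost_additive_growth:
  fixes T :: "'x::metric_space \<Rightarrow> 'x" and h :: "nat \<Rightarrow> 'x \<Rightarrow> real"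
  assumes X: "compact (UNIV :: 'x set)" and T: "continuous_on UNIV T"
    and h: "\<And>n. continuous_on UNIV (h n)" and h0: "\<And>x. h 0 x = 0"
    and add: "\<And>m n x. \<bar>h (m + n) x - h n x - h m ((T ^^ n) x)\<bar> \<le> a"
    and pos: "\<And>\<nu>. ergodic_prob T \<nu> \<Longrightarrow> lim (\<lambda>n. 1 / real n * (\<integral>x. h n x \<partial>\<nu>)) > 0"
  obtains N where "N \<ge> 1" "\<And>x. K \<le> h N x"
proof -
  let ?I = "invariant_functionals T"
  have a0: "0 \<le> a" using add[of 0 0 undefined] by simp
  have cT: "continuous_on UNIV (\<lambda>x. h m ((T ^^ n) x))" for m n
    using h continuous_on_funpow[OF T] by (rule continuous_on_compose2) auto
  have mean: "mean_functional L" if "L \<in> ?I" for L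
    using that by (auto simp: invariant_functionals_def mean_functionals_def)
  have inv: "L (\<lambda>x. h m ((T ^^ n) x)) = L (h m)" if L: "L \<in> ?I" for L m n
  proof (induction n)
    case (Suc n)
    have "L (\<lambda>x. (\<lambda>y. h m ((T ^^ n) y)) (T x)) = L (\<lambda>y. h m ((T ^^ n) y))"
      using L cT unfolding invariant_functionals_def by blast
    with Suc show ?case by (simp add: funpow_swap1)
  qed simp
  have badd: "\<bar>L (h (m + n)) - L (h n) - L (h m)\<bar> \<le> a" if L: "L \<in> ?I" for L m n
  proof -
    note mL = mean[OF L]
    have "L (\<lambda>x. h (m + n) x - h n x - h m ((T ^^ n) x)) = L (h (m + n)) - L (h n) - L (h m)"
      using mean_functional_diff[OF mL continuous_on_diff[OF h h] cT, of "m + n" n m n]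
        mean_functional_diff[OF mL h h, of "m + n" n] inv[OF L] by simp
    moreover have "L (\<lambda>x. h (m + n) x - h n x - h m ((T ^^ n) x)) \<le> L (\<lambda>_. a)"
      using add[of m n] by (intro mean_functional_mono[OF mL] continuous_intros h cT) (simp add: abs_le_iff)
    moreover have "L (\<lambda>_. - a) \<le> L (\<lambda>x. h (m + n) x - h n x - h m ((T ^^ n) x))"
    proof (intro mean_functional_mono[OF mL] continuous_intros h cT)
      show "- a \<le> h (m + n) x - h n x - h m ((T ^^ n) x)" for x using add[of m n x] by linarith
    qed
    ultimately show ?thesis by (simp add: mean_functional_const[OF mL] abs_le_iff)
  qed
  have L0': "L (h 0) = 0" if L: "L \<in> ?I" for L
  proof -
    have "h 0 = (\<lambda>_. 0)" by (simp add: fun_eq_iff h0)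
    then show ?thesis using mean_functional_const[OF mean[OF L], of 0] by simp
  qed
  have mult: "\<bar>L (h (k * n)) - real k * L (h n)\<bar> \<le> real k * a" if L: "L \<in> ?I" for L k n
  proof (induction k)
    case (Suc k)
    have "\<bar>L (h (n + k * n)) - L (h (k * n)) - L (h n)\<bar> \<le> a" by (rule badd[OF L])
    with Suc show ?case by (simp add: algebra_simps)
  qed (simp add: L0'[OF L])
  have mult': "\<bar>L (h (k * n)) / real (k * n) - L (h n) / real n\<bar> \<le> a / real n"
    if L: "L \<in> ?I" and kn: "k > 0" "n > 0" for L k n
  proof -
    have "\<bar>L (h (k * n)) / real (k * n) - L (h n) / real n\<bar> = \<bar>L (h (k * n)) - real k * L (h n)\<bar> / real (k * n)"
    proof -
      have "L (h (k * n)) / real (k * n) - L (h n) / real n = (L (h (k * n)) - real k * L (h n)) / real (k * n)"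
        using kn by (simp add: field_simps)
      then show ?thesis by (simp add: abs_divide)
    qed
    also have "\<dots> \<le> real k * a / real (k * n)" by (intro divide_right_mono mult[OF L]) simp
    also have "\<dots> = a / real n" using kn by simp
    finally show ?thesis .
  qed
  have cau: "\<bar>L (h m) / real m - L (h n) / real n\<bar> \<le> a / real m + a / real n"
    if L: "L \<in> ?I" and mn: "m > 0" "n > 0" for L m n
    using mult'[OF L mn(2,1)] mult'[OF L mn] by (simp add: mult.commute)
  have small: "\<exists>M>0. \<forall>m\<ge>M. a / real m < e" if e: "e > 0" for e
  proof -
    have "(\<lambda>m. a / real m) \<longlonglongrightarrow> 0" by (rule lim_const_over_n)
    then obtain M where M: "\<forall>m\<ge>M. a / real m < e"
      using order_tendstoD(2)[of "\<lambda>m. a / real m" 0 sequentially e] e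
      unfolding eventually_sequentially by blast
    then show ?thesis by (intro exI[of _ "Suc M"]) auto
  qed
  define \<pi> where "\<pi> L = lim (\<lambda>n. L (h n) / real n)" for L
  have conv: "(\<lambda>n. L (h n) / real n) \<longlonglongrightarrow> \<pi> L" if L: "L \<in> ?I" for L
    unfolding \<pi>_def
  proof (rule convergent_LIMSEQ_iff[THEN iffD1], rule Cauchy_convergent, rule CauchyI)
    fix e :: real assume "e > 0"
    then obtain M where M: "M > 0" "\<And>m. m \<ge> M \<Longrightarrow> a / real m < e / 2" using small[of "e/2"] by auto
    have "norm (L (h m) / real m - L (h n) / real n) < e" if "m \<ge> M" "n \<ge> M" for m n
    proof -
      have "m > 0" "n > 0" using M(1) that by auto
      from cau[OF L this] M(2)[OF that(1)] M(2)[OF that(2)] show ?thesis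
        unfolding real_norm_def by linarith
    qed
    then show "\<exists>M. \<forall>m\<ge>M. \<forall>n\<ge>M. norm (L (h m) / real m - L (h n) / real n) < e" by blast
  qed
  have near: "\<bar>L (h n) / real n - \<pi> L\<bar> \<le> a / real n" if L: "L \<in> ?I" and n: "n > 0" for L n
  proof (rule LIMSEQ_le)
    show "(\<lambda>m. \<bar>L (h n) / real n - L (h m) / real m\<bar>) \<longlonglongrightarrow> \<bar>L (h n) / real n - \<pi> L\<bar>"
      by (intro tendsto_intros conv L)
    show "(\<lambda>m. a / real n + a / real m) \<longlonglongrightarrow> a / real n"
      using tendsto_add[OF tendsto_const lim_const_over_n[of a], of "a / real n"] by simp
    show "\<exists>N. \<forall>m\<ge>N. \<bar>L (h n) / real n - L (h m) / real m\<bar> \<le> a / real n + a / real m"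
      using cau[OF L _ n] by (intro exI[of _ 1]) (auto simp: abs_minus_commute add.commute)
  qed
  have "uniform_limit ?I (\<lambda>n L. L (h n) / real n) \<pi> sequentially"
  proof (rule uniform_limitI)
    fix e :: real assume "e > 0"
    then obtain M where M: "M > 0" "\<And>m. m \<ge> M \<Longrightarrow> a / real m < e" using small[of e] by auto
    have "dist (L (h n) / real n) (\<pi> L) < e" if "n \<ge> M" "L \<in> ?I" for n L
    proof -
      have "n > 0" using M(1) that by auto
      from near[OF that(2) this] M(2)[OF that(1)] show ?thesis
        unfolding dist_real_def by linarith
    qed
    then show "\<forall>\<^sub>F n in sequentially. \<forall>L\<in>?I. dist (L (h n) / real n) (\<pi> L) < e"
      by (auto simp: eventually_sequentially)
  qed
  moreover have "continuous_on ?I (\<lambda>L. L (h n) / real n)" for n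
    by (rule continuous_on_subset[of UNIV])
      (auto intro!: continuous_on_divide continuous_evaluation continuous_on_const simp: divide_inverse
        intro: continuous_on_mult_right continuous_evaluation)
  ultimately have c\<pi>: "continuous_on ?I \<pi>"
    by (intro uniform_limit_theorem) auto
  have affine: "\<pi> (functional_segment t L1 L2) = t * \<pi> L1 + (1 - t) * \<pi> L2"
    if L: "L1 \<in> ?I" "L2 \<in> ?I" "functional_segment t L1 L2 \<in> ?I" for L1 L2 t
  proof (rule LIMSEQ_unique)
    show "(\<lambda>n. functional_segment t L1 L2 (h n) / real n) \<longlonglongrightarrow> \<pi> (functional_segment t L1 L2)"
      by (rule conv[OF L(3)])
    have "(\<lambda>n. t * (L1 (h n) / real n) + (1 - t) * (L2 (h n) / real n)) \<longlonglongrightarrow> t * \<pi> L1 + (1 - t) * \<pi> L2"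
      by (intro tendsto_intros conv L)
    then show "(\<lambda>n. functional_segment t L1 L2 (h n) / real n) \<longlonglongrightarrow> t * \<pi> L1 + (1 - t) * \<pi> L2"
      by (simp add: functional_segment_def add_divide_distrib)
  qed
  obtain \<nu> L0 where \<nu>: "ergodic_prob T \<nu>" "L0 \<in> ?I"
    "\<And>f. continuous_on UNIV f \<Longrightarrow> L0 f = (\<integral>x. f x \<partial>\<nu>)"
    "\<And>L. L \<in> ?I \<Longrightarrow> \<pi> L0 \<le> \<pi> L"
    using affine_minimum_ergodic[OF X T c\<pi> affine] by blast
  define p where "p = \<pi> L0"
  have p: "p > 0" using pos[OF \<nu>(1)] \<nu>(3)[OF h] by (simp add: p_def \<pi>_def)
  obtain n where n: "n > 0" "a / real n < p / 4" using small[of "p/4"] p by auto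
  define g where "g x = h n x / real n" for x
  have cg: "continuous_on UNIV g" unfolding g_def using n by (intro continuous_intros h) auto
  have "p / 2 < L g" if L: "L \<in> ?I" for L
  proof -
    have "L g = L (h n) / real n"
      using mean_functionalD(3)[OF mean[OF L] h, of "1 / real n" n] by (simp add: g_def[abs_def])
    then show ?thesis using near[OF L n(1)] \<nu>(4)[OF L] n(2) p unfolding p_def by linarith
  qed
  then obtain N0 where N0: "\<And>N x. N \<ge> N0 \<Longrightarrow> real N * (p / 2) \<le> (\<Sum>k<N. g ((T ^^ k) x))"
    using uniform_ergodic_lower_bound[OF X T cg] by blast
  obtain H where H: "H \<ge> 0" "\<And>x. \<bar>h 1 x\<bar> \<le> H" using continuous_bounded_real[OF X h] by blast
  define c where "c = 2 * a + 2 * H"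
  have c0: "c \<ge> 0" using H a0 by (simp add: c_def)
  \<comment> \<open>Dropping the first factor and appending one at the end costs a constant independent of \<open>m\<close>.\<close>
  have shift: "h m (T x) \<le> h m x + c" for m x
    using add[of m 1 x] add[of 1 m x] H(2)[of x] H(2)[of "(T ^^ m) x"] unfolding c_def by simp
  have shiftr: "h m ((T ^^ r) x) \<le> h m x + real r * c" for m r x
  proof (induction r)
    case (Suc r)
    then show ?case using shift[of m "(T ^^ r) x"] by (simp add: algebra_simps)
  qed simp
  have block: "(\<Sum>l<k. h n ((T ^^ (l * n)) x)) \<le> h (k * n) x + real k * a" for k x
  proof (induction k)
    case (Suc k)
    then show ?case using add[of n "k * n" x] by (simp add: algebra_simps)
  qed (simp add: h0)
  \<comment> \<open>
    An orbit segment of length \<open>l * n\<close> splits into \<open>n\<close> progressions of step \<open>n\<close>, one for each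
    residue \<open>r\<close>; \<open>block\<close> applies to each of them, started at \<open>T\<^sup>r x\<close>.\<close>
  have total: "(\<Sum>k<l * n. h n ((T ^^ k) x)) \<le> real n * (h (l * n) x + real n * c + real l * a)" for l x
  proof -
    have "(\<Sum>k<l * n. h n ((T ^^ k) x)) = (\<Sum>i<l. \<Sum>k\<in>{i * n..<i * n + n}. h n ((T ^^ k) x))"
      by (rule sum.nat_group[symmetric])
    also have "\<dots> = (\<Sum>i<l. \<Sum>r<n. h n ((T ^^ (i * n + r)) x))"
    proof (rule sum.cong[OF refl])
      fix i
      show "(\<Sum>k\<in>{i * n..<i * n + n}. h n ((T ^^ k) x)) = (\<Sum>r<n. h n ((T ^^ (i * n + r)) x))"
        using sum.shift_bounds_nat_ivl[of "\<lambda>k. h n ((T ^^ k) x)" 0 "i * n" n]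
        by (simp add: lessThan_atLeast0 add.commute)
    qed
    also have "\<dots> = (\<Sum>r<n. \<Sum>i<l. h n ((T ^^ (i * n)) ((T ^^ r) x)))"
      by (subst sum.swap) (simp add: funpow_add)
    also have "\<dots> \<le> (\<Sum>r<n. h (l * n) x + real n * c + real l * a)"
    proof (rule sum_mono)
      fix r assume "r \<in> {..<n}"
      then have "real r * c \<le> real n * c" using c0 by (intro mult_right_mono) auto
      then show "(\<Sum>i<l. h n ((T ^^ (i * n)) ((T ^^ r) x))) \<le> h (l * n) x + real n * c + real l * a"
        using block[of "(T ^^ r) x" l] shiftr[of "l * n" r x] by linarith
    qed
    finally show ?thesis by simp
  qed
  have grow: "real l * (real n * p / 4) - real n * c \<le> h (l * n) x" if l: "l \<ge> N0" for l x
  proof -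
    have "l * n \<ge> N0" using l n(1) by (metis Suc_leI le_trans mult.right_neutral mult_le_mono2 One_nat_def)
    then have "real (l * n) * (p / 2) \<le> (\<Sum>k<l * n. h n ((T ^^ k) x)) / real n"
      using N0[of "l * n" x] by (simp add: g_def sum_divide_distrib)
    also have "\<dots> \<le> h (l * n) x + real n * c + real l * a"
      using total[of x l] n(1) by (simp add: divide_le_eq mult.commute)
    also have "real l * a \<le> real l * (real n * p / 4)"
      using n by (intro mult_left_mono) (simp_all add: field_simps)
    finally show ?thesis by (simp add: algebra_simps)
  qed
  have np: "real n * p / 4 > 0" using n p by simp
  obtain l0 where l0: "K + real n * c < real l0 * (real n * p / 4)"
    using reals_Archimedean3[OF np] by blast
  define l where "l = Suc (max l0 N0)"
  have "K \<le> h (l * n) x" for x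
  proof -
    have "real l0 * (real n * p / 4) \<le> real l * (real n * p / 4)"
      using np by (intro mult_right_mono) (auto simp: l_def)
    moreover have "l \<ge> N0" by (simp add: l_def)
    ultimately show ?thesis using grow[of l x] l0 by linarith
  qed
  moreover have "l * n \<ge> 1" using n(1) by (simp add: l_def)
  ultimately show ?thesis using that by blast
qed

section \<open>Moments as derivatives of generating functions\<close>

text \<open>
  The difference quotient at \<open>1\<close> is the expectation of \<open>w * (1 + t + \<dots> + t ^ (k - 1))\<close>, which
  increases to \<open>w * k\<close> as \<open>t\<close> tends to \<open>1\<close>. By monotone convergence, the existence of the one-sided
  derivative already implies that the moment is finite.
\<close>

lemma moment_of_differentiable_expectation:
  fixes p :: "'a pmf" and w :: "'a \<Rightarrow> real" and k :: "'a \<Rightarrow> nat"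
  assumes w: "integrable p w" "\<And>x. 0 \<le> w x"
    and D: "((\<lambda>u. measure_pmf.expectation p (\<lambda>x. w x * u ^ k x)) has_real_derivative m) (at 1 within {0..1})"
  shows "integrable p (\<lambda>x. w x * real (k x))"
    and "measure_pmf.expectation p (\<lambda>x. w x * real (k x)) = m"
proof -
  define t where "t n = 1 - inverse (real (Suc n))" for n
  have t: "0 \<le> t n" "t n < 1" for n by (auto simp: t_def field_simps)
  have t_mono: "t n \<le> t n'" if "n \<le> n'" for n n' using that by (auto simp: t_def field_simps)
  have t_lim: "t \<longlonglongrightarrow> 1"
    using tendsto_diff[OF tendsto_const LIMSEQ_inverse_real_of_nat, of 1] by (simp add: t_def[abs_def])
  define f where "f n x = w x * (\<Sum>l<k x. t n ^ l)" for n x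
  have f_eq: "f n x = (w x - w x * t n ^ k x) / (1 - t n)" for n x
  proof -
    have "w x - w x * t n ^ k x = w x * (1 - t n ^ k x)" by (simp add: algebra_simps)
    also have "\<dots> = (1 - t n) * f n x" unfolding one_diff_power_eq f_def by (simp add: algebra_simps)
    finally show ?thesis using t(2)[of n] by simp
  qed
  have int: "integrable p (\<lambda>x. w x * t n ^ k x)" for n
  proof (rule Bochner_Integration.integrable_bound[OF w(1)])
    show "AE x in p. norm (w x * t n ^ k x) \<le> norm (w x)"
      using t[of n] w(2) by (intro AE_I2) (auto simp: abs_mult mult_left_le power_le_one)
  qed simp
  let ?F = "\<lambda>u. measure_pmf.expectation p (\<lambda>x. w x * u ^ k x)"
  have quot: "((\<lambda>u. (?F u - ?F 1) / (u - 1)) \<longlongrightarrow> m) (at 1 within {0..1})"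
    using D by (simp add: has_field_derivative_iff)
  have "((\<lambda>u. (?F u - ?F 1) / (u - 1)) \<circ> t) \<longlonglongrightarrow> m"
    using quot[unfolded tendsto_at_iff_sequentially, rule_format, OF _ t_lim] t
    by (auto simp: less_imp_le less_le)
  moreover have "((\<lambda>u. (?F u - ?F 1) / (u - 1)) \<circ> t) n = measure_pmf.expectation p (f n)" for n
  proof -
    have "measure_pmf.expectation p (f n) = (?F 1 - ?F (t n)) / (1 - t n)"
      unfolding f_eq using int[of n] w(1) by simp
    also have "\<dots> = (?F (t n) - ?F 1) / (t n - 1)"
      using minus_divide_divide[of "?F (t n) - ?F 1" "t n - 1"] by simp
    finally show ?thesis by simp
  qed
  ultimately have lim: "(\<lambda>n. measure_pmf.expectation p (f n)) \<longlonglongrightarrow> m" by (simp add: o_def)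
  have if': "integrable p (f n)" for n unfolding f_eq using int w(1) by simp
  have mono: "mono (\<lambda>n. f n x)" for x
    unfolding f_def by (intro monoI mult_left_mono sum_mono power_mono t_mono t w)
  have flim: "(\<lambda>n. f n x) \<longlonglongrightarrow> w x * real (k x)" for x
  proof -
    have "(\<lambda>n. w x * (\<Sum>l<k x. t n ^ l)) \<longlonglongrightarrow> w x * (\<Sum>l<k x. 1 ^ l)"
      by (intro tendsto_intros t_lim)
    then show ?thesis by (simp add: f_def)
  qed
  show "integrable p (\<lambda>x. w x * real (k x))"
    by (rule integrable_monotone_convergence[OF if' _ _ lim]) (auto simp: mono flim)
  show "measure_pmf.expectation p (\<lambda>x. w x * real (k x)) = m"
    by (rule integral_monotone_convergence[OF if' _ _ lim]) (auto simp: mono flim)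
qed

text \<open>
  On the unit interval the difference quotients of \<open>u \<mapsto> w * u ^ k\<close> are dominated by \<open>w * k\<close>.
\<close>

lemma has_derivative_expectation_power:
  fixes p :: "'a pmf" and w :: "'a \<Rightarrow> real" and k :: "'a \<Rightarrow> nat"
  assumes w: "integrable p w" "\<And>x. 0 \<le> w x" and wk: "integrable p (\<lambda>x. w x * real (k x))"
    and t: "t \<in> {0..1}"
  shows "((\<lambda>u. measure_pmf.expectation p (\<lambda>x. w x * u ^ k x)) has_real_derivative
     measure_pmf.expectation p (\<lambda>x. w x * (real (k x) * t ^ (k x - 1)))) (at t within {0..1})"
  unfolding has_field_derivative_iff tendsto_at_iff_sequentially
proof (intro allI impI)
  fix X :: "nat \<Rightarrow> real" assume X: "\<forall>i. X i \<in> {0..1} - {t}" and lim: "X \<longlonglongrightarrow> t"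
  have int: "integrable p (\<lambda>x. w x * u ^ k x)" if "u \<in> {0..1}" for u
  proof (rule Bochner_Integration.integrable_bound[OF w(1)])
    show "AE x in p. norm (w x * u ^ k x) \<le> norm (w x)"
      using that w(2) by (intro AE_I2) (auto simp: abs_mult mult_left_le power_le_one)
  qed simp
  let ?q = "\<lambda>i x. w x * ((X i ^ k x - t ^ k x) / (X i - t))"
  have "(\<lambda>i. measure_pmf.expectation p (?q i)) \<longlonglongrightarrow>
      measure_pmf.expectation p (\<lambda>x. w x * (real (k x) * t ^ (k x - 1)))"
  proof (rule integral_dominated_convergence[OF _ _ wk])
    show "AE x in p. (\<lambda>i. ?q i x) \<longlonglongrightarrow> w x * (real (k x) * t ^ (k x - 1))"
    proof (rule AE_I2)
      fix x
      have "((\<lambda>u. u ^ k x) has_real_derivative real (k x) * t ^ (k x - 1)) (at t within {0..1})"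
        by (auto intro!: derivative_eq_intros)
      then have "((\<lambda>u. (u ^ k x - t ^ k x) / (u - t)) \<circ> X) \<longlonglongrightarrow> real (k x) * t ^ (k x - 1)"
        using X lim unfolding has_field_derivative_iff tendsto_at_iff_sequentially by blast
      then show "(\<lambda>i. ?q i x) \<longlonglongrightarrow> w x * (real (k x) * t ^ (k x - 1))"
        by (intro tendsto_mult_left) (simp add: o_def)
    qed
    show "AE x in p. norm (?q i x) \<le> w x * real (k x)" for i
    proof (rule AE_I2)
      fix x
      have Xi: "0 \<le> X i" "X i \<le> 1" "X i \<noteq> t" using X by auto
      then have "norm (X i ^ k x - t ^ k x) \<le> real (k x) * norm (X i - t)"
        using t by (intro norm_power_diff) auto
      then have "norm ((X i ^ k x - t ^ k x) / (X i - t)) \<le> real (k x)"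
        using Xi by (simp add: abs_divide divide_le_eq)
      then show "norm (?q i x) \<le> w x * real (k x)"
        unfolding real_norm_def abs_mult abs_of_nonneg[OF w(2)] by (rule mult_left_mono[OF _ w(2)])
    qed
  qed auto
  moreover have "measure_pmf.expectation p (?q i) =
     (measure_pmf.expectation p (\<lambda>x. w x * X i ^ k x) - measure_pmf.expectation p (\<lambda>x. w x * t ^ k x)) / (X i - t)" for i
  proof -
    have "?q i x = (w x * X i ^ k x - w x * t ^ k x) / (X i - t)" for x by (simp add: field_simps)
    then show ?thesis using int[of "X i"] int[OF t] X by (simp add: Bochner_Integration.integral_diff)
  qed
  ultimately show "((\<lambda>u. (measure_pmf.expectation p (\<lambda>x. w x * u ^ k x) -
      measure_pmf.expectation p (\<lambda>x. w x * t ^ k x)) / (u - t)) \<circ> X) \<longlonglongrightarrow>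
      measure_pmf.expectation p (\<lambda>x. w x * (real (k x) * t ^ (k x - 1)))"
    by (simp only: o_def)
qed

definition unit_cube :: "(real ^ 'd) set" where
  "unit_cube = {s. \<forall>j. 0 \<le> s $ j \<and> s $ j \<le> 1}"

abbreviation mpow :: "real ^ 'd::finite \<Rightarrow> nat ^ 'd \<Rightarrow> real" where
  "mpow s k \<equiv> (\<Prod>j\<in>UNIV. (s $ j) ^ (k $ j))"

lemma mpow_bounds:
  assumes "s \<in> unit_cube"
  shows "0 \<le> mpow s k" "mpow s k \<le> 1"
  using assms by (auto simp: unit_cube_def intro!: prod_nonneg prod_le_1 power_le_one)

text \<open>
  On the cube the defining series converges absolutely; elsewhere it may fail to be summable.
\<close>

lemma gen_fun_expectation:
  assumes s: "s \<in> unit_cube"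
  shows "gen_fun p s = measure_pmf.expectation p (mpow s)"
proof -
  have "Infinite_Set_Sum.abs_summable_on (\<lambda>k. pmf p k * mpow s k) UNIV"
    by (rule abs_summable_on_comparison_test[OF pmf_abs_summable[of p]])
      (use mpow_bounds[OF s] in \<open>auto simp: abs_mult mult_left_le\<close>)
  then show ?thesis
    unfolding gen_fun_def pmf_expectation_eq_infsetsum by (simp add: infsetsum_infsum)
qed

lemma integrable_pmf_bounded:
  fixes f :: "'a \<Rightarrow> real"
  assumes "\<And>x. \<bar>f x\<bar> \<le> B"
  shows "integrable (measure_pmf p) f"
  by (rule measure_pmf.integrable_const_bound[where B=B]) (use assms in auto)

lemma integrable_mpow: "s \<in> unit_cube \<Longrightarrow> integrable (measure_pmf p) (mpow s)"
  by (rule integrable_pmf_bounded[where B=1]) (metis abs_of_nonneg mpow_bounds)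

lemma mpow_update_one: "mpow (\<chi> l. if l = i then t else 1) k = t ^ (k $ i)"
proof -
  have "mpow (\<chi> l. if l = i then t else 1) k = (\<Prod>j\<in>UNIV. if j = i then t ^ (k $ i) else 1)"
    by (intro prod.cong) auto
  then show ?thesis by simp
qed

lemma mpow_update_two:
  assumes "i \<noteq> j"
  shows "mpow (\<chi> l. if l = j then u else (\<chi> l. if l = i then t else 1) $ l) k = t ^ (k $ i) * u ^ (k $ j)"
proof -
  have "mpow (\<chi> l. if l = j then u else (\<chi> l. if l = i then t else 1) $ l) k =
      (\<Prod>l\<in>UNIV. (if l = i then t ^ (k $ i) else 1) * (if l = j then u ^ (k $ j) else 1))"
    using assms by (intro prod.cong) auto
  then show ?thesis by (simp add: prod.distrib)
qed

lemma partial_deriv_works: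
  assumes "partial_differentiable i f 1"
    and "\<And>t. t \<in> {0..1} \<Longrightarrow> f (\<chi> l. if l = i then t else 1) = g t"
  shows "(g has_real_derivative partial_deriv i f 1) (at 1 within {0..1})"
proof -
  have "(line_fun i f 1 has_vector_derivative partial_deriv i f 1) (at 1 within {0..1})"
    using assms(1) unfolding partial_differentiable_def partial_deriv_def vector_derivative_works by simp
  then have "(g has_vector_derivative partial_deriv i f 1) (at 1 within {0..1})"
    by (rule has_vector_derivative_transform[rotated 2]) (auto simp: line_fun_def assms(2) cong: if_cong)
  then show ?thesis by (simp add: has_real_derivative_iff_has_vector_derivative)
qed

lemma partial_derivI:
  assumes t: "s $ i \<in> {0..1}" and g: "(g has_real_derivative D) (at (s $ i) within {0..1})"
    and f: "\<And>u. u \<in> {0..1} \<Longrightarrow> f (\<chi> l. if l = i then u else s $ l) = g u"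
  shows "partial_deriv i f s = D"
proof -
  have "(g has_vector_derivative D) (at (s $ i) within {0..1})"
    using g by (simp add: has_real_derivative_iff_has_vector_derivative)
  then have "(line_fun i f s has_vector_derivative D) (at (s $ i) within {0..1})"
    by (rule has_vector_derivative_transform[OF t, rotated]) (simp add: line_fun_def f)
  then show ?thesis
    unfolding partial_deriv_def using t by (intro vector_derivative_within_closed_interval) auto
qed

lemma mean_offspring:
  assumes d: "partial_differentiable i (gen_fun p) 1"
  shows "integrable (measure_pmf p) (\<lambda>k. real (k $ i))"
    and "measure_pmf.expectation p (\<lambda>k. real (k $ i)) = partial_deriv i (gen_fun p) 1"
proof -
  have "gen_fun p (\<chi> l. if l = i then t else 1) = measure_pmf.expectation p (\<lambda>k. 1 * t ^ (k $ i))"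
    if "t \<in> {0..1}" for t
    using that by (subst gen_fun_expectation) (auto simp: unit_cube_def mpow_update_one[simplified])
  from partial_deriv_works[OF d this]
  have D: "((\<lambda>t. measure_pmf.expectation p (\<lambda>k. 1 * t ^ (k $ i))) has_real_derivative partial_deriv i (gen_fun p) 1)
     (at 1 within {0..1})" by simp
  show "integrable (measure_pmf p) (\<lambda>k. real (k $ i))"
    "measure_pmf.expectation p (\<lambda>k. real (k $ i)) = partial_deriv i (gen_fun p) 1"
    using moment_of_differentiable_expectation[OF _ _ D] by simp_all
qed

text \<open>
  The inner derivative contributes the factor \<open>k $ j\<close>, and for \<open>i = j\<close> it also lowers the exponent
  by one; this is the reason for the case distinction in \<open>c\<close>.
\<close>

lemma second_factorial_moment:
  fixes p :: "(nat ^ 'd::finite) pmf"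
  assumes d1: "\<And>i. partial_differentiable i (gen_fun p) 1"
    and d2: "partial_differentiable i (partial_deriv j (gen_fun p)) 1"
  defines "c \<equiv> \<lambda>k :: nat ^ 'd. real (k $ j) * real (if i = j then k $ i - 1 else k $ i)"
  shows "integrable (measure_pmf p) c"
    and "measure_pmf.expectation p c = partial_deriv i (partial_deriv j (gen_fun p)) 1"
proof -
  have int: "integrable (measure_pmf p) (\<lambda>k. real (k $ l))" for l by (rule mean_offspring[OF d1])
  have "partial_deriv j (gen_fun p) (\<chi> l. if l = i then t else 1) =
      measure_pmf.expectation p (\<lambda>k. real (k $ j) * t ^ (if i = j then k $ i - 1 else k $ i))"
    if t: "t \<in> {0..1}" for t
  proof (cases "i = j")
    case True
    have g: "gen_fun p (\<chi> l. if l = j then u else (\<chi> l. if l = i then t else 1) $ l) =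
        measure_pmf.expectation p (\<lambda>k. 1 * u ^ (k $ j))" if u: "u \<in> {0..1}" for u
    proof -
      have "(\<chi> l. if l = j then u else (\<chi> l. if l = i then t else 1) $ l) = (\<chi> l. if l = j then u else 1)"
        using True by (simp add: vec_eq_iff)
      then show ?thesis
        using u by (simp, subst gen_fun_expectation) (auto simp: unit_cube_def mpow_update_one[simplified])
    qed
    have "((\<lambda>u. measure_pmf.expectation p (\<lambda>k. 1 * u ^ (k $ j))) has_real_derivative
        measure_pmf.expectation p (\<lambda>k. 1 * (real (k $ j) * t ^ (k $ j - 1)))) (at t within {0..1})"
      by (rule has_derivative_expectation_power) (use int t in auto)
    then have "partial_deriv j (gen_fun p) (\<chi> l. if l = i then t else 1) =
        measure_pmf.expectation p (\<lambda>k. 1 * (real (k $ j) * t ^ (k $ j - 1)))"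
      using True t
      by (intro partial_derivI[where g="\<lambda>u. measure_pmf.expectation p (\<lambda>k. 1 * u ^ (k $ j))"] g) auto
    then show ?thesis using True by simp
  next
    case False
    have g: "gen_fun p (\<chi> l. if l = j then u else (\<chi> l. if l = i then t else 1) $ l) =
        measure_pmf.expectation p (\<lambda>k. t ^ (k $ i) * u ^ (k $ j))" if u: "u \<in> {0..1}" for u
      using t u by (subst gen_fun_expectation) (auto simp: unit_cube_def mpow_update_two[OF False, simplified])
    have ti: "integrable (measure_pmf p) (\<lambda>k. t ^ (k $ i))"
      using t by (intro integrable_pmf_bounded[where B=1]) (auto simp: abs_of_nonneg power_le_one)
    have "integrable (measure_pmf p) (\<lambda>k. t ^ (k $ i) * real (k $ j))"
      by (rule Bochner_Integration.integrable_bound[OF int[of j]])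
        (use t in \<open>auto intro!: AE_I2 mult_left_le_one_le simp: abs_mult power_le_one\<close>)
    then have "((\<lambda>u. measure_pmf.expectation p (\<lambda>k. t ^ (k $ i) * u ^ (k $ j))) has_real_derivative
        measure_pmf.expectation p (\<lambda>k. t ^ (k $ i) * (real (k $ j) * 1 ^ (k $ j - 1)))) (at 1 within {0..1})"
      using t by (intro has_derivative_expectation_power ti) auto
    then have "partial_deriv j (gen_fun p) (\<chi> l. if l = i then t else 1) =
        measure_pmf.expectation p (\<lambda>k. t ^ (k $ i) * (real (k $ j) * 1 ^ (k $ j - 1)))"
      using False
      by (intro partial_derivI[where g="\<lambda>u. measure_pmf.expectation p (\<lambda>k. t ^ (k $ i) * u ^ (k $ j))"] g) auto
    then show ?thesis using False by (simp add: mult.commute)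
  qed
  from partial_deriv_works[OF d2 this]
  have D: "((\<lambda>t. measure_pmf.expectation p (\<lambda>k. real (k $ j) * t ^ (if i = j then k $ i - 1 else k $ i)))
      has_real_derivative partial_deriv i (partial_deriv j (gen_fun p)) 1) (at 1 within {0..1})" by simp
  show "integrable (measure_pmf p) c"
    "measure_pmf.expectation p c = partial_deriv i (partial_deriv j (gen_fun p)) 1"
    unfolding c_def using moment_of_differentiable_expectation[OF int _ D] by auto
qed

text \<open>
  The factor \<open>2\<close> is needed for \<open>i = j\<close>, where the second moment is the factorial moment plus the mean.
\<close>

lemma second_moment_bound:
  fixes p :: "(nat ^ 'd::finite) pmf"
  assumes d1: "\<And>i. partial_differentiable i (gen_fun p) 1" "\<And>i. partial_deriv i (gen_fun p) 1 \<le> D"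
    and d2: "\<And>i j. partial_differentiable i (partial_deriv j (gen_fun p)) 1"
      "\<And>i j. partial_deriv i (partial_deriv j (gen_fun p)) 1 \<le> D" and D: "0 \<le> D"
  shows "integrable (measure_pmf p) (\<lambda>k. real (k $ i) * real (k $ j))"
    and "measure_pmf.expectation p (\<lambda>k. real (k $ i) * real (k $ j)) \<le> 2 * D"
proof -
  let ?c = "\<lambda>k :: nat ^ 'd. real (k $ j) * real (if i = j then k $ i - 1 else k $ i)"
  note c = second_factorial_moment[OF d1(1) d2(1)[of i j]]
  note m = mean_offspring[OF d1(1)[of j]]
  have eq: "real (k $ i) * real (k $ j) = ?c k + (if i = j then real (k $ j) else 0)" for k :: "nat ^ 'd"
    by (cases "k $ j") (auto simp: algebra_simps)
  have m': "integrable (measure_pmf p) (\<lambda>k. if i = j then real (k $ j) else 0)"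
    using m(1) by (cases "i = j") auto
  show "integrable (measure_pmf p) (\<lambda>k. real (k $ i) * real (k $ j))"
    unfolding eq by (rule Bochner_Integration.integrable_add[OF c(1) m'])
  have "measure_pmf.expectation p (\<lambda>k. real (k $ i) * real (k $ j)) =
      measure_pmf.expectation p ?c + (if i = j then measure_pmf.expectation p (\<lambda>k. real (k $ j)) else 0)"
    unfolding eq using Bochner_Integration.integral_add[OF c(1) m'] by (cases "i = j") auto
  also have "\<dots> \<le> D + D"
    unfolding c(2) m(2) using d1(2) d2(2) D by (intro add_mono) auto
  finally show "measure_pmf.expectation p (\<lambda>k. real (k $ i) * real (k $ j)) \<le> 2 * D" by simp
qed

section \<open>The process and its generating functions\<close>

definition gen_step :: "('x \<Rightarrow> 'd::finite \<Rightarrow> (nat ^ 'd) pmf) \<Rightarrow> 'x \<Rightarrow> real ^ 'd \<Rightarrow> real ^ 'd" where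
  "gen_step \<mu> x s = (\<chi> i. gen_fun (\<mu> x i) s)"

text \<open>
  The map of the last generation is applied first. This is the order in which conditioning on the
  population of generation \<open>n\<close> produces the maps.
\<close>

primrec gen_iter ::
  "('x \<Rightarrow> 'd::finite \<Rightarrow> (nat ^ 'd) pmf) \<Rightarrow> ('x \<Rightarrow> 'x) \<Rightarrow> nat \<Rightarrow> 'x \<Rightarrow> real ^ 'd \<Rightarrow> real ^ 'd" where
  "gen_iter \<mu> T 0 x s = s"
| "gen_iter \<mu> T (Suc n) x s = gen_iter \<mu> T n x (gen_step \<mu> ((T ^^ n) x) s)"

lemma gen_step_cube: "s \<in> unit_cube \<Longrightarrow> gen_step \<mu> x s \<in> unit_cube"
proof -
  assume s: "s \<in> unit_cube"
  have "0 \<le> measure_pmf.expectation p (mpow s)" "measure_pmf.expectation p (mpow s) \<le> 1" for p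
    using mpow_bounds[OF s] measure_pmf.integral_le_const[of p "mpow s" 1] integrable_mpow[OF s]
    by (auto intro!: Bochner_Integration.integral_nonneg)
  then show ?thesis by (simp add: unit_cube_def gen_step_def gen_fun_expectation[OF s])
qed

lemma measurable_add_countable:
  fixes f g :: "'a \<Rightarrow> 'b::{countable, plus}"
  assumes f: "f \<in> measurable M (count_space UNIV)" and g: "g \<in> measurable M (count_space UNIV)"
  shows "(\<lambda>x. f x + g x) \<in> measurable M (count_space UNIV)"
  by (rule measurable_compose_countable[OF _ f]) (rule measurable_compose[OF g], simp)

lemma measurable_sum_countable:
  fixes f :: "'i \<Rightarrow> 'a \<Rightarrow> 'b::{countable, comm_monoid_add}"
  assumes "\<And>i. i \<in> I \<Longrightarrow> f i \<in> measurable M (count_space UNIV)"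
  shows "(\<lambda>x. \<Sum>i\<in>I. f i x) \<in> measurable M (count_space UNIV)"
  using assms by (induction I rule: infinite_finite_induct) (auto intro: measurable_add_countable)

lemma gw_process_Suc_sum:
  "gw_process z \<omega> (Suc n) = (\<Sum>i\<in>UNIV. \<Sum>k<gw_process z \<omega> n $ i. \<omega> (n, i, k))"
  by (simp add: vec_eq_iff)

lemma gw_process_cong:
  "(\<And>m i k. m < n \<Longrightarrow> \<omega> (m, i, k) = \<omega>' (m, i, k)) \<Longrightarrow> gw_process z \<omega> n = gw_process z \<omega>' n"
proof (induction n)
  case (Suc n)
  then have "gw_process z \<omega> n = gw_process z \<omega>' n" by simp
  then show ?case using Suc.prems[of n] unfolding gw_process_Suc_sum by simp
qed simp

lemma gw_process_absorb: "gw_process z \<omega> n = 0 \<Longrightarrow> gw_process z \<omega> (Suc n) = 0"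
  by (simp add: vec_eq_iff)

lemma mpow_sum: "mpow s (\<Sum>c\<in>I. v c) = (\<Prod>c\<in>I. mpow s (v c))"
proof -
  have "mpow s (\<Sum>c\<in>I. v c) = (\<Prod>j\<in>UNIV. \<Prod>c\<in>I. (s $ j) ^ (v c $ j))"
    by (simp add: sum_component power_sum)
  then show ?thesis by (simp add: prod.swap[of _ _ I])
qed

context
  fixes \<mu> :: "'x \<Rightarrow> 'd::finite \<Rightarrow> (nat ^ 'd) pmf" and T :: "'x \<Rightarrow> 'x" and x :: 'x
begin

private definition law :: "nat \<times> 'd \<times> nat \<Rightarrow> (nat ^ 'd) measure" where
  "law = (\<lambda>(n, i, k). measure_pmf (\<mu> ((T ^^ n) x) i))"

private lemma offspring_law: "offspring_measure \<mu> T x = PiM UNIV law"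
  by (simp add: offspring_measure_def law_def)

private lemma law_prob: "prob_space (law c)"
  by (cases c) (simp add: law_def prob_space_measure_pmf)

private lemma sets_law: "sets (law c) = UNIV"
  by (cases c) (simp add: law_def)

private lemma space_offspring: "space (PiM UNIV law) = UNIV"
proof -
  have "space (law c) = UNIV" for c by (cases c) (simp add: law_def)
  then show ?thesis by (simp add: space_PiM)
qed

private lemma coord_measurable: "J = UNIV \<or> c \<in> J \<Longrightarrow> (\<lambda>\<omega>. \<omega> c) \<in> measurable (PiM J law) (count_space UNIV)"
proof -
  assume "J = UNIV \<or> c \<in> J"
  then have "(\<lambda>\<omega>. \<omega> c) \<in> measurable (PiM J law) (law c)" by (intro measurable_component_singleton) auto
  moreover have "sets (law c) = sets (count_space UNIV)" by (simp add: sets_law)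
  ultimately show ?thesis using measurable_cong_sets[OF refl] by blast
qed

private lemma gw_measurable:
  assumes "\<And>m i k. m < n \<Longrightarrow> (m, i, k) \<in> J"
  shows "(\<lambda>\<omega>. gw_process z \<omega> n) \<in> measurable (PiM J law) (count_space UNIV)"
  using assms
proof (induction n)
  case (Suc n)
  show ?case
    unfolding gw_process_Suc_sum
  proof (rule measurable_compose_countable[where g="\<lambda>\<omega>. gw_process z \<omega> n"
        and f="\<lambda>z' \<omega>. \<Sum>i\<in>UNIV. \<Sum>k<z' $ i. \<omega> (n, i, k)"])
    show "(\<lambda>\<omega>. gw_process z \<omega> n) \<in> measurable (PiM J law) (count_space UNIV)"
      using Suc by simp
    show "(\<lambda>\<omega>. \<Sum>i\<in>UNIV. \<Sum>k<z' $ i. \<omega> (n, i, k)) \<in> measurable (PiM J law) (count_space UNIV)" for z'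
      using Suc.prems by (intro measurable_sum_countable coord_measurable) auto
  qed
qed simp

private lemma coord_indep: "prob_space.indep_vars (PiM UNIV law) law (\<lambda>c \<omega>. \<omega> c) UNIV"
proof -
  interpret P: product_prob_space law UNIV
    by (simp add: product_prob_space_def product_prob_space_axioms_def product_sigma_finite_def
        law_prob prob_space_imp_sigma_finite)
  show ?thesis
    by (subst P.indep_vars_iff_distr_eq_PiM) (auto simp: P.PiM_component restrict_UNIV distr_id)
qed

text \<open>
  Given the population \<open>z\<close> of generation \<open>n\<close>, the monomial is a product over individuals, whose
  offspring vectors are distinct coordinates of the product space.
\<close>

private lemma expectation_step:
  assumes s: "s \<in> unit_cube"
  shows "(\<integral>\<^sup>+\<omega>. ennreal (mpow s (\<Sum>i\<in>UNIV. \<Sum>k<z $ i. \<omega> (n, i, k))) \<partial>PiM UNIV law) =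
    ennreal (mpow (gen_step \<mu> ((T ^^ n) x) s) z)"
proof -
  interpret P: product_prob_space law UNIV
    by (simp add: product_prob_space_def product_prob_space_axioms_def product_sigma_finite_def
        law_prob prob_space_imp_sigma_finite)
  define I where "I = Sigma (UNIV :: 'd set) (\<lambda>i. {..<z $ i})"
  define J where "J = Pair n ` I"
  have fin: "finite I" "finite J" by (auto simp: I_def J_def)
  have inj: "inj_on (Pair n) I" by (auto simp: inj_on_def)
  have reindex: "(\<Prod>i\<in>UNIV. \<Prod>k<z $ i. g (n, i, k)) = (\<Prod>c\<in>J. g c)" for g :: "nat \<times> 'd \<times> nat \<Rightarrow> real"
    using prod.reindex[OF inj, of g] by (simp add: J_def I_def prod.Sigma split_def)
  have "mpow s (\<Sum>i\<in>UNIV. \<Sum>k<z $ i. \<omega> (n, i, k)) = (\<Prod>c\<in>J. mpow s (\<omega> c))" for \<omega> :: "nat \<times> 'd \<times> nat \<Rightarrow> nat ^ 'd"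
    unfolding mpow_sum by (rule reindex)
  then have "(\<integral>\<^sup>+\<omega>. ennreal (mpow s (\<Sum>i\<in>UNIV. \<Sum>k<z $ i. \<omega> (n, i, k))) \<partial>PiM UNIV law)
     = (\<integral>\<^sup>+\<omega>. (\<Prod>c\<in>J. ennreal (mpow s (\<omega> c))) \<partial>PiM UNIV law)"
    using mpow_bounds[OF s] by (simp add: prod_ennreal)
  also have "\<dots> = (\<Prod>c\<in>J. \<integral>\<^sup>+\<omega>. ennreal (mpow s (\<omega> c)) \<partial>PiM UNIV law)"
  proof (rule P.indep_vars_nn_integral[OF fin(2)])
    show "P.indep_vars (\<lambda>_. borel) (\<lambda>c \<omega>. ennreal (mpow s (\<omega> c))) J"
      by (rule P.indep_vars_compose2[OF P.indep_vars_subset[OF coord_indep]])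
        (auto simp: measurable_def sets_law)
  qed simp
  also have "\<dots> = (\<Prod>c\<in>J. \<integral>\<^sup>+v. ennreal (mpow s v) \<partial>law c)"
  proof (rule prod.cong[OF refl])
    fix c
    have "(\<integral>\<^sup>+v. ennreal (mpow s v) \<partial>distr (PiM UNIV law) (law c) (\<lambda>\<omega>. \<omega> c)) =
        (\<integral>\<^sup>+\<omega>. ennreal (mpow s (\<omega> c)) \<partial>PiM UNIV law)"
    proof (rule nn_integral_distr)
      show "(\<lambda>\<omega>. \<omega> c) \<in> measurable (PiM UNIV law) (law c)" by (rule measurable_component_singleton) simp
      show "(\<lambda>v. ennreal (mpow s v)) \<in> borel_measurable (distr (PiM UNIV law) (law c) (\<lambda>\<omega>. \<omega> c))"
        by (simp add: measurable_def sets_law)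
    qed
    then show "(\<integral>\<^sup>+\<omega>. ennreal (mpow s (\<omega> c)) \<partial>PiM UNIV law) = (\<integral>\<^sup>+v. ennreal (mpow s v) \<partial>law c)"
      by (simp add: P.PiM_component)
  qed
  also have "\<dots> = (\<Prod>(i, k)\<in>I. ennreal (gen_step \<mu> ((T ^^ n) x) s $ i))"
    unfolding J_def prod.reindex[OF inj]
  proof (rule prod.cong[OF refl], clarsimp)
    fix i k
    show "(\<integral>\<^sup>+v. ennreal (mpow s v) \<partial>law (n, i, k)) = ennreal (gen_step \<mu> ((T ^^ n) x) s $ i)"
      using nn_integral_eq_integral[OF integrable_mpow[OF s], of "\<mu> ((T ^^ n) x) i"] mpow_bounds[OF s]
      by (simp add: law_def gen_step_def gen_fun_expectation[OF s])
  qed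
  also have "\<dots> = (\<Prod>i\<in>UNIV. \<Prod>k<z $ i. ennreal (gen_step \<mu> ((T ^^ n) x) s $ i))"
    unfolding I_def by (subst prod.Sigma) auto
  also have "\<dots> = ennreal (mpow (gen_step \<mu> ((T ^^ n) x) s) z)"
    using gen_step_cube[OF s, of \<mu> "(T ^^ n) x"] by (simp add: unit_cube_def prod_ennreal ennreal_power)
  finally show ?thesis .
qed

text \<open>
  The population of generation \<open>n\<close> depends only on the coordinates in \<open>A\<close>, those of the earlier
  generations, and the reproduction in generation \<open>n\<close> only on those in \<open>B\<close>. By independence the
  expectation is a double integral, whose inner integral replaces \<open>s\<close> by its image under the
  generating map at the point \<open>T\<^sup>n x\<close> of the orbit.
\<close>

private lemma expectation_mpow_gw:
  assumes s: "s \<in> unit_cube"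
  shows "(\<integral>\<^sup>+\<omega>. ennreal (mpow s (gw_process z \<omega> n)) \<partial>PiM UNIV law) = ennreal (mpow (gen_iter \<mu> T n x s) z)"
  using s
proof (induction n arbitrary: s)
  case 0
  interpret prob_space "PiM UNIV law" by (rule prob_space_PiM[OF law_prob])
  show ?case by (simp add: emeasure_space_1)
next
  case (Suc n)
  interpret P: prob_space "PiM UNIV law" by (rule prob_space_PiM[OF law_prob])
  define A B :: "(nat \<times> 'd \<times> nat) set" where "A = {(m, i, k). m < n}" and "B = {(m, i, k). m = n}"
  define U V :: "(nat \<times> 'd \<times> nat \<Rightarrow> nat ^ 'd) \<Rightarrow> nat \<times> 'd \<times> nat \<Rightarrow> nat ^ 'd"
    where "U \<omega> = restrict \<omega> A" and "V \<omega> = restrict \<omega> B" for \<omega>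
  define f where "f = (\<lambda>(u, v :: nat \<times> 'd \<times> nat \<Rightarrow> nat ^ 'd).
     ennreal (mpow s (\<Sum>i\<in>UNIV. \<Sum>k<gw_process z u n $ i. v (n, i, k))))"
  have "P.indep_var (PiM A law) (\<lambda>\<omega>. restrict (\<lambda>c. \<omega> c) A) (PiM B law) (\<lambda>\<omega>. restrict (\<lambda>c. \<omega> c) B)"
    by (rule P.indep_var_restrict[OF coord_indep]) (auto simp: A_def B_def)
  then have ind: "P.indep_var (PiM A law) U (PiM B law) V" by (simp add: U_def[abs_def] V_def[abs_def])
  then have U: "U \<in> measurable (PiM UNIV law) (PiM A law)" and V: "V \<in> measurable (PiM UNIV law) (PiM B law)"
    and prod: "distr (PiM UNIV law) (PiM A law) U \<Otimes>\<^sub>M distr (PiM UNIV law) (PiM B law) V =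
      distr (PiM UNIV law) (PiM A law \<Otimes>\<^sub>M PiM B law) (\<lambda>\<omega>. (U \<omega>, V \<omega>))"
    unfolding P.indep_var_distribution_eq by auto
  interpret Vd: prob_space "distr (PiM UNIV law) (PiM B law) V" by (rule P.prob_space_distr[OF V])
  have sum_meas: "(\<lambda>v. \<Sum>i\<in>UNIV. \<Sum>k<z' $ i. v (n, i, k)) \<in> measurable (PiM B law) (count_space UNIV)" for z' :: "nat ^ 'd"
    by (intro measurable_sum_countable coord_measurable) (auto simp: B_def)
  have "(\<lambda>uv. \<Sum>i\<in>UNIV. \<Sum>k<gw_process z (fst uv) n $ i. snd uv (n, i, k))
      \<in> measurable (PiM A law \<Otimes>\<^sub>M PiM B law) (count_space UNIV)"
    by (rule measurable_compose_countable[where g="\<lambda>uv. gw_process z (fst uv) n"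
          and f="\<lambda>z' uv. \<Sum>i\<in>UNIV. \<Sum>k<z' $ i. snd uv (n, i, k)"])
      (auto intro!: measurable_compose[OF measurable_snd sum_meas]
        measurable_compose[OF measurable_fst gw_measurable] simp: A_def)
  then have f: "f \<in> borel_measurable (PiM A law \<Otimes>\<^sub>M PiM B law)"
    unfolding f_def split_def by (rule measurable_compose) simp
  have "(\<integral>\<^sup>+\<omega>. ennreal (mpow s (gw_process z \<omega> (Suc n))) \<partial>PiM UNIV law) = (\<integral>\<^sup>+\<omega>. f (U \<omega>, V \<omega>) \<partial>PiM UNIV law)"
  proof (intro nn_integral_cong)
    fix \<omega>
    have "gw_process z (U \<omega>) n = gw_process z \<omega> n" by (intro gw_process_cong) (simp add: U_def A_def)
    then show "ennreal (mpow s (gw_process z \<omega> (Suc n))) = f (U \<omega>, V \<omega>)"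
      unfolding gw_process_Suc_sum f_def by (simp add: V_def B_def)
  qed
  also have "\<dots> = (\<integral>\<^sup>+uv. f uv \<partial>distr (PiM UNIV law) (PiM A law \<Otimes>\<^sub>M PiM B law) (\<lambda>\<omega>. (U \<omega>, V \<omega>)))"
    using U V f by (subst nn_integral_distr) auto
  also have "\<dots> = (\<integral>\<^sup>+u. \<integral>\<^sup>+v. f (u, v) \<partial>distr (PiM UNIV law) (PiM B law) V \<partial>distr (PiM UNIV law) (PiM A law) U)"
    unfolding prod[symmetric] using f
    by (intro Vd.nn_integral_fst[symmetric]) (simp add: measurable_cong_sets[OF sets_pair_measure_cong[OF sets_distr sets_distr] refl])
  also have "\<dots> = (\<integral>\<^sup>+u. ennreal (mpow (gen_step \<mu> ((T ^^ n) x) s) (gw_process z u n)) \<partial>distr (PiM UNIV law) (PiM A law) U)"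
  proof (intro nn_integral_cong)
    fix u
    have "(\<integral>\<^sup>+v. f (u, v) \<partial>distr (PiM UNIV law) (PiM B law) V) = (\<integral>\<^sup>+\<omega>. f (u, V \<omega>) \<partial>PiM UNIV law)"
    proof -
      have "(\<lambda>v. f (u, v)) \<in> borel_measurable (PiM B law)"
        unfolding f_def prod.case by (rule measurable_compose[OF sum_meas]) simp
      then show ?thesis by (intro nn_integral_distr[OF V]) simp
    qed
    also have "\<dots> = (\<integral>\<^sup>+\<omega>. ennreal (mpow s (\<Sum>i\<in>UNIV. \<Sum>k<gw_process z u n $ i. \<omega> (n, i, k))) \<partial>PiM UNIV law)"
      by (simp add: f_def V_def B_def)
    also have "\<dots> = ennreal (mpow (gen_step \<mu> ((T ^^ n) x) s) (gw_process z u n))"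
      by (rule expectation_step[OF Suc.prems])
    finally show "(\<integral>\<^sup>+v. f (u, v) \<partial>distr (PiM UNIV law) (PiM B law) V) =
      ennreal (mpow (gen_step \<mu> ((T ^^ n) x) s) (gw_process z u n))" .
  qed
  also have "\<dots> = (\<integral>\<^sup>+\<omega>. ennreal (mpow (gen_step \<mu> ((T ^^ n) x) s) (gw_process z (U \<omega>) n)) \<partial>PiM UNIV law)"
  proof -
    have "(\<lambda>u. gw_process z u n) \<in> measurable (PiM A law) (count_space UNIV)"
      by (rule gw_measurable) (simp add: A_def)
    then have "(\<lambda>u. ennreal (mpow (gen_step \<mu> ((T ^^ n) x) s) (gw_process z u n))) \<in> borel_measurable (PiM A law)"
      by (rule measurable_compose) simp
    then show ?thesis by (intro nn_integral_distr[OF U]) simp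
  qed
  also have "\<dots> = (\<integral>\<^sup>+\<omega>. ennreal (mpow (gen_step \<mu> ((T ^^ n) x) s) (gw_process z \<omega> n)) \<partial>PiM UNIV law)"
  proof (intro nn_integral_cong)
    fix \<omega>
    have "gw_process z (U \<omega>) n = gw_process z \<omega> n" by (intro gw_process_cong) (simp add: U_def A_def)
    then show "ennreal (mpow (gen_step \<mu> ((T ^^ n) x) s) (gw_process z (U \<omega>) n)) =
      ennreal (mpow (gen_step \<mu> ((T ^^ n) x) s) (gw_process z \<omega> n))" by simp
  qed
  also have "\<dots> = ennreal (mpow (gen_iter \<mu> T (Suc n) x s) z)"
    using Suc.IH[OF gen_step_cube[OF Suc.prems]] by simp
  finally show ?case .
qed

text \<open>
  At \<open>s = 0\<close> the monomial is the indicator of the zero vector, because \<open>0 ^ 0 = 1\<close>. The state \<open>0\<close> is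
  absorbing, so the events of being extinct at time \<open>n\<close> increase with \<open>n\<close>.
\<close>

lemma extinction_prob_limit: "(\<lambda>n. gen_iter \<mu> T n x 0 $ i) \<longlonglongrightarrow> extinction_prob \<mu> T x $ i"
proof -
  interpret P: prob_space "PiM UNIV law" by (rule prob_space_PiM[OF law_prob])
  let ?E = "\<lambda>n. {\<omega>. gw_process (axis i 1) \<omega> n = 0}"
  have zero: "(0 :: real ^ 'd) \<in> unit_cube" by (simp add: unit_cube_def)
  have "gen_iter \<mu> T n x s \<in> unit_cube" if "s \<in> unit_cube" for n s
    using that by (induction n arbitrary: s) (auto intro: gen_step_cube)
  then have cube: "gen_iter \<mu> T n x 0 \<in> unit_cube" for n using zero by blast
  have E: "?E n \<in> sets (PiM UNIV law)" for n
    using measurable_sets[OF gw_measurable[of n UNIV "axis i 1"], of "{0}"]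
    by (simp add: space_offspring vimage_def)
  have m0: "mpow 0 k = (if k = 0 then 1 else 0)" for k :: "nat ^ 'd"
    by (auto simp: vec_eq_iff power_0_left)
  have ax: "mpow s (axis i 1) = s $ i" for s :: "real ^ 'd"
  proof -
    have "mpow s (axis i 1) = (\<Prod>j\<in>UNIV. if j = i then s $ i else 1)"
      by (intro prod.cong) (auto simp: axis_def)
    then show ?thesis by simp
  qed
  have "P.prob (?E n) = gen_iter \<mu> T n x 0 $ i" for n
  proof -
    have "emeasure (PiM UNIV law) (?E n) = (\<integral>\<^sup>+\<omega>. indicator (?E n) \<omega> \<partial>PiM UNIV law)"
      using E by simp
    also have "\<dots> = (\<integral>\<^sup>+\<omega>. ennreal (mpow 0 (gw_process (axis i 1) \<omega> n)) \<partial>PiM UNIV law)"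
      by (intro nn_integral_cong) (simp add: m0[simplified] indicator_def)
    also have "\<dots> = ennreal (gen_iter \<mu> T n x 0 $ i)"
      unfolding expectation_mpow_gw[OF zero] ax ..
    finally show ?thesis using cube[of n] by (simp add: P.emeasure_eq_measure unit_cube_def)
  qed
  moreover have "(\<lambda>n. P.prob (?E n)) \<longlonglongrightarrow> P.prob (\<Union>n. ?E n)"
    using E gw_process_absorb by (intro P.finite_Lim_measure_incseq incseq_SucI) blast+
  ultimately show ?thesis by (simp add: extinction_prob_def offspring_law)
qed

end

section \<open>Concavity of the survival map\<close>

lemma mpow_lipschitz:
  assumes s: "s \<in> unit_cube" and s': "s' \<in> unit_cube"
  shows "\<bar>mpow s k - mpow s' k\<bar> \<le> (\<Sum>i\<in>UNIV. real (k $ i) * \<bar>s $ i - s' $ i\<bar>)"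
proof -
  have "norm (mpow s k - mpow s' k) \<le> (\<Sum>i\<in>UNIV. norm ((s $ i) ^ (k $ i) - (s' $ i) ^ (k $ i)))"
    using s s' by (intro norm_prod_diff) (auto simp: unit_cube_def norm_power power_le_one)
  also have "\<dots> \<le> (\<Sum>i\<in>UNIV. real (k $ i) * norm (s $ i - s' $ i))"
    using s s' by (intro sum_mono norm_power_diff) (auto simp: unit_cube_def)
  finally show ?thesis by simp
qed

lemma mpow_mono:
  assumes "\<And>i. 0 \<le> s $ i" "\<And>i. s $ i \<le> s' $ i"
  shows "mpow s k \<le> mpow s' k"
  using assms by (intro prod_mono) (auto intro: power_mono)

lemma one_minus_cube: "s \<in> unit_cube \<Longrightarrow> 1 - s \<in> unit_cube"
  by (auto simp: unit_cube_def)

lemma mpow_one_minus_lower: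
  assumes s: "s \<in> unit_cube"
  shows "1 - (\<Sum>i\<in>UNIV. real (k $ i) * s $ i) \<le> mpow (1 - s) k"
proof -
  have one: "(1 :: real ^ 'a) \<in> unit_cube" by (simp add: unit_cube_def)
  have "\<bar>mpow 1 k - mpow (1 - s) k\<bar> \<le> (\<Sum>i\<in>UNIV. real (k $ i) * \<bar>(1 :: real ^ 'a) $ i - (1 - s) $ i\<bar>)"
    by (rule mpow_lipschitz[OF one one_minus_cube[OF s]])
  also have "\<dots> = (\<Sum>i\<in>UNIV. real (k $ i) * s $ i)"
    using s by (intro sum.cong) (auto simp: unit_cube_def)
  finally show ?thesis by (simp add: abs_le_iff)
qed

text \<open>
  With \<open>A\<close> the linear term, the monomial is at most \<open>exp (- A) \<le> 1 / (1 + A) \<le> 1 - A + A\<^sup>2\<close>.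
\<close>

lemma mpow_one_minus_upper:
  assumes s: "s \<in> unit_cube"
  shows "mpow (1 - s) k \<le> 1 - (\<Sum>i\<in>UNIV. real (k $ i) * s $ i) + (\<Sum>i\<in>UNIV. real (k $ i) * s $ i)\<^sup>2"
proof -
  define A where "A = (\<Sum>i\<in>UNIV. real (k $ i) * s $ i)"
  have A: "0 \<le> A" unfolding A_def using s by (intro sum_nonneg) (auto simp: unit_cube_def)
  have "mpow (1 - s) k \<le> (\<Prod>i\<in>UNIV. exp (- (real (k $ i) * s $ i)))"
  proof (rule prod_mono)
    fix i
    have "((1 - s) $ i) ^ (k $ i) \<le> (exp (- (s $ i))) ^ (k $ i)"
      using s exp_ge_add_one_self[of "- (s $ i)"] by (intro power_mono) (auto simp: unit_cube_def)
    then show "0 \<le> ((1 - s) $ i) ^ (k $ i) \<and> ((1 - s) $ i) ^ (k $ i) \<le> exp (- (real (k $ i) * s $ i))"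
      using s by (auto simp: unit_cube_def exp_of_nat_mult[symmetric])
  qed
  also have "\<dots> = exp (- A)" by (simp add: A_def exp_sum sum_negf[symmetric])
  also have "\<dots> \<le> 1 / (1 + A)"
    using exp_ge_add_one_self[of A] A by (simp add: exp_minus inverse_eq_divide frac_le)
  also have "\<dots> \<le> 1 - A + A\<^sup>2"
  proof -
    have "(1 - A + A\<^sup>2) * (1 + A) = 1 + A ^ 3" by (simp add: algebra_simps power2_eq_square power3_eq_cube)
    then show ?thesis using A by (simp add: divide_le_eq)
  qed
  finally show ?thesis unfolding A_def .
qed

text \<open>
  As a function of \<open>t\<close>, the product of the \<open>1 - t * a c\<close> is convex. The second part quantifies its
  distance to the chord: a new factor with value \<open>a c0\<close> contributes at least
  \<open>t * (1 - t) * a c0\<close> times the drop of the remaining product from \<open>t = 0\<close> to \<open>t = 1\<close>.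
\<close>

lemma prod_convex_gap:
  fixes a :: "'c \<Rightarrow> real"
  assumes "finite I" and a: "\<And>c. c \<in> I \<Longrightarrow> 0 \<le> a c \<and> a c \<le> 1" and t: "0 \<le> t" "t \<le> 1"
  shows "(\<Prod>c\<in>I. 1 - t * a c) \<le> (1 - t) + t * (\<Prod>c\<in>I. 1 - a c)"
    and "c0 \<notin> I \<Longrightarrow> 0 \<le> a c0 \<Longrightarrow> a c0 \<le> 1 \<Longrightarrow>
      (\<Prod>c\<in>insert c0 I. 1 - t * a c) + t * (1 - t) * a c0 * (1 - (\<Prod>c\<in>I. 1 - a c))
        \<le> (1 - t) + t * (\<Prod>c\<in>insert c0 I. 1 - a c)"
proof -
  have step: "(1 - t * a c) * G + t * (1 - t) * a c * (1 - g) \<le> (1 - t) + t * ((1 - a c) * g)"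
    if "0 \<le> a c" "a c \<le> 1" "G \<le> (1 - t) + t * g" for c G g
  proof -
    have "t * a c \<le> 1" using t that by (simp add: mult_le_one)
    then have "(1 - t * a c) * G \<le> (1 - t * a c) * ((1 - t) + t * g)"
      using that by (intro mult_left_mono) auto
    then show ?thesis by (simp add: algebra_simps)
  qed
  have gap: "(\<Prod>c\<in>J. 1 - t * a c) \<le> (1 - t) + t * (\<Prod>c\<in>J. 1 - a c)" if "finite J" "J \<subseteq> I" for J
    using that
  proof (induction J rule: finite_induct)
    case (insert c J)
    have g: "(\<Prod>c\<in>J. 1 - a c) \<le> 1" using insert a by (intro prod_le_1) auto
    have "0 \<le> t * (1 - t) * a c * (1 - (\<Prod>c\<in>J. 1 - a c))"
      using t a insert g by (intro mult_nonneg_nonneg) auto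
    moreover have "0 \<le> a c" "a c \<le> 1" using a insert by auto
    ultimately show ?case using step[of c "\<Prod>c\<in>J. 1 - t * a c" "\<Prod>c\<in>J. 1 - a c"] insert by simp
  qed simp
  show "(\<Prod>c\<in>I. 1 - t * a c) \<le> (1 - t) + t * (\<Prod>c\<in>I. 1 - a c)" by (rule gap[OF assms(1)]) simp
  then show "(\<Prod>c\<in>insert c0 I. 1 - t * a c) + t * (1 - t) * a c0 * (1 - (\<Prod>c\<in>I. 1 - a c))
        \<le> (1 - t) + t * (\<Prod>c\<in>insert c0 I. 1 - a c)"
    if "c0 \<notin> I" "0 \<le> a c0" "a c0 \<le> 1"
    using step[OF that(2,3)] that(1) assms(1) by simp
qed

text \<open>
  With at least two individuals, one factor can be split off while another one keeps the remaining
  product at \<open>t = 1\<close> below \<open>1 - e\<close>. Both of them contribute a factor \<open>e\<close>.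
\<close>

lemma mpow_convex_gap:
  fixes k :: "nat ^ 'd::finite"
  assumes w: "\<And>i. e \<le> w $ i" "\<And>i. w $ i \<le> 1" and e: "0 \<le> e" and t: "0 \<le> t" "t \<le> 1"
  shows "mpow (1 - t *\<^sub>R w) k + (if k \<noteq> 0 \<and> (\<forall>j. k \<noteq> axis j 1) then e\<^sup>2 * (t * (1 - t)) else 0)
    \<le> (1 - t) + t * mpow (1 - w) k"
proof -
  define I where "I = Sigma (UNIV :: 'd set) (\<lambda>i. {..<k $ i})"
  have fin: "finite I" by (simp add: I_def)
  have pr: "mpow (1 - u *\<^sub>R w) k = (\<Prod>c\<in>I. 1 - u * w $ fst c)" for u
    unfolding I_def by (subst prod.Sigma[symmetric, where g="\<lambda>i _. 1 - u * w $ i", unfolded split_def]) auto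
  have w01: "0 \<le> w $ i" "w $ i \<le> 1" for i using w[of i] e by auto
  have pr1: "mpow (1 - w) k = (\<Prod>c\<in>I. 1 - w $ fst c)" using pr[of 1] by simp
  show ?thesis
  proof (cases "k \<noteq> 0 \<and> (\<forall>j. k \<noteq> axis j 1)")
    case False
    then show ?thesis
      using prod_convex_gap(1)[OF fin, of "\<lambda>c. w $ fst c" t] w01 t unfolding pr pr1 by auto
  next
    case True
    have "card I = (\<Sum>i\<in>UNIV. k $ i)" by (simp add: I_def)
    moreover have "(\<Sum>i\<in>UNIV. k $ i) \<noteq> 0" using True by (auto simp: vec_eq_iff)
    moreover have "(\<Sum>i\<in>UNIV. k $ i) \<noteq> Suc 0"
    proof
      assume "(\<Sum>i\<in>UNIV. k $ i) = Suc 0"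
      then obtain j where "k $ j = Suc 0" "\<And>l. j \<noteq> l \<Longrightarrow> k $ l = 0"
        by (auto simp: sum_eq_Suc0_iff)
      then have "k = axis j 1" by (auto simp: vec_eq_iff axis_def)
      then show False using True by blast
    qed
    ultimately have "card I \<ge> 2" by linarith
    then obtain c c' where c: "c \<in> I" "c' \<in> I" "c \<noteq> c'"
      by (metis card_le_Suc0_iff_eq fin not_less_eq_eq numeral_2_eq_2)
    define I' where "I' = I - {c}"
    have I': "I = insert c I'" "c \<notin> I'" "finite I'" "c' \<in> I'" using c fin by (auto simp: I'_def)
    have "(\<Prod>c\<in>I'. 1 - w $ fst c) = (1 - w $ fst c') * (\<Prod>c\<in>I' - {c'}. 1 - w $ fst c)"
      using I' by (intro prod.remove) auto
    also have "\<dots> \<le> (1 - w $ fst c') * 1"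
      using w01 by (intro mult_left_mono prod_le_1) auto
    also have "\<dots> \<le> 1 - e" using w(1)[of "fst c'"] by simp
    finally have "e \<le> 1 - (\<Prod>c\<in>I'. 1 - w $ fst c)" by simp
    then have "e * e \<le> w $ fst c * (1 - (\<Prod>c\<in>I'. 1 - w $ fst c))"
      using w(1)[of "fst c"] e by (intro mult_mono) auto
    then have "t * (1 - t) * (e * e) \<le> t * (1 - t) * (w $ fst c * (1 - (\<Prod>c\<in>I'. 1 - w $ fst c)))"
      using t by (intro mult_left_mono) auto
    moreover have "(\<Prod>c\<in>insert c I'. 1 - t * w $ fst c) + t * (1 - t) * w $ fst c * (1 - (\<Prod>c\<in>I'. 1 - w $ fst c))
        \<le> (1 - t) + t * (\<Prod>c\<in>insert c I'. 1 - w $ fst c)"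
      by (rule prod_convex_gap(2)[OF I'(3) _ t I'(2)]) (simp_all add: w01)
    ultimately show ?thesis
      using True unfolding pr pr1 I'(1)[symmetric] by (simp add: power2_eq_square algebra_simps)
  qed
qed

text \<open>
  The generating map in survival coordinates: if children of type \<open>i\<close> survive independently with
  probability \<open>s $ i\<close>, then component \<open>j\<close> is the probability that some child of an individual of type \<open>j\<close> does.
\<close>

definition surv_step :: "('x \<Rightarrow> 'd::finite \<Rightarrow> (nat ^ 'd) pmf) \<Rightarrow> 'x \<Rightarrow> real ^ 'd \<Rightarrow> real ^ 'd" where
  "surv_step \<mu> x s = 1 - gen_step \<mu> x (1 - s)"

definition surv_iter ::
  "('x \<Rightarrow> 'd::finite \<Rightarrow> (nat ^ 'd) pmf) \<Rightarrow> ('x \<Rightarrow> 'x) \<Rightarrow> nat \<Rightarrow> 'x \<Rightarrow> real ^ 'd \<Rightarrow> real ^ 'd" where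
  "surv_iter \<mu> T n x s = 1 - gen_iter \<mu> T n x (1 - s)"

lemma surv_step_cube: "s \<in> unit_cube \<Longrightarrow> surv_step \<mu> x s \<in> unit_cube"
  unfolding surv_step_def by (intro one_minus_cube gen_step_cube)

lemma surv_iter_0: "surv_iter \<mu> T 0 x s = s"
  by (simp add: surv_iter_def)

lemma surv_iter_Suc: "surv_iter \<mu> T (Suc n) x s = surv_iter \<mu> T n x (surv_step \<mu> ((T ^^ n) x) s)"
  by (simp add: surv_iter_def surv_step_def)

lemma surv_iter_Suc_left: "surv_iter \<mu> T (Suc n) x s = surv_step \<mu> x (surv_iter \<mu> T n (T x) s)"
proof (induction n arbitrary: s)
  case (Suc n)
  then show ?case unfolding surv_iter_Suc[of _ _ "Suc n"] by (simp add: surv_iter_Suc funpow_swap1)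
qed (simp add: surv_iter_0 surv_iter_Suc)

lemma surv_iter_add: "surv_iter \<mu> T (m + n) x s = surv_iter \<mu> T m x (surv_iter \<mu> T n ((T ^^ m) x) s)"
proof (induction m arbitrary: x)
  case (Suc m)
  then show ?case by (simp add: surv_iter_Suc_left funpow_swap1)
qed (simp add: surv_iter_0)

lemma surv_iter_cube: "s \<in> unit_cube \<Longrightarrow> surv_iter \<mu> T n x s \<in> unit_cube"
  by (induction n arbitrary: s) (simp_all add: surv_iter_0 surv_iter_Suc surv_step_cube)

lemma surv_step_expectation:
  assumes s: "s \<in> unit_cube"
  shows "surv_step \<mu> x s $ j = 1 - measure_pmf.expectation (\<mu> x j) (mpow (1 - s))"
  using gen_fun_expectation[OF one_minus_cube[OF s]] by (simp add: surv_step_def gen_step_def)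

lemma surv_step_mono:
  assumes s: "s \<in> unit_cube" "s' \<in> unit_cube" and le: "\<And>i. s $ i \<le> s' $ i"
  shows "surv_step \<mu> x s $ j \<le> surv_step \<mu> x s' $ j"
proof -
  have "measure_pmf.expectation (\<mu> x j) (mpow (1 - s')) \<le> measure_pmf.expectation (\<mu> x j) (mpow (1 - s))"
    by (intro integral_mono integrable_mpow one_minus_cube s mpow_mono)
      (use s le in \<open>auto simp: unit_cube_def\<close>)
  then show ?thesis by (simp add: surv_step_expectation s)
qed

lemma surv_iter_mono:
  assumes "s \<in> unit_cube" "s' \<in> unit_cube" "\<And>i. s $ i \<le> s' $ i"
  shows "surv_iter \<mu> T n x s $ j \<le> surv_iter \<mu> T n x s' $ j"
  using assms
proof (induction n arbitrary: s s' j)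
  case (Suc n)
  show ?case unfolding surv_iter_Suc by (intro Suc.IH surv_step_cube surv_step_mono Suc.prems)
qed (simp add: surv_iter_0)

text \<open>
  The survival map is concave and vanishes at the origin; the extra term is the strictness of this
  concavity, which comes from the offspring vectors with at least two individuals.
\<close>

lemma surv_step_concave_gap:
  assumes w: "\<And>i. e \<le> w $ i" "\<And>i. w $ i \<le> 1" and e: "0 \<le> e" and t: "0 \<le> t" "t \<le> 1"
    and b: "b \<le> 1 - (pmf (\<mu> x j) 0 + (\<Sum>i\<in>UNIV. pmf (\<mu> x j) (axis i 1)))"
  shows "t * surv_step \<mu> x w $ j + b * e\<^sup>2 * (t * (1 - t)) \<le> surv_step \<mu> x (t *\<^sub>R w) $ j"
proof -
  define S where "S = {k :: nat ^ 'a. k \<noteq> 0 \<and> (\<forall>j. k \<noteq> axis j 1)}"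
  have w01: "0 \<le> w $ i" "w $ i \<le> 1" for i using w[of i] e by auto
  have cw: "w \<in> unit_cube" using w01 by (simp add: unit_cube_def)
  have ct: "t *\<^sub>R w \<in> unit_cube" using w01 t by (simp add: unit_cube_def mult_le_one)
  have inj: "inj (\<lambda>i. axis i (1 :: nat) :: nat ^ 'a)" by (auto simp: inj_on_def axis_eq_axis)
  have "UNIV - S = insert 0 (range (\<lambda>i. axis i 1))" by (auto simp: S_def)
  then have "measure_pmf.prob (\<mu> x j) (UNIV - S) = (\<Sum>k\<in>insert 0 (range (\<lambda>i. axis i 1)). pmf (\<mu> x j) k)"
    by (simp add: measure_measure_pmf_finite)
  also have "\<dots> = pmf (\<mu> x j) 0 + (\<Sum>i\<in>UNIV. pmf (\<mu> x j) (axis i 1))"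
    using sum.reindex[OF inj, of "pmf (\<mu> x j)"] by (subst sum.insert) (auto simp: axis_eq_0_iff o_def)
  finally have "b \<le> measure_pmf.prob (\<mu> x j) S"
    using b measure_pmf.prob_compl[of S "\<mu> x j"] by simp
  then have "b * e\<^sup>2 * (t * (1 - t)) \<le> measure_pmf.prob (\<mu> x j) S * (e\<^sup>2 * (t * (1 - t)))"
    using t by (simp only: mult.assoc) (intro mult_right_mono, auto)
  also have "\<dots> = measure_pmf.expectation (\<mu> x j) (\<lambda>k. indicator S k * (e\<^sup>2 * (t * (1 - t))))"
    by simp
  also have "\<dots> \<le> measure_pmf.expectation (\<mu> x j) (\<lambda>k. (1 - t) + t * mpow (1 - w) k - mpow (1 - t *\<^sub>R w) k)"
  proof (rule integral_mono)
    show "integrable (\<mu> x j) (\<lambda>k. indicator S k * (e\<^sup>2 * (t * (1 - t))))"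
      by (rule integrable_pmf_bounded[where B="\<bar>e\<^sup>2 * (t * (1 - t))\<bar>"]) (auto simp: indicator_def)
    show "integrable (\<mu> x j) (\<lambda>k. (1 - t) + t * mpow (1 - w) k - mpow (1 - t *\<^sub>R w) k)"
      using integrable_mpow[OF one_minus_cube[OF cw]] integrable_mpow[OF one_minus_cube[OF ct]] by auto
    fix k
    show "indicator S k * (e\<^sup>2 * (t * (1 - t))) \<le> (1 - t) + t * mpow (1 - w) k - mpow (1 - t *\<^sub>R w) k"
    proof -
      have "(k \<noteq> 0 \<and> (\<forall>j. k \<noteq> axis j 1)) = (k \<in> S)" by (simp add: S_def)
      note gap = mpow_convex_gap[OF w e t, of k, unfolded this]
      show ?thesis
      proof (cases "k \<in> S")
        case True
        with gap show ?thesis by simp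
      next
        case False
        with gap show ?thesis by simp
      qed
    qed
  qed
  also have "\<dots> = (1 - t) + t * measure_pmf.expectation (\<mu> x j) (mpow (1 - w))
      - measure_pmf.expectation (\<mu> x j) (mpow (1 - t *\<^sub>R w))"
    using integrable_mpow[OF one_minus_cube[OF cw]] integrable_mpow[OF one_minus_cube[OF ct]] by simp
  finally show ?thesis
    unfolding surv_step_expectation[OF cw] surv_step_expectation[OF ct] by (simp add: algebra_simps)
qed

section \<open>Products of mean matrices\<close>

lemma continuous_on_Max_image:
  fixes f :: "'i \<Rightarrow> 'x::topological_space \<Rightarrow> real"
  assumes "finite I" "I \<noteq> {}" "\<And>i. i \<in> I \<Longrightarrow> continuous_on S (f i)"
  shows "continuous_on S (\<lambda>x. Max ((\<lambda>i. f i x) ` I))"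
  using assms
proof (induction I rule: finite_ne_induct)
  case (insert i I)
  then have "continuous_on S (\<lambda>x. max (f i x) (Max ((\<lambda>i. f i x) ` I)))"
    by (intro continuous_intros) auto
  then show ?case using insert by simp
qed simp

definition row_sum :: "real ^ 'd ^ 'd::finite \<Rightarrow> 'd \<Rightarrow> real" where
  "row_sum A i = (\<Sum>j\<in>UNIV. A $ i $ j)"

lemma row_sum_norm_nonneg_matrix:
  assumes "\<And>i j. 0 \<le> A $ i $ j"
  shows "row_sum_norm A = Max (range (row_sum A))"
  using assms by (simp add: row_sum_norm_def row_sum_def[abs_def])

lemma row_sum_mult: "row_sum (A ** B) i = (\<Sum>k\<in>UNIV. A $ i $ k * row_sum B k)"
proof -
  have "row_sum (A ** B) i = (\<Sum>j\<in>UNIV. \<Sum>k\<in>UNIV. A $ i $ k * B $ k $ j)"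
    by (simp add: row_sum_def matrix_matrix_mult_def)
  also have "\<dots> = (\<Sum>k\<in>UNIV. \<Sum>j\<in>UNIV. A $ i $ k * B $ k $ j)" by (rule sum.swap)
  finally show ?thesis by (simp add: row_sum_def sum_distrib_left)
qed

locale gw_environment =
  fixes T :: "'x::metric_space \<Rightarrow> 'x" and \<mu> :: "'x \<Rightarrow> 'd::finite \<Rightarrow> (nat ^ 'd) pmf" and C D :: real
  assumes X: "compact (UNIV :: 'x set)"
    and T: "continuous_on UNIV T"
    and cont_mu: "continuous_map euclidean (product_topology (\<lambda>_. weak_pmf_topology) UNIV) \<mu>"
    and nondeg: "\<And>x i. pmf (\<mu> x i) 0 + (\<Sum>j\<in>UNIV. pmf (\<mu> x i) (axis j 1)) < 1"
    and C: "0 < C" "C \<le> D"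
    and diff1: "\<And>x i j. partial_differentiable i (gen_fun (\<mu> x j)) 1"
    and mean: "\<And>x i j. C \<le> mean_matrix \<mu> x $ i $ j" "\<And>x i j. mean_matrix \<mu> x $ i $ j \<le> D"
    and diff2: "\<And>x i j k. partial_differentiable i (partial_deriv j (gen_fun (\<mu> x k))) 1"
      "\<And>x i j k. partial_deriv i (partial_deriv j (gen_fun (\<mu> x k))) 1 \<le> D"
begin

lemma D_pos: "0 < D" using C by simp

lemma mean_eq: "measure_pmf.expectation (\<mu> x j) (\<lambda>k. real (k $ i)) = mean_matrix \<mu> x $ i $ j"
  using mean_offspring(2)[OF diff1] by (simp add: mean_matrix_def)

lemma mean_int: "integrable (measure_pmf (\<mu> x j)) (\<lambda>k. real (k $ i))"
  by (rule mean_offspring(1)[OF diff1])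

lemma second_moment:
  "integrable (measure_pmf (\<mu> x j)) (\<lambda>k. real (k $ i) * real (k $ l))"
  "measure_pmf.expectation (\<mu> x j) (\<lambda>k. real (k $ i) * real (k $ l)) \<le> 2 * D"
proof -
  have "partial_deriv i (gen_fun (\<mu> x j)) 1 \<le> D" for i
    using mean(2)[of x i j] by (simp add: mean_matrix_def)
  from second_moment_bound[OF diff1 this diff2] D_pos
  show "integrable (measure_pmf (\<mu> x j)) (\<lambda>k. real (k $ i) * real (k $ l))"
    "measure_pmf.expectation (\<mu> x j) (\<lambda>k. real (k $ i) * real (k $ l)) \<le> 2 * D" by simp_all
qed

text \<open>
  Continuity of the environment in the weak topology enters the proof only in this form.
\<close>

lemma continuous_expectation:
  fixes f :: "nat ^ 'd \<Rightarrow> real"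
  assumes f: "\<And>k. \<bar>f k\<bar> \<le> B"
  shows "continuous_on UNIV (\<lambda>x. measure_pmf.expectation (\<mu> x j) f)"
proof -
  have cj: "continuous_map euclidean weak_pmf_topology (\<lambda>x. \<mu> x j)"
    using cont_mu unfolding continuous_map_componentwise_UNIV by blast
  have bf: "bounded (range f)" using f by (auto simp: bounded_iff)
  have "open {x. measure_pmf.expectation (\<mu> x j) f \<in> U}" if "open U" for U
  proof -
    have "openin weak_pmf_topology {p. measure_pmf.expectation p f \<in> U}"
      unfolding weak_pmf_topology_def openin_topology_generated_by_iff
      by (rule generate_topology_on.Basis) (use bf that in blast)
    from openin_continuous_map_preimage[OF cj this] show ?thesis by simp
  qed
  then show ?thesis
    using continuous_on_open_vimage[of UNIV "\<lambda>x. measure_pmf.expectation (\<mu> x j) f"]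
    by (simp add: vimage_def)
qed

text \<open>
  The bounded second moments control the tails uniformly in \<open>x\<close>, so the mean is a uniform limit of
  truncated means, and those depend continuously on \<open>x\<close>.
\<close>

lemma continuous_mean: "continuous_on UNIV (\<lambda>x. mean_matrix \<mu> x $ i $ j)"
proof -
  let ?f = "\<lambda>L x. measure_pmf.expectation (\<mu> x j) (\<lambda>k. min (real (k $ i)) (real L))"
  have "uniform_limit UNIV ?f (\<lambda>x. mean_matrix \<mu> x $ i $ j) sequentially"
  proof (rule uniform_limitI)
    fix e :: real assume e: "e > 0"
    obtain M where M: "2 * D / e < real M" using reals_Archimedean2 by blast
    have "dist (?f L x) (mean_matrix \<mu> x $ i $ j) < e" if L: "L \<ge> Suc M" for L x
    proof -
      have L0: "real L > 0" "2 * D / e < real L" using L M by auto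
      have int: "integrable (\<mu> x j) (\<lambda>k. min (real (k $ i)) (real L))"
        by (rule integrable_pmf_bounded[where B="real L"]) auto
      have "\<bar>mean_matrix \<mu> x $ i $ j - ?f L x\<bar> =
          \<bar>measure_pmf.expectation (\<mu> x j) (\<lambda>k. real (k $ i) - min (real (k $ i)) (real L))\<bar>"
        using int mean_int by (simp add: mean_eq[symmetric])
      also have "\<dots> \<le> measure_pmf.expectation (\<mu> x j) (\<lambda>k. \<bar>real (k $ i) - min (real (k $ i)) (real L)\<bar>)"
        by (rule integral_abs_bound)
      also have "\<dots> \<le> measure_pmf.expectation (\<mu> x j) (\<lambda>k. real (k $ i) * real (k $ i) / real L)"
      proof (rule integral_mono)
        show "integrable (\<mu> x j) (\<lambda>k. \<bar>real (k $ i) - min (real (k $ i)) (real L)\<bar>)"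
          using int mean_int by (intro integrable_abs Bochner_Integration.integrable_diff)
        show "integrable (\<mu> x j) (\<lambda>k. real (k $ i) * real (k $ i) / real L)" using second_moment(1) by simp
        fix k :: "nat ^ 'd"
        show "\<bar>real (k $ i) - min (real (k $ i)) (real L)\<bar> \<le> real (k $ i) * real (k $ i) / real L"
        proof (cases "k $ i \<le> L")
          case False
          then have "real L * real (k $ i) \<le> real (k $ i) * real (k $ i)" by (intro mult_right_mono) auto
          then have "real (k $ i) \<le> real (k $ i) * real (k $ i) / real L" using L0 by (simp add: field_simps)
          moreover have "\<bar>real (k $ i) - min (real (k $ i)) (real L)\<bar> \<le> real (k $ i)" using False by simp
          ultimately show ?thesis by linarith
        qed simp
      qed
      also have "\<dots> \<le> 2 * D / real L" using second_moment(2) L0 by (simp add: divide_right_mono)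
      also have "\<dots> < e" using L0 e by (simp add: field_simps)
      finally show ?thesis by (simp add: dist_real_def abs_minus_commute)
    qed
    then show "\<forall>\<^sub>F L in sequentially. \<forall>x\<in>UNIV. dist (?f L x) (mean_matrix \<mu> x $ i $ j) < e"
      unfolding eventually_sequentially by blast
  qed
  moreover have "continuous_on UNIV (?f L)" for L
    by (rule continuous_expectation[where B="real L"]) auto
  ultimately show ?thesis by (intro uniform_limit_theorem[of _ ?f]) auto
qed

lemma mean_nonneg: "0 \<le> mean_matrix \<mu> x $ i $ j" using mean(1)[of x i j] C by simp

lemma cocycle_nonneg: "0 \<le> mean_cocycle \<mu> T n x $ i $ j"
proof (induction n arbitrary: i j)
  case (Suc n)
  have "0 \<le> (\<Sum>k\<in>UNIV. mean_matrix \<mu> ((T ^^ n) x) $ i $ k * mean_cocycle \<mu> T n x $ k $ j)"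
    by (intro sum_nonneg mult_nonneg_nonneg mean_nonneg Suc)
  then show ?case by (simp add: matrix_matrix_mult_def)
qed (simp add: mat_def)

lemma cocycle_add: "mean_cocycle \<mu> T (m + n) x = mean_cocycle \<mu> T m ((T ^^ n) x) ** mean_cocycle \<mu> T n x"
  by (induction m) (simp_all add: funpow_add matrix_mul_assoc)

lemma continuous_cocycle: "continuous_on UNIV (\<lambda>x. mean_cocycle \<mu> T n x $ i $ j)"
proof (induction n arbitrary: i j)
  case (Suc n)
  have "continuous_on UNIV (\<lambda>x. mean_matrix \<mu> ((T ^^ n) x) $ i $ k)" for i k
    using continuous_mean continuous_on_funpow[OF T] by (rule continuous_on_compose2) auto
  then have "continuous_on UNIV (\<lambda>x. \<Sum>k\<in>UNIV. mean_matrix \<mu> ((T ^^ n) x) $ i $ k * mean_cocycle \<mu> T n x $ k $ j)"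
    by (intro continuous_on_sum continuous_on_mult Suc)
  then show ?case by (simp add: matrix_matrix_mult_def)
qed simp

lemma row_sum_nonneg: "0 \<le> row_sum (mean_cocycle \<mu> T n x) i"
  unfolding row_sum_def by (intro sum_nonneg cocycle_nonneg)

lemma row_sum_le_norm: "row_sum (mean_cocycle \<mu> T n x) i \<le> row_sum_norm (mean_cocycle \<mu> T n x)"
  by (simp add: row_sum_norm_nonneg_matrix[OF cocycle_nonneg])

lemma norm_attained: obtains i where "row_sum_norm (mean_cocycle \<mu> T n x) = row_sum (mean_cocycle \<mu> T n x) i"
proof -
  have "Max (range (row_sum (mean_cocycle \<mu> T n x))) \<in> range (row_sum (mean_cocycle \<mu> T n x))"
    by (intro Max_in) auto
  then obtain i where "Max (range (row_sum (mean_cocycle \<mu> T n x))) = row_sum (mean_cocycle \<mu> T n x) i"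
    by (rule rangeE)
  then show ?thesis by (intro that[of i]) (simp add: row_sum_norm_nonneg_matrix[OF cocycle_nonneg])
qed

text \<open>
  The entries of the leftmost factor lie between \<open>C\<close> and \<open>D\<close>, so all rows of the product weigh the
  row sums of the other factors in a comparable way. For \<open>n = 0\<close> the row sums of the identity matrix
  are equal.
\<close>

lemma row_sums_comparable: "C / D * row_sum_norm (mean_cocycle \<mu> T n x) \<le> row_sum (mean_cocycle \<mu> T n x) i"
proof (cases n)
  case 0
  have r: "row_sum (mat 1 :: real ^ 'd ^ 'd) i = 1" for i by (simp add: row_sum_def mat_def)
  obtain l where "row_sum_norm (mean_cocycle \<mu> T 0 x) = row_sum (mean_cocycle \<mu> T 0 x) l"
    by (rule norm_attained)
  then show ?thesis using 0 r C by simp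
next
  case (Suc m)
  let ?B = "mean_cocycle \<mu> T m x"
  let ?S = "\<Sum>k\<in>UNIV. row_sum ?B k"
  have eq: "row_sum (mean_cocycle \<mu> T n x) i = (\<Sum>k\<in>UNIV. mean_matrix \<mu> ((T ^^ m) x) $ i $ k * row_sum ?B k)" for i
    using Suc by (simp add: row_sum_mult)
  obtain l where "row_sum_norm (mean_cocycle \<mu> T n x) = row_sum (mean_cocycle \<mu> T n x) l"
    by (rule norm_attained)
  also have "\<dots> \<le> D * ?S"
    unfolding eq sum_distrib_left by (intro sum_mono mult_right_mono mean row_sum_nonneg)
  finally have "C / D * row_sum_norm (mean_cocycle \<mu> T n x) \<le> C / D * (D * ?S)"
    using C by (intro mult_left_mono) auto
  also have "\<dots> = C * ?S" using D_pos by simp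
  also have "\<dots> \<le> row_sum (mean_cocycle \<mu> T n x) i"
    unfolding eq sum_distrib_left by (intro sum_mono mult_right_mono mean row_sum_nonneg)
  finally show ?thesis .
qed

lemma norm_submult:
  "row_sum_norm (mean_cocycle \<mu> T (m + n) x) \<le>
    row_sum_norm (mean_cocycle \<mu> T m ((T ^^ n) x)) * row_sum_norm (mean_cocycle \<mu> T n x)"
  "C / D * (row_sum_norm (mean_cocycle \<mu> T m ((T ^^ n) x)) * row_sum_norm (mean_cocycle \<mu> T n x)) \<le>
    row_sum_norm (mean_cocycle \<mu> T (m + n) x)"
proof -
  let ?A = "mean_cocycle \<mu> T m ((T ^^ n) x)" and ?B = "mean_cocycle \<mu> T n x"
  have eq: "row_sum (mean_cocycle \<mu> T (m + n) x) i = (\<Sum>k\<in>UNIV. ?A $ i $ k * row_sum ?B k)" for i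
    by (simp add: cocycle_add row_sum_mult)
  have B0: "0 \<le> row_sum_norm ?B" using row_sum_nonneg row_sum_le_norm by (rule order_trans)
  obtain l where "row_sum_norm (mean_cocycle \<mu> T (m + n) x) = row_sum (mean_cocycle \<mu> T (m + n) x) l"
    by (rule norm_attained)
  also have "\<dots> \<le> (\<Sum>k\<in>UNIV. ?A $ l $ k * row_sum_norm ?B)"
    unfolding eq by (intro sum_mono mult_left_mono row_sum_le_norm cocycle_nonneg)
  also have "\<dots> = row_sum ?A l * row_sum_norm ?B" by (simp add: row_sum_def sum_distrib_right)
  also have "\<dots> \<le> row_sum_norm ?A * row_sum_norm ?B"
    by (intro mult_right_mono row_sum_le_norm B0)
  finally show "row_sum_norm (mean_cocycle \<mu> T (m + n) x) \<le> row_sum_norm ?A * row_sum_norm ?B" .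
  obtain l' where l': "row_sum_norm ?A = row_sum ?A l'" by (rule norm_attained)
  have "C / D * (row_sum ?A l' * row_sum_norm ?B) = (\<Sum>k\<in>UNIV. ?A $ l' $ k * (C / D * row_sum_norm ?B))"
    by (simp add: row_sum_def sum_distrib_right sum_distrib_left mult_ac)
  also have "\<dots> \<le> (\<Sum>k\<in>UNIV. ?A $ l' $ k * row_sum ?B k)"
    by (intro sum_mono mult_left_mono row_sums_comparable cocycle_nonneg)
  also have "\<dots> \<le> row_sum_norm (mean_cocycle \<mu> T (m + n) x)"
    unfolding eq[symmetric] by (rule row_sum_le_norm)
  finally show "C / D * (row_sum_norm ?A * row_sum_norm ?B) \<le> row_sum_norm (mean_cocycle \<mu> T (m + n) x)"
    unfolding l' .
qed

lemma norm_cocycle_0: "row_sum_norm (mean_cocycle \<mu> T 0 x) = 1"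
proof -
  obtain l where "row_sum_norm (mean_cocycle \<mu> T 0 x) = row_sum (mean_cocycle \<mu> T 0 x) l"
    by (rule norm_attained)
  then show ?thesis by (simp add: row_sum_def mat_def)
qed

lemma norm_cocycle_pos: "0 < row_sum_norm (mean_cocycle \<mu> T n x)"
proof (induction n)
  case (Suc n)
  have "C \<le> row_sum_norm (mean_cocycle \<mu> T 1 ((T ^^ n) x))"
  proof -
    fix i :: 'd
    have "C \<le> mean_matrix \<mu> ((T ^^ n) x) $ i $ i" by (rule mean)
    also have "\<dots> \<le> row_sum (mean_cocycle \<mu> T 1 ((T ^^ n) x)) i"
      unfolding row_sum_def by (simp, intro member_le_sum mean_nonneg) auto
    also have "\<dots> \<le> row_sum_norm (mean_cocycle \<mu> T 1 ((T ^^ n) x))" by (rule row_sum_le_norm)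
    finally show ?thesis .
  qed
  then have "0 < C / D * (row_sum_norm (mean_cocycle \<mu> T 1 ((T ^^ n) x)) * row_sum_norm (mean_cocycle \<mu> T n x))"
    using Suc C by (intro mult_pos_pos divide_pos_pos) auto
  then show ?case using norm_submult(2)[of 1 n x] by simp
qed (simp add: norm_cocycle_0 del: mean_cocycle.simps)

text \<open>
  By the two bounds of the norm of a product, the logarithm of the norm is additive along orbits up
  to \<open>ln (D / C)\<close>. A large norm makes every column sum large, because the entries of the rightmost
  factor \<open>M(x)\<close> lie between \<open>C\<close> and \<open>D\<close>.
\<close>

lemma column_sums_growth:
  assumes pos: "\<And>\<nu>. ergodic_prob T \<nu> \<Longrightarrow> lyapunov_exponent \<mu> T \<nu> > 0"
  obtains N where "N \<ge> 1" "\<And>x j. 2 \<le> (\<Sum>i\<in>UNIV. mean_cocycle \<mu> T N x $ i $ j)"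
proof -
  let ?n = "\<lambda>n x. row_sum_norm (mean_cocycle \<mu> T n x)"
  define h where "h n x = ln (?n n x)" for n x
  \<comment> \<open>
    With \<open>S\<close> the sum of all entries of the product without its rightmost factor, the norm is at most
    \<open>CARD('d) * D * S\<close> and each column sum at least \<open>C * S\<close>; hence this threshold.\<close>
  define K where "K = 2 * real CARD('d) * D / C"
  have K: "K > 0" using C by (simp add: K_def)
  have ch: "continuous_on UNIV (h n)" for n
  proof -
    have "continuous_on UNIV (\<lambda>x. Max (range (\<lambda>i. \<Sum>j\<in>UNIV. \<bar>mean_cocycle \<mu> T n x $ i $ j\<bar>)))"
      by (intro continuous_on_Max_image continuous_intros continuous_cocycle) auto
    then have "continuous_on UNIV (\<lambda>x. ?n n x)" by (simp add: row_sum_norm_def)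
    then show ?thesis
      unfolding h_def using norm_cocycle_pos by (intro continuous_on_ln) (auto simp: less_imp_neq[symmetric])
  qed
  have hadd: "\<bar>h (m + n) x - h n x - h m ((T ^^ n) x)\<bar> \<le> ln (D / C)" for m n x
  proof -
    let ?A = "?n m ((T ^^ n) x)" and ?B = "?n n x"
    have p: "0 < ?A" "0 < ?B" "0 < ?n (m + n) x" by (rule norm_cocycle_pos)+
    have "h (m + n) x \<le> ln (?A * ?B)"
      unfolding h_def using norm_submult(1)[of m n x] p by (subst ln_le_cancel_iff) auto
    moreover have "ln (C / D * (?A * ?B)) \<le> h (m + n) x"
      unfolding h_def using norm_submult(2)[of m n x] p C by (subst ln_le_cancel_iff) auto
    moreover have "ln (C / D * (?A * ?B)) = - ln (D / C) + (h m ((T ^^ n) x) + h n x)"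
      using p C by (simp add: ln_mult ln_div h_def)
    moreover have "ln (?A * ?B) = h m ((T ^^ n) x) + h n x" using p by (simp add: ln_mult h_def)
    moreover have "0 \<le> ln (D / C)" using C by simp
    ultimately show ?thesis by linarith
  qed
  obtain N where N: "N \<ge> 1" "\<And>x. ln K \<le> h N x"
  proof (rule almost_additive_growth[OF X T ch _ hadd, of "ln K"])
    show "h 0 x = 0" for x by (simp add: h_def norm_cocycle_0 del: mean_cocycle.simps)
    show "0 < lim (\<lambda>n. 1 / real n * (\<integral>x. h n x \<partial>\<nu>))" if "ergodic_prob T \<nu>" for \<nu>
      using pos[OF that] by (simp add: lyapunov_exponent_def h_def)
  qed blast
  have "2 \<le> (\<Sum>i\<in>UNIV. mean_cocycle \<mu> T N x $ i $ j)" for x j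
  proof -
    obtain m where m: "N = m + 1" using N(1) by (metis add.commute le_Suc_ex)
    let ?A = "mean_cocycle \<mu> T m (T x)"
    define S where "S = (\<Sum>i\<in>UNIV. \<Sum>k\<in>UNIV. ?A $ i $ k)"
    have "mean_cocycle \<mu> T N x = ?A ** mean_matrix \<mu> x"
      using cocycle_add[of m 1 x] m by simp
    then have ent: "mean_cocycle \<mu> T N x $ i $ j = (\<Sum>k\<in>UNIV. ?A $ i $ k * mean_matrix \<mu> x $ k $ j)" for i j
      by (simp add: matrix_matrix_mult_def)
    have lo: "C * S \<le> (\<Sum>i\<in>UNIV. mean_cocycle \<mu> T N x $ i $ j)"
      unfolding ent S_def sum_distrib_left mult.commute[of C]
      by (intro sum_mono mult_left_mono mean cocycle_nonneg)
    have "K \<le> ?n N x"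
    proof -
      have "ln K \<le> ln (?n N x)" using N(2)[of x] by (simp add: h_def)
      then show ?thesis using K norm_cocycle_pos[of N x] by simp
    qed
    also obtain l where "?n N x = row_sum (mean_cocycle \<mu> T N x) l" by (rule norm_attained)
    also have "row_sum (mean_cocycle \<mu> T N x) l \<le> (\<Sum>i\<in>UNIV. row_sum (mean_cocycle \<mu> T N x) i)"
      by (intro member_le_sum row_sum_nonneg) auto
    also have "\<dots> = (\<Sum>i\<in>UNIV. \<Sum>k\<in>UNIV. ?A $ i $ k * row_sum (mean_matrix \<mu> x) k)"
      unfolding row_sum_mult[symmetric] \<open>mean_cocycle \<mu> T N x = ?A ** mean_matrix \<mu> x\<close> ..
    also have "\<dots> \<le> (\<Sum>i\<in>UNIV. \<Sum>k\<in>UNIV. ?A $ i $ k * (real CARD('d) * D))"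
    proof (intro sum_mono mult_left_mono cocycle_nonneg)
      show "row_sum (mean_matrix \<mu> x) k \<le> real CARD('d) * D" for k
        unfolding row_sum_def using sum_bounded_above[of UNIV "\<lambda>j. mean_matrix \<mu> x $ k $ j" D] mean(2) by simp
    qed
    also have "\<dots> = real CARD('d) * D * S" by (simp add: S_def sum_distrib_left mult_ac)
    finally have "2 * real CARD('d) * D / C \<le> real CARD('d) * D * S" by (simp add: K_def)
    then have "2 \<le> C * S" using C by (simp add: field_simps)
    then show ?thesis using lo by simp
  qed
  with N(1) that show ?thesis by blast
qed

section \<open>The survival map: continuity and linear behaviour near the origin\<close>

lemma surv_step_lipschitz:
  assumes s: "s \<in> unit_cube" "s' \<in> unit_cube"
  shows "\<bar>surv_step \<mu> x s $ j - surv_step \<mu> x s' $ j\<bar> \<le> (\<Sum>i\<in>UNIV. D * \<bar>s $ i - s' $ i\<bar>)"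
proof -
  note c = one_minus_cube[OF s(1)] one_minus_cube[OF s(2)]
  have "\<bar>surv_step \<mu> x s $ j - surv_step \<mu> x s' $ j\<bar> =
      \<bar>measure_pmf.expectation (\<mu> x j) (\<lambda>k. mpow (1 - s') k - mpow (1 - s) k)\<bar>"
    using integrable_mpow[OF c(1)] integrable_mpow[OF c(2)] by (simp add: surv_step_expectation s)
  also have "\<dots> \<le> measure_pmf.expectation (\<mu> x j) (\<lambda>k. \<bar>mpow (1 - s') k - mpow (1 - s) k\<bar>)"
    by (rule integral_abs_bound)
  also have "\<dots> \<le> measure_pmf.expectation (\<mu> x j) (\<lambda>k. \<Sum>i\<in>UNIV. real (k $ i) * \<bar>s $ i - s' $ i\<bar>)"
  proof (rule integral_mono)
    show "integrable (\<mu> x j) (\<lambda>k. \<bar>mpow (1 - s') k - mpow (1 - s) k\<bar>)"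
      by (intro integrable_abs Bochner_Integration.integrable_diff integrable_mpow c)
    show "integrable (\<mu> x j) (\<lambda>k. \<Sum>i\<in>UNIV. real (k $ i) * \<bar>s $ i - s' $ i\<bar>)"
      using mean_int by simp
    show "\<bar>mpow (1 - s') k - mpow (1 - s) k\<bar> \<le> (\<Sum>i\<in>UNIV. real (k $ i) * \<bar>s $ i - s' $ i\<bar>)" for k
      using mpow_lipschitz[OF c(2,1), of k] by simp
  qed
  also have "\<dots> = (\<Sum>i\<in>UNIV. mean_matrix \<mu> x $ i $ j * \<bar>s $ i - s' $ i\<bar>)"
    using mean_int by (simp add: mean_eq)
  also have "\<dots> \<le> (\<Sum>i\<in>UNIV. D * \<bar>s $ i - s' $ i\<bar>)"
    by (intro sum_mono mult_right_mono mean) auto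
  finally show ?thesis .
qed

text \<open>
  Weak continuity at the frozen argument \<open>s x0\<close>, combined with a Lipschitz bound in the argument
  that is uniform in the environment.
\<close>

lemma continuous_surv_step:
  assumes s: "\<And>x. s x \<in> unit_cube" and cs: "\<And>i. continuous_on UNIV (\<lambda>x. s x $ i)"
  shows "continuous_on UNIV (\<lambda>x. surv_step \<mu> x (s x) $ j)"
  unfolding continuous_on_def
proof
  fix x0 :: 'x
  let ?F = "at x0 within UNIV"
  have "continuous_on UNIV (\<lambda>x. measure_pmf.expectation (\<mu> x j) (mpow (1 - s x0)))"
    by (rule continuous_expectation[where B=1])
      (use mpow_bounds[OF one_minus_cube[OF s]] in \<open>metis abs_of_nonneg\<close>)
  then have "continuous_on UNIV (\<lambda>x. surv_step \<mu> x (s x0) $ j)"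
    unfolding surv_step_expectation[OF s] by (intro continuous_intros)
  then have 1: "((\<lambda>x. surv_step \<mu> x (s x0) $ j) \<longlongrightarrow> surv_step \<mu> x0 (s x0) $ j) ?F"
    by (simp add: continuous_on_def)
  have "((\<lambda>x. \<Sum>i\<in>UNIV. D * \<bar>s x $ i - s x0 $ i\<bar>) \<longlongrightarrow> (\<Sum>i\<in>UNIV. D * \<bar>s x0 $ i - s x0 $ i\<bar>)) ?F"
    using cs unfolding continuous_on_def
    by (intro tendsto_sum tendsto_mult tendsto_rabs tendsto_diff tendsto_const) auto
  then have lim0: "((\<lambda>x. \<Sum>i\<in>UNIV. D * \<bar>s x $ i - s x0 $ i\<bar>) \<longlongrightarrow> 0) ?F" by simp
  have "norm (surv_step \<mu> x (s x) $ j - surv_step \<mu> x (s x0) $ j) \<le> (\<Sum>i\<in>UNIV. D * \<bar>s x $ i - s x0 $ i\<bar>)" for x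
    unfolding real_norm_def by (rule surv_step_lipschitz[OF s s])
  from Lim_null_comparison[OF always_eventually[OF allI[OF this]] lim0]
  have 2: "((\<lambda>x. surv_step \<mu> x (s x) $ j - surv_step \<mu> x (s x0) $ j) \<longlongrightarrow> 0) ?F" .
  from tendsto_add[OF 2 1] show "((\<lambda>x. surv_step \<mu> x (s x) $ j) \<longlongrightarrow> surv_step \<mu> x0 (s x0) $ j) ?F"
    by simp
qed

lemma continuous_surv_iter:
  assumes s: "s \<in> unit_cube"
  shows "continuous_on UNIV (\<lambda>x. surv_iter \<mu> T n x s $ j)"
proof (induction n arbitrary: j)
  case (Suc n)
  show ?case
    unfolding surv_iter_Suc_left
    by (intro continuous_surv_step surv_iter_cube s continuous_on_compose2[OF Suc T]) auto
qed (simp add: surv_iter_0)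

lemma surv_step_upper:
  assumes s: "s \<in> unit_cube"
  shows "surv_step \<mu> x s $ j \<le> (\<Sum>i\<in>UNIV. s $ i * mean_matrix \<mu> x $ i $ j)"
proof -
  have "measure_pmf.expectation (\<mu> x j) (\<lambda>k. 1 - (\<Sum>i\<in>UNIV. real (k $ i) * s $ i))
      \<le> measure_pmf.expectation (\<mu> x j) (mpow (1 - s))"
    by (intro integral_mono integrable_mpow one_minus_cube s mpow_one_minus_lower) (simp add: mean_int)
  moreover have "measure_pmf.expectation (\<mu> x j) (\<lambda>k. 1 - (\<Sum>i\<in>UNIV. real (k $ i) * s $ i)) =
      1 - (\<Sum>i\<in>UNIV. s $ i * mean_matrix \<mu> x $ i $ j)"
    using mean_int by (simp add: mean_eq mult.commute)
  ultimately show ?thesis unfolding surv_step_expectation[OF s] by simp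
qed

text \<open>
  The quadratic error of the linear approximation is absorbed into the linear term, because the
  latter is at least \<open>C\<close> times the total mass of \<open>s\<close>.
\<close>

lemma surv_step_lower:
  assumes s: "s \<in> unit_cube"
  shows "(1 - 2 * D / C * (\<Sum>i\<in>UNIV. s $ i)) * (\<Sum>i\<in>UNIV. s $ i * mean_matrix \<mu> x $ i $ j) \<le> surv_step \<mu> x s $ j"
proof -
  let ?\<sigma> = "\<Sum>i\<in>UNIV. s $ i" and ?m = "\<Sum>i\<in>UNIV. s $ i * mean_matrix \<mu> x $ i $ j"
  let ?A = "\<lambda>k :: nat ^ 'd. \<Sum>i\<in>UNIV. real (k $ i) * s $ i"
  have s0: "0 \<le> s $ i" for i using s by (simp add: unit_cube_def)
  have sq: "(?A k)\<^sup>2 = (\<Sum>i\<in>UNIV. \<Sum>l\<in>UNIV. s $ i * s $ l * (real (k $ i) * real (k $ l)))" for k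
    by (simp add: power2_eq_square sum_product mult_ac)
  have intsq: "integrable (\<mu> x j) (\<lambda>k. (?A k)\<^sup>2)" unfolding sq using second_moment(1) by simp
  have "measure_pmf.expectation (\<mu> x j) (\<lambda>k. (?A k)\<^sup>2) =
      (\<Sum>i\<in>UNIV. \<Sum>l\<in>UNIV. s $ i * s $ l * measure_pmf.expectation (\<mu> x j) (\<lambda>k. real (k $ i) * real (k $ l)))"
    unfolding sq using second_moment(1) by simp
  also have "\<dots> \<le> (\<Sum>i\<in>UNIV. \<Sum>l\<in>UNIV. s $ i * s $ l * (2 * D))"
    by (intro sum_mono mult_left_mono second_moment(2) mult_nonneg_nonneg s0)
  also have "\<dots> = 2 * D * ?\<sigma> * ?\<sigma>" by (simp add: sum_product sum_distrib_left mult_ac)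
  also have "\<dots> \<le> 2 * D * ?\<sigma> * (?m / C)"
  proof (rule mult_left_mono)
    have "C * ?\<sigma> \<le> ?m"
      unfolding sum_distrib_left mult.commute[of C] by (intro sum_mono mult_left_mono mean s0)
    then show "?\<sigma> \<le> ?m / C" using C by (simp add: field_simps)
    show "0 \<le> 2 * D * ?\<sigma>" using D_pos by (intro mult_nonneg_nonneg sum_nonneg s0) auto
  qed
  finally have sqb: "measure_pmf.expectation (\<mu> x j) (\<lambda>k. (?A k)\<^sup>2) \<le> 2 * D / C * ?\<sigma> * ?m" by simp
  have "measure_pmf.expectation (\<mu> x j) (mpow (1 - s)) \<le>
      measure_pmf.expectation (\<mu> x j) (\<lambda>k. 1 - ?A k + (?A k)\<^sup>2)"
    using mean_int intsq by (intro integral_mono integrable_mpow one_minus_cube s mpow_one_minus_upper) simp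
  also have "\<dots> = 1 - ?m + measure_pmf.expectation (\<mu> x j) (\<lambda>k. (?A k)\<^sup>2)"
    using mean_int intsq by (simp add: mean_eq mult.commute)
  finally show ?thesis using sqb unfolding surv_step_expectation[OF s] by (simp add: algebra_simps)
qed

text \<open>
  As long as the total mass is small, each step loses at most a factor \<open>1 - \<theta>\<close> against the linear
  map. The assumption on \<open>s\<close> keeps the mass small for \<open>n\<close> steps, since one step multiplies it by at
  most \<open>max 1 (CARD('d) * D)\<close>.
\<close>

lemma surv_iter_lower:
  assumes s: "s \<in> unit_cube" and \<theta>: "0 \<le> \<theta>" "\<theta> \<le> 1"
    and small: "2 * D / C * (max 1 (real CARD('d) * D)) ^ n * (\<Sum>i\<in>UNIV. s $ i) \<le> \<theta>"
  shows "(1 - \<theta>) ^ n * (\<Sum>i\<in>UNIV. s $ i * mean_cocycle \<mu> T n x $ i $ j) \<le> surv_iter \<mu> T n x s $ j"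
  using s small
proof (induction n arbitrary: s j)
  case 0
  have "(\<Sum>i\<in>UNIV. s $ i * (if i = j then 1 else 0)) = s $ j" by (simp add: if_distrib cong: if_cong)
  then show ?case by (simp add: surv_iter_0 mat_def)
next
  case (Suc n)
  let ?E = "max 1 (real CARD('d) * D)" and ?\<sigma> = "\<Sum>i\<in>UNIV. s $ i" and ?x = "(T ^^ n) x"
  let ?s = "surv_step \<mu> ?x s"
  have s0: "0 \<le> s $ i" for i using Suc.prems by (simp add: unit_cube_def)
  have \<sigma>0: "0 \<le> ?\<sigma>" by (intro sum_nonneg s0)
  have E1: "1 \<le> ?E" by simp
  have \<kappa>: "0 \<le> 2 * D / C" using C by simp
  have "(\<Sum>j\<in>UNIV. ?s $ j) \<le> (\<Sum>j\<in>(UNIV :: 'd set). D * ?\<sigma>)"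
  proof (rule sum_mono)
    fix j
    have "?s $ j \<le> (\<Sum>i\<in>UNIV. s $ i * mean_matrix \<mu> ?x $ i $ j)" by (rule surv_step_upper[OF Suc.prems(1)])
    also have "\<dots> \<le> (\<Sum>i\<in>UNIV. s $ i * D)" by (intro sum_mono mult_left_mono mean s0)
    finally show "?s $ j \<le> D * ?\<sigma>" by (simp add: sum_distrib_left mult.commute)
  qed
  also have "\<dots> \<le> ?E * ?\<sigma>" using \<sigma>0 by (simp add: mult.assoc[symmetric] mult_right_mono)
  finally have "2 * D / C * ?E ^ n * (\<Sum>j\<in>UNIV. ?s $ j) \<le> 2 * D / C * ?E ^ n * (?E * ?\<sigma>)"
    using \<kappa> E1 by (intro mult_left_mono mult_nonneg_nonneg zero_le_power) auto
  also have "\<dots> \<le> \<theta>" using Suc.prems(2) by (simp add: mult_ac)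
  finally have IH: "(1 - \<theta>) ^ n * (\<Sum>i\<in>UNIV. ?s $ i * mean_cocycle \<mu> T n x $ i $ j) \<le> surv_iter \<mu> T n x ?s $ j" for j
    by (intro Suc.IH surv_step_cube Suc.prems(1))
  have "2 * D / C * ?\<sigma> \<le> 2 * D / C * ?E ^ Suc n * ?\<sigma>"
    using \<kappa> one_le_power[OF E1, of "Suc n"] \<sigma>0
    by (intro mult_right_mono) (metis mult.right_neutral mult_left_mono)
  then have \<sigma>\<theta>: "2 * D / C * ?\<sigma> \<le> \<theta>" using Suc.prems(2) by linarith
  have low: "(1 - \<theta>) * (\<Sum>i\<in>UNIV. s $ i * mean_matrix \<mu> ?x $ i $ l) \<le> ?s $ l" for l
  proof -
    have "(1 - \<theta>) * (\<Sum>i\<in>UNIV. s $ i * mean_matrix \<mu> ?x $ i $ l) \<le>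
        (1 - 2 * D / C * ?\<sigma>) * (\<Sum>i\<in>UNIV. s $ i * mean_matrix \<mu> ?x $ i $ l)"
      using \<sigma>\<theta> by (intro mult_right_mono sum_nonneg mult_nonneg_nonneg s0 mean_nonneg) simp
    then show ?thesis using surv_step_lower[OF Suc.prems(1)] by (rule order_trans)
  qed
  have "(\<Sum>i\<in>UNIV. s $ i * mean_cocycle \<mu> T (Suc n) x $ i $ j) =
      (\<Sum>i\<in>UNIV. \<Sum>l\<in>UNIV. s $ i * mean_matrix \<mu> ?x $ i $ l * mean_cocycle \<mu> T n x $ l $ j)"
    by (simp add: matrix_matrix_mult_def sum_distrib_left mult.assoc)
  also have "\<dots> = (\<Sum>l\<in>UNIV. (\<Sum>i\<in>UNIV. s $ i * mean_matrix \<mu> ?x $ i $ l) * mean_cocycle \<mu> T n x $ l $ j)"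
    by (subst sum.swap) (simp add: sum_distrib_right)
  finally have "(1 - \<theta>) ^ Suc n * (\<Sum>i\<in>UNIV. s $ i * mean_cocycle \<mu> T (Suc n) x $ i $ j) =
      (1 - \<theta>) ^ n * (\<Sum>l\<in>UNIV. ((1 - \<theta>) * (\<Sum>i\<in>UNIV. s $ i * mean_matrix \<mu> ?x $ i $ l)) * mean_cocycle \<mu> T n x $ l $ j)"
    by (simp only: power_Suc sum_distrib_left mult_ac)
  also have "\<dots> \<le> (1 - \<theta>) ^ n * (\<Sum>l\<in>UNIV. ?s $ l * mean_cocycle \<mu> T n x $ l $ j)"
    using \<theta> by (intro mult_left_mono sum_mono mult_right_mono low cocycle_nonneg) auto
  also have "\<dots> \<le> surv_iter \<mu> T (Suc n) x s $ j" unfolding surv_iter_Suc by (rule IH)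
  finally show ?case .
qed

section \<open>Uniform convergence of the survival probabilities\<close>

lemma one_cube: "(1 :: real ^ 'd) \<in> unit_cube" by (simp add: unit_cube_def)

lemma scaled_one_cube: "0 \<le> e \<Longrightarrow> e \<le> 1 \<Longrightarrow> e *\<^sub>R (1 :: real ^ 'd) \<in> unit_cube"
  by (simp add: unit_cube_def)

lemma surv_iter_one_antimono: "surv_iter \<mu> T (n + m) x 1 $ j \<le> surv_iter \<mu> T n x 1 $ j"
proof -
  have c: "surv_iter \<mu> T m y 1 \<in> unit_cube" for y by (rule surv_iter_cube[OF one_cube])
  show ?thesis
    unfolding surv_iter_add using c by (intro surv_iter_mono one_cube) (auto simp: unit_cube_def)
qed

text \<open>
  Choose \<open>N\<close> such that the \<open>N\<close>-step mean matrix has all column sums at least \<open>2\<close>. For small \<open>e\<close>,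
  the \<open>N\<close>-step survival map loses at most half of this growth at the vector with all entries \<open>e\<close>,
  so it maps this vector above itself. By monotonicity the survival probabilities at multiples of
  \<open>N\<close>, and hence at all times, stay above \<open>e\<close>.
\<close>

lemma uniform_survival:
  assumes pos: "\<And>\<nu>. ergodic_prob T \<nu> \<Longrightarrow> lyapunov_exponent \<mu> T \<nu> > 0"
  obtains e where "0 < e" "e \<le> 1" "\<And>n x j. e \<le> surv_iter \<mu> T n x 1 $ j"
proof -
  obtain N where N: "N \<ge> 1" "\<And>x j. 2 \<le> (\<Sum>i\<in>UNIV. mean_cocycle \<mu> T N x $ i $ j)"
    using column_sums_growth[OF pos] by blast
  \<comment> \<open>By Bernoulli's inequality, \<open>(1 - \<theta>) ^ N\<close> is at least \<open>1 / 2\<close>.\<close>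
  define \<theta> where "\<theta> = 1 / (2 * real N)"
  have \<theta>: "0 < \<theta>" "\<theta> \<le> 1" using N(1) by (auto simp: \<theta>_def field_simps)
  \<comment> \<open>The smallness condition of \<open>surv_iter_lower\<close> for the vector with entries \<open>e\<close> is \<open>B * e \<le> \<theta>\<close>.\<close>
  define B where "B = 2 * D / C * (max 1 (real CARD('d) * D)) ^ N * real CARD('d)"
  have B: "0 < B" unfolding B_def using C D_pos by (intro mult_pos_pos zero_less_power divide_pos_pos) auto
  define e where "e = min 1 (\<theta> / B)"
  have e: "0 < e" "e \<le> 1" "B * e \<le> \<theta>" using \<theta> B by (auto simp: e_def min_def field_simps)
  let ?e = "e *\<^sub>R (1 :: real ^ 'd)"
  have ce: "?e \<in> unit_cube" using e by (intro scaled_one_cube) auto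
  have step: "e \<le> surv_iter \<mu> T N x ?e $ j" for x j
  proof -
    have "1 + real N * (- \<theta>) \<le> (1 + - \<theta>) ^ N"
      using \<theta> by (intro Bernoulli_inequality) simp
    then have half: "1 / 2 \<le> (1 - \<theta>) ^ N" using N(1) by (simp add: \<theta>_def)
    have "e = 1 / 2 * (e * 2)" by simp
    also have "\<dots> \<le> (1 - \<theta>) ^ N * (e * (\<Sum>i\<in>UNIV. mean_cocycle \<mu> T N x $ i $ j))"
      using half N(2)[of x j] e \<theta> by (intro mult_mono) auto
    also have "\<dots> = (1 - \<theta>) ^ N * (\<Sum>i\<in>UNIV. ?e $ i * mean_cocycle \<mu> T N x $ i $ j)"
      by (simp add: sum_distrib_left)
    also have "\<dots> \<le> surv_iter \<mu> T N x ?e $ j"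
      using \<theta> e(3) by (intro surv_iter_lower ce) (auto simp: B_def mult_ac)
    finally show ?thesis .
  qed
  have blocks: "e \<le> surv_iter \<mu> T (k * N) x 1 $ j" for k x j
  proof (induction k arbitrary: x j)
    case (Suc k)
    have "e \<le> surv_iter \<mu> T N x ?e $ j" by (rule step)
    also have "\<dots> \<le> surv_iter \<mu> T N x (surv_iter \<mu> T (k * N) ((T ^^ N) x) 1) $ j"
      using Suc by (intro surv_iter_mono ce surv_iter_cube one_cube) simp
    finally show ?case by (simp add: surv_iter_add)
  qed (simp add: surv_iter_0 e)
  have "e \<le> surv_iter \<mu> T n x 1 $ j" for n x j
  proof -
    obtain m where m: "n * N = n + m" using N(1) by (metis le_Suc_ex mult.right_neutral mult_le_mono2)
    have "e \<le> surv_iter \<mu> T (n + m) x 1 $ j" using blocks[of n x j] m by simp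
    also have "\<dots> \<le> surv_iter \<mu> T n x 1 $ j" by (rule surv_iter_one_antimono)
    finally show ?thesis .
  qed
  with e that show ?thesis by blast
qed

text \<open>
  The probability of having at least two children is continuous and positive on a compact space.
\<close>

lemma uniform_branching:
  obtains b where "0 < b" "b \<le> 1"
    "\<And>x j. b \<le> 1 - (pmf (\<mu> x j) 0 + (\<Sum>i\<in>UNIV. pmf (\<mu> x j) (axis i 1)))"
proof -
  let ?f = "\<lambda>j x. 1 - (pmf (\<mu> x j) 0 + (\<Sum>i\<in>UNIV. pmf (\<mu> x j) (axis i 1)))"
  have "continuous_on UNIV (\<lambda>x. pmf (\<mu> x j) k)" for j k
  proof -
    have "continuous_on UNIV (\<lambda>x. measure_pmf.expectation (\<mu> x j) (indicat_real {k}))"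
      by (rule continuous_expectation[where B=1]) (simp add: indicator_def)
    then show ?thesis by (simp add: pmf.rep_eq)
  qed
  then have c: "continuous_on UNIV (?f j)" for j by (intro continuous_intros)
  have "\<exists>y. \<forall>x. ?f j y \<le> ?f j x" for j
    using continuous_attains_inf[OF X _ c[of j]] by auto
  then obtain y where y: "\<And>j x. ?f j (y j) \<le> ?f j x" by metis
  define b where "b = Min (range (\<lambda>j. ?f j (y j)))"
  have b_le: "b \<le> ?f j x" for j x
  proof -
    have "b \<le> ?f j (y j)" unfolding b_def by (intro Min_le) auto
    then show ?thesis using y[of j x] by linarith
  qed
  have "b \<in> range (\<lambda>j. ?f j (y j))" unfolding b_def by (intro Min_in) auto
  then obtain j where "b = ?f j (y j)" by blast
  then have "0 < b" using nondeg[of "y j" j] by simp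
  moreover have "b \<le> 1"
  proof -
    have "0 \<le> pmf (\<mu> x j) 0 + (\<Sum>i\<in>UNIV. pmf (\<mu> x j) (axis i 1))" for x
      by (intro add_nonneg_nonneg sum_nonneg) auto
    from this[of "y j"] b_le[of "y j" j] show ?thesis by linarith
  qed
  ultimately show ?thesis using that b_le by blast
qed

text \<open>
  The iterates from the small vector catch up with those from \<open>1\<close>. If they are at least \<open>t\<close> times
  as large, strict concavity improves \<open>t\<close> to \<open>t + b * e\<^sup>2 * t * (1 - t)\<close> in the next step; as
  \<open>t \<ge> e\<close>, the deficit \<open>1 - t\<close> shrinks by the factor \<open>1 - b * e ^ 3\<close>. It starts from \<open>1 - e\<close>.
\<close>

lemma surv_iter_ratio:
  assumes e: "0 < e" "e \<le> 1" "\<And>n x j. e \<le> surv_iter \<mu> T n x 1 $ j"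
    and b: "0 < b" "b \<le> 1" "\<And>x j. b \<le> 1 - (pmf (\<mu> x j) 0 + (\<Sum>i\<in>UNIV. pmf (\<mu> x j) (axis i 1)))"
  shows "(1 - (1 - b * e ^ 3) ^ n * (1 - e)) * surv_iter \<mu> T n x 1 $ j \<le> surv_iter \<mu> T n x (e *\<^sub>R 1) $ j"
proof (induction n arbitrary: x j)
  case 0
  show ?case by (simp add: surv_iter_0)
next
  case (Suc n)
  define r where "r = 1 - b * e ^ 3"
  have be: "0 \<le> b * e ^ 3" "b * e ^ 3 \<le> 1"
    using b e by (auto intro!: mult_le_one power_le_one)
  have r: "0 \<le> r" "r \<le> 1" using be by (auto simp: r_def)
  define t where "t = 1 - r ^ n * (1 - e)"
  have rn: "0 \<le> r ^ n" "r ^ n \<le> 1" using r by (auto intro: power_le_one)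
  have "r ^ n * (1 - e) \<le> 1 * (1 - e)" using rn e by (intro mult_right_mono) auto
  then have t: "e \<le> t" "t \<le> 1" using rn e by (auto simp: t_def)
  let ?w = "surv_iter \<mu> T n (T x) 1" and ?v = "surv_iter \<mu> T n (T x) (e *\<^sub>R 1)"
  have cw: "?w \<in> unit_cube" by (rule surv_iter_cube[OF one_cube])
  have cv: "?v \<in> unit_cube" using e by (intro surv_iter_cube scaled_one_cube) auto
  have ct: "t *\<^sub>R ?w \<in> unit_cube" using cw t e by (auto simp: unit_cube_def mult_le_one)
  have w1: "surv_step \<mu> x ?w $ j \<le> 1" using surv_step_cube[OF cw, of \<mu> x] by (simp add: unit_cube_def)
  have "(1 - r ^ Suc n * (1 - e)) = t + b * e ^ 3 * (1 - t)"
    by (simp add: t_def r_def algebra_simps)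
  also have "\<dots> * surv_step \<mu> x ?w $ j \<le> t * surv_step \<mu> x ?w $ j + b * e\<^sup>2 * (t * (1 - t))"
  proof -
    have "b * e ^ 3 * (1 - t) * surv_step \<mu> x ?w $ j \<le> b * e ^ 3 * (1 - t) * 1"
      using w1 b e t by (intro mult_left_mono mult_nonneg_nonneg) auto
    also have "\<dots> = b * e\<^sup>2 * (e * (1 - t))" by (simp add: power3_eq_cube power2_eq_square)
    also have "\<dots> \<le> b * e\<^sup>2 * (t * (1 - t))"
      using b t by (intro mult_left_mono mult_right_mono) auto
    finally show ?thesis by (simp add: algebra_simps)
  qed
  also have "\<dots> \<le> surv_step \<mu> x (t *\<^sub>R ?w) $ j"
    using e t cw by (intro surv_step_concave_gap b e) (auto simp: unit_cube_def)
  also have "\<dots> \<le> surv_step \<mu> x ?v $ j"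
    using Suc.IH[of "T x"] by (intro surv_step_mono ct cv) (simp add: t_def r_def)
  finally show ?case by (simp only: r_def surv_iter_Suc_left)
qed

text \<open>
  Since all survival iterates from \<open>1\<close> are at least \<open>e\<close>, every later one lies between the
  \<open>n\<close>-th iterates started from \<open>e\<close> and from \<open>1\<close>. These are within \<open>r ^ n\<close> of each other, so the
  convergence to the extinction probability is uniform.
\<close>

theorem continuous_extinction_prob:
  assumes pos: "\<And>\<nu>. ergodic_prob T \<nu> \<Longrightarrow> lyapunov_exponent \<mu> T \<nu> > 0"
  shows "continuous_on UNIV (extinction_prob \<mu> T)"
proof -
  obtain e where e: "0 < e" "e \<le> 1" "\<And>n x j. e \<le> surv_iter \<mu> T n x 1 $ j"
    using uniform_survival[OF pos] by blast
  obtain b where b: "0 < b" "b \<le> 1"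
    "\<And>x j. b \<le> 1 - (pmf (\<mu> x j) 0 + (\<Sum>i\<in>UNIV. pmf (\<mu> x j) (axis i 1)))"
    using uniform_branching by blast
  define r where "r = 1 - b * e ^ 3"
  have r: "0 \<le> r" "r < 1"
    using b e by (auto simp: r_def intro!: mult_le_one power_le_one)
  have Q: "gen_iter \<mu> T n x 0 $ i = 1 - surv_iter \<mu> T n x 1 $ i" for n x i
    by (simp add: surv_iter_def)
  have gap: "surv_iter \<mu> T n x 1 $ i - surv_iter \<mu> T (n + m) x 1 $ i \<le> r ^ n" for n m x i
  proof -
    let ?P = "surv_iter \<mu> T n x 1 $ i"
    have P: "0 \<le> ?P" "?P \<le> 1" using surv_iter_cube[OF one_cube, of \<mu> T n x] by (auto simp: unit_cube_def)
    have "(1 - r ^ n * (1 - e)) * ?P \<le> surv_iter \<mu> T n x (e *\<^sub>R 1) $ i"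
      unfolding r_def by (rule surv_iter_ratio[OF e b])
    also have "\<dots> \<le> surv_iter \<mu> T (n + m) x 1 $ i"
      unfolding surv_iter_add
      using e by (intro surv_iter_mono scaled_one_cube surv_iter_cube one_cube) auto
    finally have "?P - surv_iter \<mu> T (n + m) x 1 $ i \<le> r ^ n * ((1 - e) * ?P)" by (simp add: algebra_simps)
    also have "\<dots> \<le> r ^ n * 1"
      using r e P by (intro mult_left_mono mult_le_one) auto
    finally show ?thesis by simp
  qed
  have near: "\<bar>gen_iter \<mu> T n x 0 $ i - extinction_prob \<mu> T x $ i\<bar> \<le> r ^ n" for n x i
  proof -
    have lim: "(\<lambda>m. gen_iter \<mu> T (n + m) x 0 $ i) \<longlonglongrightarrow> extinction_prob \<mu> T x $ i"
      using LIMSEQ_ignore_initial_segment[OF extinction_prob_limit[where \<mu>=\<mu> and T=T and x=x and i=i], of n] by (simp add: add.commute)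
    have "gen_iter \<mu> T (n + m) x 0 $ i \<le> gen_iter \<mu> T n x 0 $ i + r ^ n" for m
      using gap[where n=n and m=m and x=x and i=i] unfolding Q by simp
    then have "extinction_prob \<mu> T x $ i \<le> gen_iter \<mu> T n x 0 $ i + r ^ n"
      by (intro LIMSEQ_le_const2[OF lim]) blast
    moreover have "gen_iter \<mu> T n x 0 $ i \<le> gen_iter \<mu> T (n + m) x 0 $ i" for m
      using surv_iter_one_antimono[where n=n and m=m and x=x and j=i] unfolding Q by simp
    then have "gen_iter \<mu> T n x 0 $ i \<le> extinction_prob \<mu> T x $ i"
      by (intro LIMSEQ_le_const[OF lim]) blast
    ultimately show ?thesis using r by simp
  qed
  have "continuous_on UNIV (\<lambda>x. extinction_prob \<mu> T x $ i)" for i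
  proof (rule uniform_limit_theorem)
    show "\<forall>\<^sub>F n in sequentially. continuous_on UNIV (\<lambda>x. gen_iter \<mu> T n x 0 $ i)"
      unfolding Q by (intro always_eventually allI continuous_on_diff continuous_on_const
          continuous_surv_iter one_cube)
    show "uniform_limit UNIV (\<lambda>n x. gen_iter \<mu> T n x 0 $ i) (\<lambda>x. extinction_prob \<mu> T x $ i) sequentially"
    proof (rule uniform_limitI)
      fix d :: real assume "d > 0"
      have "(\<lambda>n. r ^ n) \<longlonglongrightarrow> 0" using r by (intro LIMSEQ_power_zero) simp
      then have "\<forall>\<^sub>F n in sequentially. r ^ n < d" by (rule order_tendstoD(2)) fact
      then show "\<forall>\<^sub>F n in sequentially. \<forall>x\<in>UNIV. dist (gen_iter \<mu> T n x 0 $ i) (extinction_prob \<mu> T x $ i) < d"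
      proof eventually_elim
        case (elim n)
        then show ?case using near[where n=n and i=i] unfolding dist_real_def by (meson le_less_trans)
      qed
    qed
  qed simp
  then have "continuous_on UNIV (\<lambda>x. \<chi> i. extinction_prob \<mu> T x $ i)"
    by (rule continuous_on_vec_lambda)
  then show ?thesis by simp
qed

end

theorem theorem3p5:
  fixes T :: "'x::metric_space \<Rightarrow> 'x"
    and \<mu> :: "'x \<Rightarrow> 'd::finite \<Rightarrow> (nat ^ 'd) pmf"
  assumes compact_X: "compact (UNIV :: 'x set)"
    and cont_T: "continuous_on UNIV T"
    and cont_mu: "continuous_map euclidean (product_topology (\<lambda>_. weak_pmf_topology) UNIV) \<mu>"
    and nondegenerate:
      "\<forall>x i. 0 \<le> pmf (\<mu> x i) 0 + (\<Sum>j\<in>UNIV. pmf (\<mu> x i) (axis j 1)) \<and>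
             pmf (\<mu> x i) 0 + (\<Sum>j\<in>UNIV. pmf (\<mu> x i) (axis j 1)) < 1"
    and moments:
      "\<exists>C D. 0 < C \<and> C \<le> D \<and>
         (\<forall>x i j. partial_differentiable i (gen_fun (\<mu> x j)) 1 \<and>
            C \<le> mean_matrix \<mu> x $ i $ j \<and> mean_matrix \<mu> x $ i $ j \<le> D) \<and>
         (\<forall>x i j k. partial_differentiable i (partial_deriv j (gen_fun (\<mu> x k))) 1 \<and>
            partial_deriv i (partial_deriv j (gen_fun (\<mu> x k))) 1 \<le> D)"
    and supercritical: "\<forall>\<nu>. ergodic_prob T \<nu> \<longrightarrow> lyapunov_exponent \<mu> T \<nu> > 0"
  shows "continuous_on UNIV (extinction_prob \<mu> T)"
proof -
  obtain C D where CD: "0 < C" "C \<le> D"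
    "\<And>x i j. partial_differentiable i (gen_fun (\<mu> x j)) 1 \<and>
        C \<le> mean_matrix \<mu> x $ i $ j \<and> mean_matrix \<mu> x $ i $ j \<le> D"
    "\<And>x i j k. partial_differentiable i (partial_deriv j (gen_fun (\<mu> x k))) 1 \<and>
        partial_deriv i (partial_deriv j (gen_fun (\<mu> x k))) 1 \<le> D"
    using moments by blast
  interpret gw_environment T \<mu> C D
    by unfold_locales (use compact_X cont_T cont_mu nondegenerate CD in blast)+
  show ?thesis using supercritical by (intro continuous_extinction_prob) blast
qed

end
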